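(* Let $d\in\mathbb{N}$, $1\le p<2$, $1\le q\le\infty$ and $s>d/2$. Let $U$ be the closed unit ball of $B^s_{pq}(\mathbb{R}^d)$ and let $\mathcal{U}$ be any set of functions obtained by selecting one arbitrary representative from every equivalence class $[f]_\lambda\in U$. Let $\mathbb{P}$ be a probability measure on $\mathbb{R}^d$ with a density $\varphi$ with respect to Lebesgue measure such that $\|\varphi\langle x\rangle^{d}\|_{\infty,\lambda}<\infty$. Then $\mathcal{U}$ is $\mathbb{P}$-pregaussian.
   Context: $\lambda$ is Lebesgue measure on $\mathbb{R}^d$, $\|h\|_{r,\mu}=(\int|h|^r d\mu)^{1/r}$ (essential supremum if $r=\infty$), and $\langle x\rangle^\gamma=(1+\|x\|^2)^{\gamma/2}$. Besov spaces: fix a $C^\infty$ function $\varphi_0$ on $\mathbb{R}^d$ with $\varphi_0(x)=1$ for $\|x\|\le1$, $\varphi_0(x)=0$ for $\|x\|\ge3/2$; put $\varphi_1(x)=\varphi_0(x/2)-\varphi_0(x)$, $\varphi_k(x)=\varphi_1(2^{-k+1}x)$. For a tempered distribution $T$, $\|T\|_{s,p,q,\lambda}=\big(\sum_{k\ge0}2^{ksq}\|F^{-1}(\varphi_kFT)\|_{p,\lambda}^q\big)^{1/q}$ (sup-modification for $q=\infty$), $F$ the Fourier transform. $B^s_{pq}(\mathbb{R}^d)$ is the space of real tempered distributions with finite norm; for $s>0$ its elements are equivalence classes (modulo Lebesgue-a.e. equality) of $p$-integrable functions. Pregaussian: for $\mathcal{F}\subseteq\mathcal{L}^2(\mathbb{P})$,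 a Brownian bridge on $\mathcal{F}$ is a centered Gaussian process $\mathbb{G}$ with covariance $E\mathbb{G}(f)\mathbb{G}(g)=\mathbb{P}[(f-\mathbb{P}f)(g-\mathbb{P}g)]$ and induced semimetric $\rho(f,g)=(E[\mathbb{G}(f)-\mathbb{G}(g)]^2)^{1/2}$; $\mathcal{F}$ is $\mathbb{P}$-pregaussian if such $\mathbb{G}$ can be defined with all sample paths bounded and uniformly $\rho$-continuous on $\mathcal{F}$. *)

theory Defs
  imports "HOL-Analysis.Analysis" "HOL-Probability.Probability"
begin

fun iter_dirderiv :: "'a::euclidean_space list \<Rightarrow> ('a \<Rightarrow> real) \<Rightarrow> 'a \<Rightarrow> real" where
  "iter_dirderiv [] f = f"
| "iter_dirderiv (v # vs) f = (\<lambda>x. frechet_derivative (iter_dirderiv vs f) (at x) v)"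

definition smooth_fun :: "('a::euclidean_space \<Rightarrow> real) \<Rightarrow> bool" where
  "smooth_fun f \<longleftrightarrow> (\<forall>vs x. iter_dirderiv vs f differentiable (at x))"

definition admissible_phi0 :: "('a::euclidean_space \<Rightarrow> real) \<Rightarrow> bool" where
  "admissible_phi0 \<phi>0 \<longleftrightarrow> smooth_fun \<phi>0 \<and>
     (\<forall>x. norm x \<le> 1 \<longrightarrow> \<phi>0 x = 1) \<and> (\<forall>x. norm x \<ge> 3/2 \<longrightarrow> \<phi>0 x = 0)"

definition phik :: "('a::euclidean_space \<Rightarrow> real) \<Rightarrow> nat \<Rightarrow> 'a \<Rightarrow> real" where
  "phik \<phi>0 k x = (if k = 0 then \<phi>0 x
      else \<phi>0 ((1 / 2 ^ k) *\<^sub>R x) - \<phi>0 ((1 / 2 ^ (k - 1)) *\<^sub>R x))"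

text \<open>Inverse Fourier transform of phi_k, with the convention
  F g(xi) = int g(x) exp(-i x.xi) dx, F^-1 h(x) = (2 pi)^-d int h(xi) exp(i x.xi) dxi.\<close>
definition psik :: "('a::euclidean_space \<Rightarrow> real) \<Rightarrow> nat \<Rightarrow> 'a \<Rightarrow> complex" where
  "psik \<phi>0 k x = complex_of_real (1 / (2 * pi) ^ DIM('a)) *
      (CLINT \<xi>|lebesgue. complex_of_real (phik \<phi>0 k \<xi>) * cis (x \<bullet> \<xi>))"

text \<open>F^-1(phi_k F f) for an L^p function f is the convolution f * F^-1 phi_k.\<close>
definition dyadic_block :: "('a::euclidean_space \<Rightarrow> real) \<Rightarrow> nat \<Rightarrow> ('a \<Rightarrow> real) \<Rightarrow> 'a \<Rightarrow> complex" where
  "dyadic_block \<phi>0 k f x = (CLINT y|lebesgue. complex_of_real (f y) * psik \<phi>0 k (x - y))"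

definition enn_powr :: "ennreal \<Rightarrow> real \<Rightarrow> ennreal" where
  "enn_powr a r = (if a = \<infinity> then \<infinity> else ennreal (enn2real a powr r))"

definition Lp_norm :: "real \<Rightarrow> ('a::euclidean_space \<Rightarrow> complex) \<Rightarrow> ennreal" where
  "Lp_norm p h = enn_powr (\<integral>\<^sup>+ x. ennreal (norm (h x) powr p) \<partial>lebesgue) (1 / p)"

definition besov_norm ::
  "('a::euclidean_space \<Rightarrow> real) \<Rightarrow> real \<Rightarrow> real \<Rightarrow> ennreal \<Rightarrow> ('a \<Rightarrow> real) \<Rightarrow> ennreal" where
  "besov_norm \<phi>0 s p q f =
     (if q = \<infinity> then (SUP k. ennreal (2 powr (real k * s)) * Lp_norm p (dyadic_block \<phi>0 k f))
      else enn_powr (\<Sum>k. enn_powr (ennreal (2 powr (real k * s)) * Lp_norm p (dyadic_block \<phi>0 k f))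
                             (enn2real q))
                    (1 / enn2real q))"

text \<open>f represents an element of the closed unit ball of B^s_pq (for s > 0 the elements
  are classes of p-integrable functions).\<close>
definition in_besov_unit_ball ::
  "('a::euclidean_space \<Rightarrow> real) \<Rightarrow> real \<Rightarrow> real \<Rightarrow> ennreal \<Rightarrow> ('a \<Rightarrow> real) \<Rightarrow> bool" where
  "in_besov_unit_ball \<phi>0 s p q f \<longleftrightarrow>
     f \<in> borel_measurable lebesgue \<and> integrable lebesgue (\<lambda>x. \<bar>f x\<bar> powr p) \<and>
     besov_norm \<phi>0 s p q f \<le> 1"

definition centered_normal_rv :: "'w measure \<Rightarrow> ('w \<Rightarrow> real) \<Rightarrow> real \<Rightarrow> bool" where
  "centered_normal_rv M X v \<longleftrightarrow>
     (v = 0 \<longrightarrow> (AE \<omega> in M. X \<omega> = 0)) \<and>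
     (v \<noteq> 0 \<longrightarrow> distributed M lborel X (\<lambda>x. ennreal (normal_density 0 (sqrt v) x)))"

definition bb_cov :: "'x measure \<Rightarrow> ('x \<Rightarrow> real) \<Rightarrow> ('x \<Rightarrow> real) \<Rightarrow> real" where
  "bb_cov P f g = (\<integral>x. (f x - (\<integral>y. f y \<partial>P)) * (g x - (\<integral>y. g y \<partial>P)) \<partial>P)"

definition bb_rho :: "'x measure \<Rightarrow> ('x \<Rightarrow> real) \<Rightarrow> ('x \<Rightarrow> real) \<Rightarrow> real" where
  "bb_rho P f g = sqrt (\<integral>x. ((f x - (\<integral>y. f y \<partial>P)) - (g x - (\<integral>y. g y \<partial>P)))\<^sup>2 \<partial>P)"

text \<open>Brownian bridge on F: centered Gaussian process (all finite linear combinations are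
  centered normal with the prescribed variance) on some probability space. The sample space
  is taken to be the path space, which is no loss of generality.\<close>
definition pregaussian :: "'x measure \<Rightarrow> ('x \<Rightarrow> real) set \<Rightarrow> bool" where
  "pregaussian P F \<longleftrightarrow>
     (\<forall>f\<in>F. f \<in> borel_measurable P \<and> integrable P (\<lambda>x. (f x)\<^sup>2)) \<and>
     (\<exists>(\<Omega> :: (('x \<Rightarrow> real) \<Rightarrow> real) measure) G.
        prob_space \<Omega> \<and>
        (\<forall>f\<in>F. G f \<in> borel_measurable \<Omega>) \<and>
        (\<forall>S a. finite S \<longrightarrow> S \<subseteq> F \<longrightarrow>
           centered_normal_rv \<Omega> (\<lambda>\<omega>. \<Sum>f\<in>S. a f * G f \<omega>)
             (\<Sum>f\<in>S. \<Sum>g\<in>S. a f * a g * bb_cov P f g)) \<and>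
        (\<forall>\<omega>\<in>space \<Omega>. bounded ((\<lambda>f. G f \<omega>) ` F) \<and>
           (\<forall>e>0. \<exists>\<delta>>0. \<forall>f\<in>F. \<forall>g\<in>F. bb_rho P f g < \<delta> \<longrightarrow> \<bar>G f \<omega> - G g \<omega>\<bar> < e)))"

end

theory Submission
  imports Defs
begin

text \<open>
  Let \<open>f = \<Sum>k. f\<^sub>k\<close> be the Littlewood-Paley decomposition of a function in the unit ball. The block
  \<open>f\<^sub>k\<close> is reproduced by convolution with a kernel \<open>\<chi>\<^sub>k\<close> that lives on scale \<open>2^(-k)\<close>. For \<open>h\<close> in
  \<open>L\<^sup>2(P)\<close>, Young's inequality therefore bounds \<open>\<integral> f h dP\<close>, uniformly over the ball, by weighted
  \<open>L\<^sup>r\<close> norms of \<open>y \<mapsto> \<integral> \<chi>\<^sub>k(x - y) h(x) dP(x)\<close> with some \<open>r > 2\<close>.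

  Take \<open>h\<close> to be a block of a random series \<open>\<Sum>j. \<xi>\<^sub>j e\<^sub>j\<close> with independent standard normal \<open>\<xi>\<^sub>j\<close> and an
  orthonormal basis \<open>e\<close> of \<open>L\<^sup>2(P)\<close>. By Bessel's inequality and the moments of the normal distribution,
  the \<open>r\<close>-th moments of these norms are controlled by \<open>\<integral> (\<integral> |\<chi>\<^sub>k(x - y)|^2 dP(x))^(r/2) dy\<close>. The weight
  condition on the density makes this \<open>O(2^(k d r / 2))\<close>, because \<open>(1 + |y|)^(- d r / 2)\<close> is integrable
  for \<open>r > 2\<close>, and \<open>s > d / 2\<close> makes the sum over \<open>k\<close> converge. By dominated convergence the expected
  supremum over the ball of the tails of the series tends to \<open>0\<close>. So, along a subsequence, the partial
  sums of \<open>\<Sum>j. \<xi>\<^sub>j \<integral> f e\<^sub>j dP\<close> converge uniformly in \<open>f\<close>, and they are Lipschitz for the intrinsic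
  semimetric.
\<close>

section \<open>Fourier inversion and decay\<close>

text \<open>The weight of order d is borderline: \<open>(1 + norm y) powr (- d)\<close> just fails
  to be integrable, so a pure L^2 duality would diverge logarithmically in space. This is where p <
  2 enters: the blocks are placed in L^t with p < t < 2, whose conjugate exponent r is finite and
  exceeds 2. Passing from p to t costs d/p - d/t derivatives, which the gap s - d/2 pays if t is
  close to p. The surplus that remains is split into two halves \<eta>: one makes the Young terms of
  the blocks summable, the other makes the kernel norms decay in k. All q are treated at once
  through the ball for q = infinity, which contains the others. The first basis vector is the
  constant 1; omitting it turns the isonormal process of L^2(P) into the Brownian bridge. The sample
  space is prescribed as a space of functions on functions, hence the noise is a product measure
  there, of which the coordinates at constant functions are used. Path properties are demanded for
  every sample, so paths are set to 0 on the null set where the series of bounds diverges.\<close>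

lemma nn_integral_lborel_affine:
  fixes f :: "'a::euclidean_space \<Rightarrow> ennreal"
  assumes [measurable]: "f \<in> borel_measurable borel" and c: "c \<noteq> 0"
  shows "(\<integral>\<^sup>+x. f (t + c *\<^sub>R x) \<partial>lborel) = ennreal (1 / \<bar>c\<bar> ^ DIM('a)) * (\<integral>\<^sup>+x. f x \<partial>lborel)"
proof -
  have "(\<integral>\<^sup>+x. f x \<partial>lborel) = (\<integral>\<^sup>+x. f x \<partial>density (distr lborel borel (\<lambda>x. t + c *\<^sub>R x)) (\<lambda>_. \<bar>c\<bar> ^ DIM('a)))"
    using lborel_affine[OF c, of t] by simp
  also have "\<dots> = ennreal (\<bar>c\<bar> ^ DIM('a)) * (\<integral>\<^sup>+x. f (t + c *\<^sub>R x) \<partial>lborel)"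
    by (simp add: nn_integral_density nn_integral_distr nn_integral_cmult)
  finally show ?thesis
    using c by (simp add: mult.assoc[symmetric] ennreal_mult[symmetric])
qed

lemma lborel_integral_affine:
  fixes f :: "'a::euclidean_space \<Rightarrow> 'b::{banach, second_countable_topology}"
  assumes f: "f \<in> borel_measurable borel" and c: "c \<noteq> 0"
  shows lborel_integrable_affine_iff: "integrable lborel (\<lambda>x. f (t + c *\<^sub>R x)) \<longleftrightarrow> integrable lborel f"
    and lborel_integral_affine_eq: "(\<integral>x. f (t + c *\<^sub>R x) \<partial>lborel) = (1 / \<bar>c\<bar> ^ DIM('a)) *\<^sub>R (\<integral>x. f x \<partial>lborel)"
proof -
  have eq: "lborel = density (distr lborel borel (\<lambda>x. t + c *\<^sub>R x :: 'a)) (\<lambda>_. ennreal (\<bar>c\<bar> ^ DIM('a)))"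
    using lborel_affine[OF c, of t] by (simp add: ennreal_power)
  have "integrable lborel f \<longleftrightarrow> integrable lborel (\<lambda>x. \<bar>c\<bar> ^ DIM('a) *\<^sub>R f (t + c *\<^sub>R x))"
    using f by (subst eq) (simp add: integrable_density integrable_distr_eq)
  then show "integrable lborel (\<lambda>x. f (t + c *\<^sub>R x)) \<longleftrightarrow> integrable lborel f"
    using c integrable_scaleR_right[of "1 / \<bar>c\<bar> ^ DIM('a)" lborel "\<lambda>x. \<bar>c\<bar> ^ DIM('a) *\<^sub>R f (t + c *\<^sub>R x)"]
    by auto
  have "(\<integral>x. f x \<partial>lborel) = \<bar>c\<bar> ^ DIM('a) *\<^sub>R (\<integral>x. f (t + c *\<^sub>R x) \<partial>lborel)"
    using f by (subst eq) (simp add: integral_density integral_distr)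
  then show "(\<integral>x. f (t + c *\<^sub>R x) \<partial>lborel) = (1 / \<bar>c\<bar> ^ DIM('a)) *\<^sub>R (\<integral>x. f x \<partial>lborel)"
    using c by simp
qed

text \<open>Decompose into dyadic shells: the integral over \<open>2^(n-1) < |x| \<le> 2^n\<close> is \<open>O(2^(n(d - M)))\<close>.\<close>
lemma nn_integral_polynomial_decay:
  fixes M :: real
  assumes M: "M > real DIM('a::euclidean_space)"
  shows "(\<integral>\<^sup>+(x::'a). ennreal ((1 + norm x) powr (- M)) \<partial>lborel) < \<infinity>"
proof -
  let ?d = "DIM('a)"
  define w where "w n = 2 powr M * (2 powr (- M)) ^ n" for n :: nat
  have [measurable]: "(indicator (cball 0 (2 ^ n)) :: 'a \<Rightarrow> ennreal) \<in> borel_measurable borel" for n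
    by (rule borel_measurable_indicator) simp
  have w_nonneg: "w n \<ge> 0" for n by (simp add: w_def)
  have "(\<integral>\<^sup>+(x::'a). ennreal ((1 + norm x) powr (- M)) \<partial>lborel)
    \<le> (\<integral>\<^sup>+(x::'a). (\<Sum>n. ennreal (w n) * indicator (cball 0 (2 ^ n)) x) \<partial>lborel)"
  proof (rule nn_integral_mono)
    fix x :: 'a
    define n where "n = (LEAST n. norm x \<le> 2 ^ n)"
    have "\<exists>n. norm x \<le> 2 ^ n" using real_arch_pow[of 2 "norm x"] by (auto intro: less_imp_le)
    then have n: "norm x \<le> 2 ^ n" unfolding n_def by (rule LeastI_ex)
    \<comment> \<open>Minimality of \<open>n\<close> gives \<open>norm x > 2 ^ (n - 1)\<close> for
      positive \<open>n\<close>; the added 1 also covers \<open>n = 0\<close>, so one formula for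
      \<open>w n\<close> serves all shells.\<close>
    have "2 ^ n \<le> 2 * (1 + norm x)"
    proof (cases n)
      case (Suc m)
      then have "\<not> norm x \<le> 2 ^ m" using not_less_Least[of m "\<lambda>n. norm x \<le> 2 ^ n"] by (simp add: n_def)
      then show ?thesis using Suc by simp
    qed simp
    then have "(2 * (1 + norm x)) powr (- M) \<le> (2 ^ n) powr (- M)"
      using M by (intro powr_mono2') auto
    moreover have "(1 + norm x) powr (- M) = 2 powr M * (2 * (1 + norm x)) powr (- M)"
      by (subst powr_mult) (auto simp: mult.assoc[symmetric] simp flip: powr_add)
    ultimately have "(1 + norm x) powr (- M) \<le> 2 powr M * (2 ^ n) powr (- M)"
      by simp
    also have "(2 ^ n) powr (- M) = (2 powr (- M)) ^ n"
      by (simp add: powr_powr mult.commute flip: powr_realpow)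
    finally have "(1 + norm x) powr (- M) \<le> w n" by (simp only: w_def)
    then have "ennreal ((1 + norm x) powr (- M)) \<le> ennreal (w n) * indicator (cball 0 (2 ^ n)) x"
      using n by (simp add: ennreal_leI)
    also have "v n \<le> (\<Sum>n. v n)" for v :: "nat \<Rightarrow> ennreal"
      using sum_le_suminf[of v "{n}"] by simp
    finally show "ennreal ((1 + norm x) powr (- M)) \<le> (\<Sum>n. ennreal (w n) * indicator (cball 0 (2 ^ n)) x)" .
  qed
  also have "\<dots> = (\<Sum>n. ennreal (w n) * emeasure lborel (cball (0::'a) (2 ^ n)))"
    by (subst nn_integral_suminf) (auto intro!: suminf_cong nn_integral_cmult_indicator)
  also have "\<dots> = (\<Sum>n. ennreal (2 powr M * unit_ball_vol (real ?d) * (2 powr (?d - M)) ^ n))"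
  proof (rule suminf_cong)
    fix n :: nat
    have "(2 powr (- M)) ^ n * (2 ^ n) ^ ?d = (2 powr (?d - M)) ^ n"
      by (simp add: powr_diff powr_minus powr_realpow power_divide field_simps flip: power_mult)
    then have "w n * (2 ^ n) ^ ?d = 2 powr M * (2 powr (?d - M)) ^ n" by (simp only: w_def mult.assoc)
    then show "ennreal (w n) * emeasure lborel (cball (0::'a) (2 ^ n))
       = ennreal (2 powr M * unit_ball_vol (real ?d) * (2 powr (?d - M)) ^ n)"
      by (simp add: emeasure_cball w_nonneg ennreal_mult[symmetric])
  qed
  also have "\<dots> < \<infinity>"
  proof -
    have "summable (\<lambda>n. 2 powr M * unit_ball_vol (real ?d) * (2 powr (?d - M)) ^ n)"
      using M by (intro summable_mult summable_geometric) (simp add: powr_less_one)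
    then show ?thesis by (subst suminf_ennreal2) auto
  qed
  finally show ?thesis .
qed

lemma integrable_polynomial_decay:
  assumes "n > DIM('a::euclidean_space)"
  shows "integrable lborel (\<lambda>x::'a. 1 / (1 + norm x) ^ n)"
proof (rule integrableI_nonneg)
  have "(\<integral>\<^sup>+(x::'a). ennreal (1 / (1 + norm x) ^ n) \<partial>lborel) = (\<integral>\<^sup>+(x::'a). ennreal ((1 + norm x) powr (- real n)) \<partial>lborel)"
    by (intro nn_integral_cong) (simp add: powr_minus divide_inverse powr_realpow add_pos_nonneg)
  also have "\<dots> < \<infinity>" using assms by (intro nn_integral_polynomial_decay) simp
  finally show "(\<integral>\<^sup>+(x::'a). ennreal (1 / (1 + norm x) ^ n) \<partial>lborel) < \<infinity>" .
qed auto

text \<open>Normalised as \<open>psik\<close>, but taken over \<open>lborel\<close> instead of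
  \<open>lebesgue\<close>, where product measures and affine substitutions are at hand;
  \<open>integral_completion\<close> passes between the two.\<close>

definition inv_fourier :: "('a::euclidean_space \<Rightarrow> real) \<Rightarrow> 'a \<Rightarrow> complex" where
  "inv_fourier a x = complex_of_real (1 / (2 * pi) ^ DIM('a)) *
     (CLINT \<xi>|lborel. complex_of_real (a \<xi>) * cis (x \<bullet> \<xi>))"

lemma measurable_cis [measurable (raw)]:
  "f \<in> borel_measurable M \<Longrightarrow> (\<lambda>x. cis (f x)) \<in> borel_measurable M"
  using measurable_compose[of f M borel cis borel] borel_measurable_continuous_onI[of cis] continuous_on_cis[OF continuous_on_id]
  by simp

lemma measurable_inv_fourier [measurable]:
  assumes [measurable]: "a \<in> borel_measurable borel"
  shows "inv_fourier a \<in> borel_measurable borel"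
  unfolding inv_fourier_def by measurable

lemma integrable_times_cis:
  fixes a :: "'a::euclidean_space \<Rightarrow> complex"
  assumes "integrable M a" "f \<in> borel_measurable M"
  shows "integrable M (\<lambda>\<xi>. a \<xi> * cis (f \<xi>))"
  using assms by (intro Bochner_Integration.integrable_bound[OF assms(1)]) (auto simp: norm_mult)

lemma inv_fourier_diff:
  assumes "integrable lborel a" "integrable lborel b"
  shows "inv_fourier (\<lambda>\<xi>. a \<xi> - b \<xi>) x = inv_fourier a x - inv_fourier b x"
  using integrable_times_cis[of lborel "\<lambda>\<xi>. complex_of_real (a \<xi>)" "\<lambda>\<xi>. x \<bullet> \<xi>"]
    integrable_times_cis[of lborel "\<lambda>\<xi>. complex_of_real (b \<xi>)" "\<lambda>\<xi>. x \<bullet> \<xi>"] assms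
  by (simp add: inv_fourier_def left_diff_distrib right_diff_distrib)

lemma inv_fourier_scale:
  fixes a :: "'a::euclidean_space \<Rightarrow> real"
  assumes [measurable]: "a \<in> borel_measurable borel" and c: "c > 0"
  shows "inv_fourier (\<lambda>\<xi>. a ((1 / c) *\<^sub>R \<xi>)) x = complex_of_real (c ^ DIM('a)) * inv_fourier a (c *\<^sub>R x)"
proof -
  have "(CLINT \<xi>|lborel. complex_of_real (a (0 + (1 / c) *\<^sub>R \<xi>)) * cis ((c *\<^sub>R x) \<bullet> (0 + (1 / c) *\<^sub>R \<xi>)))
    = (1 / \<bar>1 / c\<bar> ^ DIM('a)) *\<^sub>R (CLINT \<xi>|lborel. complex_of_real (a \<xi>) * cis ((c *\<^sub>R x) \<bullet> \<xi>))"
    by (rule lborel_integral_affine_eq) (use c in auto)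
  then show ?thesis
    using c by (simp add: inv_fourier_def power_divide scaleR_conv_of_real)
qed

text \<open>Fubini in coordinates: \<open>lborel\<close> is the image of a product of
  one-dimensional Lebesgue measures. It reduces the Gaussian integral to dimension one.\<close>

lemma integral_lborel_prod:
  fixes f :: "'a::euclidean_space \<Rightarrow> real \<Rightarrow> complex"
  assumes "\<And>b. b \<in> Basis \<Longrightarrow> integrable lborel (f b)"
  shows "(CLINT x|lborel. (\<Prod>b\<in>Basis. f b (x \<bullet> b))) = (\<Prod>b\<in>Basis. CLINT t|lborel. f b t)"
proof -
  interpret product_sigma_finite "\<lambda>_::'a. lborel :: real measure" ..
  have [measurable]: "f b \<in> borel_measurable borel" if "b \<in> Basis" for b
    using assms[OF that] by (simp add: borel_measurable_integrable)
  have "(CLINT x|lborel. (\<Prod>b\<in>Basis. f b (x \<bullet> b)))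
    = (CLINT x|distr (\<Pi>\<^sub>M b\<in>Basis. lborel) borel (\<lambda>f. \<Sum>b\<in>Basis. f b *\<^sub>R b :: 'a). (\<Prod>b\<in>Basis. f b (x \<bullet> b)))"
    by (subst lborel_eq) simp
  also have "\<dots> = (CLINT y|(\<Pi>\<^sub>M b\<in>Basis. lborel). (\<Prod>b\<in>Basis. f b ((\<Sum>c\<in>Basis. y c *\<^sub>R c :: 'a) \<bullet> b)))"
    by (subst integral_distr) auto
  also have "\<dots> = (CLINT y|(\<Pi>\<^sub>M b\<in>Basis. lborel). (\<Prod>b\<in>Basis. f b (y b)))"
    by (intro Bochner_Integration.integral_cong prod.cong refl) (simp add: inner_sum_left_Basis)
  also have "\<dots> = (\<Prod>b\<in>Basis. CLINT t|lborel. f b t)"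
    by (rule product_integral_prod) (use assms in auto)
  finally show ?thesis .
qed

text \<open>The characteristic function of the standard normal law, with its density rescaled by
  \<open>sqrt (2 * pi)\<close>.\<close>

lemma fourier_gaussian_real:
  shows "integrable lborel (\<lambda>t. complex_of_real (exp (- t\<^sup>2 / 2)) * cis (s * t))" (is ?int)
    and "(CLINT t|lborel. complex_of_real (exp (- t\<^sup>2 / 2)) * cis (s * t)) = complex_of_real (sqrt (2 * pi) * exp (- s\<^sup>2 / 2))"
proof -
  have eq: "complex_of_real (exp (- t\<^sup>2 / 2)) * cis (s * t) = complex_of_real (sqrt (2 * pi)) * (complex_of_real (std_normal_density t) * cis (s * t))" for t
    by (simp add: std_normal_density_def)
  have "integrable lborel (\<lambda>t. complex_of_real (std_normal_density t) * cis (s * t))"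
    by (rule integrable_times_cis) auto
  then show ?int unfolding eq by simp
  have "char std_normal_distribution s = (CLINT t|lborel. complex_of_real (std_normal_density t) * cis (s * t))"
    unfolding char_def by (subst integral_density) (auto simp: scaleR_conv_of_real cis_conv_exp)
  then show "(CLINT t|lborel. complex_of_real (exp (- t\<^sup>2 / 2)) * cis (s * t)) = complex_of_real (sqrt (2 * pi) * exp (- s\<^sup>2 / 2))"
    unfolding eq by (simp add: char_std_normal_distribution)
qed

lemma fourier_gaussian:
  fixes x :: "'a::euclidean_space"
  shows "(CLINT \<xi>|lborel. complex_of_real (exp (- (norm \<xi>)\<^sup>2 / 2)) * cis (x \<bullet> \<xi>))
    = complex_of_real (sqrt (2 * pi) ^ DIM('a) * exp (- (norm x)\<^sup>2 / 2))"
proof -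
  have norm2: "(norm y)\<^sup>2 = (\<Sum>b\<in>Basis. (y \<bullet> b)\<^sup>2)" for y :: 'a
    by (subst power2_norm_eq_inner, subst euclidean_inner) (simp add: power2_eq_square)
  have exp_norm: "exp (- (norm y)\<^sup>2 / 2) = (\<Prod>b\<in>Basis. exp (- (y \<bullet> b)\<^sup>2 / 2))" for y :: 'a
    by (simp add: norm2 exp_sum sum_negf[symmetric] sum_divide_distrib)
  have cis_sum: "cis (\<Sum>b\<in>A. g b) = (\<Prod>b\<in>A. cis (g b))" if "finite A" for A and g :: "'a \<Rightarrow> real"
    using that by (induction A) (auto simp flip: cis_mult)
  have "complex_of_real (exp (- (norm \<xi>)\<^sup>2 / 2)) * cis (x \<bullet> \<xi>)
     = (\<Prod>b\<in>Basis. complex_of_real (exp (- (\<xi> \<bullet> b)\<^sup>2 / 2)) * cis ((x \<bullet> b) * (\<xi> \<bullet> b)))" for \<xi>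
    by (subst euclidean_inner) (simp only: exp_norm of_real_prod prod.distrib cis_sum[OF finite_Basis])
  then have "(CLINT \<xi>|lborel. complex_of_real (exp (- (norm \<xi>)\<^sup>2 / 2)) * cis (x \<bullet> \<xi>))
    = (\<Prod>b\<in>Basis. CLINT t|lborel. complex_of_real (exp (- t\<^sup>2 / 2)) * cis ((x \<bullet> b) * t))"
    using integral_lborel_prod[of "\<lambda>b t. complex_of_real (exp (- t\<^sup>2 / 2)) * cis ((x \<bullet> b) * t)"] fourier_gaussian_real(1)
    by simp
  also have "\<dots> = (\<Prod>b\<in>Basis. complex_of_real (sqrt (2 * pi) * exp (- (x \<bullet> b)\<^sup>2 / 2)))"
    by (simp only: fourier_gaussian_real(2))
  also have "\<dots> = complex_of_real (sqrt (2 * pi) ^ DIM('a) * exp (- (norm x)\<^sup>2 / 2))"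
    by (simp only: exp_norm of_real_prod of_real_mult of_real_power prod.distrib prod_constant)
  finally show ?thesis .
qed

text \<open>The Bochner integral of a non-integrable function is 0, whereas the Fourier integral at
  0 is not; so integrability can be read off the formula above.\<close>

lemma integrable_gaussian: "integrable lborel (\<lambda>x::'a::euclidean_space. exp (- (norm x)\<^sup>2 / 2))"
proof -
  have "(CLINT \<xi>|lborel. complex_of_real (exp (- (norm \<xi>)\<^sup>2 / 2)) * cis ((0::'a) \<bullet> \<xi>)) \<noteq> 0"
    unfolding fourier_gaussian by simp
  then have "integrable lborel (\<lambda>\<xi>::'a. complex_of_real (exp (- (norm \<xi>)\<^sup>2 / 2)))"
    using not_integrable_integral_eq by force
  then show ?thesis by (simp only: complex_of_real_integrable_eq)
qed

lemma (in pair_sigma_finite) integrable_product_mult: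
  fixes f :: "_ \<Rightarrow> real" and g :: "_ \<Rightarrow> real"
  assumes f: "integrable M1 f" and g: "integrable M2 g"
  shows "integrable (M1 \<Otimes>\<^sub>M M2) (\<lambda>(x, y). f x * g y)"
proof (rule Fubini_integrable)
  have [measurable]: "f \<in> borel_measurable M1" "g \<in> borel_measurable M2" using f g by auto
  show "(\<lambda>(x, y). f x * g y) \<in> borel_measurable (M1 \<Otimes>\<^sub>M M2)" by measurable
qed (use f g in \<open>auto simp: abs_mult\<close>)

text \<open>Gaussian regularisation: with the weight \<open>exp (- \<epsilon>^2 |y|^2 / 2)\<close> inserted, Fubini turns the
  left-hand side into an average of \<open>a\<close> over a Gaussian of width \<open>\<epsilon>\<close> centred at \<open>\<xi>\<close>.\<close>
lemma fourier_inversion: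
  fixes a :: "'a::euclidean_space \<Rightarrow> real"
  assumes a: "integrable lborel a" and cont: "continuous_on UNIV a"
    and B: "\<And>\<xi>. \<bar>a \<xi>\<bar> \<le> B" and int: "integrable lborel (inv_fourier a)"
  shows "(CLINT y|lborel. inv_fourier a y * cis (- (y \<bullet> \<xi>))) = complex_of_real (a \<xi>)"
proof -
  let ?d = "DIM('a)"
  define \<epsilon> where "\<epsilon> n = inverse (real (Suc n))" for n
  have \<epsilon>: "\<epsilon> n > 0" for n by (simp add: \<epsilon>_def)
  have \<epsilon>_lim: "\<epsilon> \<longlonglongrightarrow> 0" unfolding \<epsilon>_def by (rule LIMSEQ_inverse_real_of_nat)
  have a_meas [measurable]: "a \<in> borel_measurable borel"
    using a by (simp add: borel_measurable_integrable)
  define \<gamma> where "\<gamma> n y = exp (- (norm (\<epsilon> n *\<^sub>R y))\<^sup>2 / 2)" for n and y :: 'a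
  have [measurable]: "\<gamma> n \<in> borel_measurable borel" for n unfolding \<gamma>_def by measurable
  have \<gamma>_int: "integrable lborel (\<gamma> n)" for n
    using lborel_integrable_affine_iff[of "\<lambda>y::'a. exp (- (norm y)\<^sup>2 / 2)" "\<epsilon> n" 0] \<epsilon>[of n] integrable_gaussian
    by (simp add: \<gamma>_def[abs_def])
  define c where "c = complex_of_real (1 / (2 * pi) ^ ?d)"
  define J where "J n = (CLINT y|lborel. inv_fourier a y * cis (- (y \<bullet> \<xi>)) * complex_of_real (\<gamma> n y))" for n
  \<comment> \<open>As the weights tend to 1, integrability of \<open>inv_fourier a\<close> provides
    the majorant on this side.\<close>
  have lim1: "J \<longlonglongrightarrow> (CLINT y|lborel. inv_fourier a y * cis (- (y \<bullet> \<xi>)))"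
    unfolding J_def
  proof (rule integral_dominated_convergence[where w = "\<lambda>y. norm (inv_fourier a y)"])
    show "AE y in lborel. (\<lambda>n. inv_fourier a y * cis (- (y \<bullet> \<xi>)) * complex_of_real (\<gamma> n y)) \<longlonglongrightarrow> inv_fourier a y * cis (- (y \<bullet> \<xi>))"
    proof (rule AE_I2)
      fix y
      have "(\<lambda>n. \<gamma> n y) \<longlonglongrightarrow> exp (- (norm (0 *\<^sub>R y))\<^sup>2 / 2)"
        unfolding \<gamma>_def by (intro tendsto_intros \<epsilon>_lim) simp
      then have "(\<lambda>n. inv_fourier a y * cis (- (y \<bullet> \<xi>)) * complex_of_real (\<gamma> n y)) \<longlonglongrightarrow> inv_fourier a y * cis (- (y \<bullet> \<xi>)) * complex_of_real 1"
        by (intro tendsto_intros) simp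
      then show "(\<lambda>n. inv_fourier a y * cis (- (y \<bullet> \<xi>)) * complex_of_real (\<gamma> n y)) \<longlonglongrightarrow> inv_fourier a y * cis (- (y \<bullet> \<xi>))" by simp
    qed
    show "AE y in lborel. norm (inv_fourier a y * cis (- (y \<bullet> \<xi>)) * complex_of_real (\<gamma> n y)) \<le> norm (inv_fourier a y)" for n
      by (rule AE_I2) (auto simp: norm_mult \<gamma>_def intro: mult_left_le)
  qed (use int in auto)
  have J_eq: "J n = c * complex_of_real (sqrt (2 * pi) ^ ?d) *
      (CLINT w|lborel. complex_of_real (a (\<xi> + \<epsilon> n *\<^sub>R w) * exp (- (norm w)\<^sup>2 / 2)))" for n
  proof -
    \<comment> \<open>The Gaussian weight makes the double integral absolutely convergent; the phase
      alone does not decay in \<open>y\<close>.\<close>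
    have pair: "integrable (lborel \<Otimes>\<^sub>M lborel) (\<lambda>(y, \<eta>). complex_of_real (\<gamma> n y) * complex_of_real (a \<eta>) * cis (y \<bullet> (\<eta> - \<xi>)))"
    proof (rule Bochner_Integration.integrable_bound)
      show "integrable (lborel \<Otimes>\<^sub>M lborel) (\<lambda>(y, \<eta>). \<gamma> n y * a \<eta>)"
        by (rule lborel_pair.integrable_product_mult) (use \<gamma>_int a in auto)
    qed (auto simp: norm_mult abs_mult split_beta)
    have inner: "(CLINT y|lborel. complex_of_real (\<gamma> n y) * complex_of_real (a \<eta>) * cis (y \<bullet> (\<eta> - \<xi>)))
       = complex_of_real (a \<eta>) * ((1 / \<epsilon> n ^ ?d) *\<^sub>R complex_of_real (sqrt (2 * pi) ^ ?d * exp (- (norm ((1 / \<epsilon> n) *\<^sub>R (\<eta> - \<xi>)))\<^sup>2 / 2)))" for \<eta>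
    proof -
      let ?z = "(1 / \<epsilon> n) *\<^sub>R (\<eta> - \<xi>)"
      have "complex_of_real (\<gamma> n y) * cis (y \<bullet> (\<eta> - \<xi>))
        = complex_of_real (exp (- (norm (0 + \<epsilon> n *\<^sub>R y))\<^sup>2 / 2)) * cis (?z \<bullet> (0 + \<epsilon> n *\<^sub>R y))" for y
        using \<epsilon>[of n] by (simp add: \<gamma>_def inner_commute)
      then have "(CLINT y|lborel. complex_of_real (\<gamma> n y) * cis (y \<bullet> (\<eta> - \<xi>)))
         = (CLINT y|lborel. complex_of_real (exp (- (norm (0 + \<epsilon> n *\<^sub>R y))\<^sup>2 / 2)) * cis (?z \<bullet> (0 + \<epsilon> n *\<^sub>R y)))"
        by simp
      also have "\<dots> = (1 / \<bar>\<epsilon> n\<bar> ^ ?d) *\<^sub>R (CLINT y|lborel. complex_of_real (exp (- (norm y)\<^sup>2 / 2)) * cis (?z \<bullet> y))"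
        by (rule lborel_integral_affine_eq) (use \<epsilon>[of n] in auto)
      also have "\<dots> = (1 / \<epsilon> n ^ ?d) *\<^sub>R complex_of_real (sqrt (2 * pi) ^ ?d * exp (- (norm ?z)\<^sup>2 / 2))"
        using \<epsilon>[of n] by (simp only: fourier_gaussian abs_of_pos)
      finally show ?thesis by (simp add: mult.commute mult.left_commute mult.assoc)
    qed
    have "J n = (CLINT y|lborel. c * (CLINT \<eta>|lborel. complex_of_real (\<gamma> n y) * complex_of_real (a \<eta>) * cis (y \<bullet> (\<eta> - \<xi>))))"
      unfolding J_def
    proof (intro Bochner_Integration.integral_cong refl)
      fix y
      have split: "cis (y \<bullet> (\<eta> - \<xi>)) = cis (- (y \<bullet> \<xi>)) * cis (y \<bullet> \<eta>)" for \<eta>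
        by (simp add: cis_mult inner_diff_right)
      have "(CLINT \<eta>|lborel. complex_of_real (\<gamma> n y) * complex_of_real (a \<eta>) * cis (y \<bullet> (\<eta> - \<xi>)))
        = (CLINT \<eta>|lborel. (cis (- (y \<bullet> \<xi>)) * complex_of_real (\<gamma> n y)) * (complex_of_real (a \<eta>) * cis (y \<bullet> \<eta>)))"
        by (intro Bochner_Integration.integral_cong refl) (simp only: split mult_ac)
      also have "\<dots> = (cis (- (y \<bullet> \<xi>)) * complex_of_real (\<gamma> n y)) * (CLINT \<eta>|lborel. complex_of_real (a \<eta>) * cis (y \<bullet> \<eta>))"
        by (rule integral_mult_right_zero)
      finally show "inv_fourier a y * cis (- (y \<bullet> \<xi>)) * complex_of_real (\<gamma> n y)
        = c * (CLINT \<eta>|lborel. complex_of_real (\<gamma> n y) * complex_of_real (a \<eta>) * cis (y \<bullet> (\<eta> - \<xi>)))"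
        by (simp only: inv_fourier_def c_def mult_ac)
    qed
    also have "\<dots> = c * (CLINT \<eta>|lborel. CLINT y|lborel. complex_of_real (\<gamma> n y) * complex_of_real (a \<eta>) * cis (y \<bullet> (\<eta> - \<xi>)))"
      using lborel_pair.Fubini_integral[OF pair] by simp
    also have "(CLINT \<eta>|lborel. CLINT y|lborel. complex_of_real (\<gamma> n y) * complex_of_real (a \<eta>) * cis (y \<bullet> (\<eta> - \<xi>)))
      = (CLINT \<eta>|lborel. complex_of_real (sqrt (2 * pi) ^ ?d / \<epsilon> n ^ ?d) *
           complex_of_real (a \<eta> * exp (- (norm ((1 / \<epsilon> n) *\<^sub>R (\<eta> - \<xi>)))\<^sup>2 / 2)))"
      unfolding inner by (intro Bochner_Integration.integral_cong refl) (simp add: scaleR_conv_of_real mult_ac)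
    also have "\<dots> = complex_of_real (sqrt (2 * pi) ^ ?d / \<epsilon> n ^ ?d) *
        (CLINT \<eta>|lborel. complex_of_real (a \<eta> * exp (- (norm ((1 / \<epsilon> n) *\<^sub>R (\<eta> - \<xi>)))\<^sup>2 / 2)))"
      by (rule integral_mult_right_zero)
    also have "(CLINT \<eta>|lborel. complex_of_real (a \<eta> * exp (- (norm ((1 / \<epsilon> n) *\<^sub>R (\<eta> - \<xi>)))\<^sup>2 / 2)))
       = \<epsilon> n ^ ?d *\<^sub>R (CLINT w|lborel. complex_of_real (a (\<xi> + \<epsilon> n *\<^sub>R w) * exp (- (norm ((1 / \<epsilon> n) *\<^sub>R ((\<xi> + \<epsilon> n *\<^sub>R w) - \<xi>)))\<^sup>2 / 2)))"
      using \<epsilon>[of n] by (subst lborel_integral_affine_eq) auto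
    finally show ?thesis
      using \<epsilon>[of n] by (simp add: scaleR_conv_of_real)
  qed
  \<comment> \<open>Here continuity of \<open>a\<close> and its bound \<open>B\<close> take over:
    averages over a Gaussian of width \<open>\<epsilon> n\<close> tend to the value at the
    centre.\<close>
  have lim2: "(\<lambda>n. c * complex_of_real (sqrt (2 * pi) ^ ?d) *
      (CLINT w|lborel. complex_of_real (a (\<xi> + \<epsilon> n *\<^sub>R w) * exp (- (norm w)\<^sup>2 / 2))))
     \<longlonglongrightarrow> c * complex_of_real (sqrt (2 * pi) ^ ?d) * (CLINT w|lborel. complex_of_real (a \<xi> * exp (- (norm (w :: 'a))\<^sup>2 / 2)))"
  proof (intro tendsto_mult tendsto_const integral_dominated_convergence[where w = "\<lambda>w. B * exp (- (norm w)\<^sup>2 / 2)"])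
    show "AE w in lborel. (\<lambda>n. complex_of_real (a (\<xi> + \<epsilon> n *\<^sub>R w) * exp (- (norm w)\<^sup>2 / 2))) \<longlonglongrightarrow> complex_of_real (a \<xi> * exp (- (norm w)\<^sup>2 / 2))"
    proof (rule AE_I2)
      fix w
      have "(\<lambda>n. \<xi> + \<epsilon> n *\<^sub>R w) \<longlonglongrightarrow> \<xi> + 0 *\<^sub>R w" by (intro tendsto_intros \<epsilon>_lim)
      then have "(\<lambda>n. a (\<xi> + \<epsilon> n *\<^sub>R w)) \<longlonglongrightarrow> a \<xi>"
        using cont by (intro continuous_on_tendsto_compose[OF cont]) auto
      then show "(\<lambda>n. complex_of_real (a (\<xi> + \<epsilon> n *\<^sub>R w) * exp (- (norm w)\<^sup>2 / 2))) \<longlonglongrightarrow> complex_of_real (a \<xi> * exp (- (norm w)\<^sup>2 / 2))"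
        by (intro tendsto_intros)
    qed
    show "AE w in lborel. norm (complex_of_real (a (\<xi> + \<epsilon> n *\<^sub>R w) * exp (- (norm w)\<^sup>2 / 2))) \<le> B * exp (- (norm w)\<^sup>2 / 2)" for n
      using B by (intro AE_I2) (simp add: norm_mult)
    show "integrable lborel (\<lambda>w::'a. B * exp (- (norm w)\<^sup>2 / 2))"
      by (intro integrable_mult_right integrable_gaussian)
  qed measurable
  \<comment> \<open>One power of \<open>sqrt (2 * pi)\<close> comes from transforming the weight,
    another from the total mass of the Gaussian; together they cancel \<open>c\<close>.\<close>
  have val: "c * complex_of_real (sqrt (2 * pi) ^ ?d) * (CLINT w|lborel. complex_of_real (a \<xi> * exp (- (norm (w :: 'a))\<^sup>2 / 2))) = complex_of_real (a \<xi>)"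
  proof -
    have "(CLINT w|lborel. complex_of_real (a \<xi> * exp (- (norm (w :: 'a))\<^sup>2 / 2)))
      = complex_of_real (a \<xi>) * (CLINT w|lborel. complex_of_real (exp (- (norm (w :: 'a))\<^sup>2 / 2)))"
      by (simp only: of_real_mult integral_mult_right_zero)
    also have "(CLINT w|lborel. complex_of_real (exp (- (norm (w :: 'a))\<^sup>2 / 2))) = complex_of_real (sqrt (2 * pi) ^ ?d)"
      using fourier_gaussian[of "0::'a"] by simp
    finally have "c * complex_of_real (sqrt (2 * pi) ^ ?d) * (CLINT w|lborel. complex_of_real (a \<xi> * exp (- (norm (w :: 'a))\<^sup>2 / 2)))
      = complex_of_real (a \<xi> * ((sqrt (2 * pi) * sqrt (2 * pi)) ^ ?d / (2 * pi) ^ ?d))"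
      by (simp only: c_def of_real_mult of_real_divide of_real_1 of_real_power power_mult_distrib) (simp add: mult_ac)
    also have "\<dots> = complex_of_real (a \<xi>)" by simp
    finally show ?thesis .
  qed
  have "J \<longlonglongrightarrow> complex_of_real (a \<xi>)"
    using lim2 unfolding val J_eq[symmetric] .
  with lim1 show ?thesis by (rule LIMSEQ_unique)
qed

section \<open>Test functions and rapid decay of their inverse Fourier transforms\<close>

definition test_function :: "('a::euclidean_space \<Rightarrow> real) \<Rightarrow> bool" where
  "test_function a \<longleftrightarrow> smooth_fun a \<and> (\<exists>R. \<forall>x. norm x > R \<longrightarrow> a x = 0)"

definition dir_deriv :: "'a::euclidean_space \<Rightarrow> ('a \<Rightarrow> real) \<Rightarrow> 'a \<Rightarrow> real" where
  "dir_deriv v a x = frechet_derivative a (at x) v"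

text \<open>The new direction is differentiated first, hence goes to the end of the list. So
  iterated derivatives of a directional derivative are iterated derivatives of the function, and
  smoothness is inherited.\<close>

lemma iter_dirderiv_dir_deriv: "iter_dirderiv vs (dir_deriv v a) = iter_dirderiv (vs @ [v]) a"
  by (induction vs) (auto simp: dir_deriv_def)

lemma smooth_fun_differentiable: "smooth_fun a \<Longrightarrow> a differentiable at x"
  unfolding smooth_fun_def by (metis iter_dirderiv.simps(1))

lemma test_function_differentiable: "test_function a \<Longrightarrow> a differentiable at x"
  by (simp add: test_function_def smooth_fun_differentiable)

lemma test_function_continuous: "test_function a \<Longrightarrow> continuous_on UNIV a"
  by (intro differentiable_imp_continuous_on) (simp add: differentiable_on_def test_function_differentiable)

lemma test_function_measurable [measurable_dest]: "test_function a \<Longrightarrow> a \<in> borel_measurable borel"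
  by (intro borel_measurable_continuous_onI test_function_continuous)

lemma test_function_dir_deriv:
  assumes a: "test_function a" shows "test_function (dir_deriv v a)"
proof -
  obtain R where R: "\<And>x. norm x > R \<Longrightarrow> a x = 0" using a by (auto simp: test_function_def)
  have "dir_deriv v a x = 0" if "norm x > R" for x
  proof -
    \<comment> \<open>The complement of the ball is open, so \<open>a\<close> vanishes near the
      point and its derivative there is 0.\<close>
    have "open {y::'a. norm y > R}"
      by (intro open_Collect_less continuous_intros)
    then have "frechet_derivative a (at x) = frechet_derivative (\<lambda>_. 0) (at x)"
      using test_function_differentiable[OF a] R that
      by (intro frechet_derivative_transform_within_open[where X = "{y. norm y > R}"]) auto
    then show ?thesis by (simp add: dir_deriv_def)
  qed
  moreover have "smooth_fun (dir_deriv v a)"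
    using a unfolding smooth_fun_def iter_dirderiv_dir_deriv test_function_def by blast
  ultimately show ?thesis by (auto simp: test_function_def)
qed

lemma test_function_bounded_support:
  assumes a: "test_function a"
  obtains B R where "B \<ge> 0" "R \<ge> 0" "\<And>x. \<bar>a x\<bar> \<le> B * indicator (cball 0 R) x"
proof -
  obtain R where R: "\<And>x. norm x > R \<Longrightarrow> a x = 0" using a by (auto simp: test_function_def)
  define R' where "R' = max R 0"
  have "compact (a ` cball 0 R')"
    using test_function_continuous[OF a] by (intro compact_continuous_image) (auto intro: continuous_on_subset)
  then obtain B where B: "\<And>x. x \<in> cball 0 R' \<Longrightarrow> \<bar>a x\<bar> \<le> B"
    by (metis (no_types, lifting) bounded_iff compact_imp_bounded image_eqI real_norm_def)
  show ?thesis
  proof (rule that[of "max B 0" R'])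
    show "\<bar>a x\<bar> \<le> max B 0 * indicator (cball 0 R') x" for x
      using B[of x] R[of x] by (auto simp: indicator_def R'_def not_le)
  qed (auto simp: R'_def)
qed

lemma integrable_cball_indicator: "integrable lborel (\<lambda>x::'a::euclidean_space. c * indicat_real (cball 0 R) x)"
  by (intro integrable_mult_right integrable_real_indicator) (auto intro: emeasure_lborel_cball_finite[unfolded infinity_ennreal_def])

lemma test_function_integrable:
  assumes a: "test_function a" shows "integrable lborel a"
proof -
  obtain B R where BR: "\<And>x. \<bar>a x\<bar> \<le> B * indicator (cball 0 R) x"
    using test_function_bounded_support[OF a] by metis
  show ?thesis
    by (rule Bochner_Integration.integrable_bound[OF integrable_cball_indicator[of B R]])
      (use BR a test_function_measurable in \<open>auto intro!: AE_I2 order_trans[OF BR]\<close>)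
qed

lemma DERIV_along_direction:
  assumes a: "test_function a"
  shows "((\<lambda>s. a (x + s *\<^sub>R v)) has_real_derivative dir_deriv v a (x + s *\<^sub>R v)) (at s within S)"
proof -
  have "(a has_derivative frechet_derivative a (at (x + s *\<^sub>R v))) (at (x + s *\<^sub>R v))"
    using test_function_differentiable[OF a] by (simp add: frechet_derivative_works)
  then have "((\<lambda>s. a (x + s *\<^sub>R v)) has_derivative (\<lambda>h. frechet_derivative a (at (x + s *\<^sub>R v)) (h *\<^sub>R v))) (at s)"
    by (rule has_derivative_compose[rotated]) (auto intro!: derivative_eq_intros)
  moreover have "frechet_derivative a (at (x + s *\<^sub>R v)) (h *\<^sub>R v) = dir_deriv v a (x + s *\<^sub>R v) * h" for h
    using linear_frechet_derivative[OF test_function_differentiable[OF a]]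
    by (simp add: dir_deriv_def linear_cmul)
  ultimately show ?thesis
    by (simp add: has_field_derivative_def has_derivative_at_withinI)
qed

lemma lipschitz_along_direction:
  assumes a: "test_function a" and B: "\<And>x. \<bar>dir_deriv v a x\<bar> \<le> B"
  shows "\<bar>a (x + t *\<^sub>R v) - a x\<bar> \<le> B * \<bar>t\<bar>"
  using field_differentiable_bound[of UNIV "\<lambda>s. a (x + s *\<^sub>R v)" "\<lambda>s. dir_deriv v a (x + s *\<^sub>R v)" B t 0]
  by (simp add: DERIV_along_direction[OF a] B)

definition fourier_int :: "('a::euclidean_space \<Rightarrow> real) \<Rightarrow> 'a \<Rightarrow> complex" where
  "fourier_int a x = (CLINT \<xi>|lborel. complex_of_real (a \<xi>) * cis (x \<bullet> \<xi>))"

text \<open>Integration by parts, carried out on difference quotients: translating \<open>a\<close> by \<open>t v\<close> multiplies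
  its Fourier integral by \<open>cis (- t (x \<bullet> v))\<close>.\<close>
lemma fourier_int_dir_deriv:
  fixes a :: "'a::euclidean_space \<Rightarrow> real"
  assumes a: "test_function a"
  shows "fourier_int (dir_deriv v a) x = - \<i> * complex_of_real (x \<bullet> v) * fourier_int a x"
proof -
  obtain B R where B: "B \<ge> 0" and R: "R \<ge> 0" and BR: "\<And>x. \<bar>dir_deriv v a x\<bar> \<le> B * indicator (cball 0 R) x"
    using test_function_bounded_support[OF test_function_dir_deriv[OF a]] by metis
  have dB: "\<bar>dir_deriv v a x\<bar> \<le> B" for x
    using BR[of x] B by (cases "x \<in> cball 0 R") auto
  obtain A Ra where Ra: "Ra \<ge> 0" and ARa: "\<And>x. \<bar>a x\<bar> \<le> A * indicator (cball 0 Ra) x"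
    using test_function_bounded_support[OF a] by metis
  have a_supp: "a x = 0" if "norm x > Ra" for x
    using ARa[of x] that by simp
  note [measurable] = test_function_measurable[OF a] test_function_measurable[OF test_function_dir_deriv[OF a]]
  define \<epsilon> where "\<epsilon> n = inverse (real (Suc n))" for n
  have \<epsilon>: "\<epsilon> n > 0" "\<epsilon> n \<le> 1" for n by (auto simp: \<epsilon>_def inverse_le_1_iff)
  have \<epsilon>_lim: "\<epsilon> \<longlonglongrightarrow> 0" unfolding \<epsilon>_def by (rule LIMSEQ_inverse_real_of_nat)
  have \<epsilon>_at: "filterlim \<epsilon> (at 0) sequentially"
    using \<epsilon>_lim \<epsilon> by (auto simp: filterlim_at intro!: always_eventually) (metis less_irrefl)
  define D where "D n \<xi> = (a (\<xi> + \<epsilon> n *\<^sub>R v) - a \<xi>) / \<epsilon> n" for n \<xi>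
  have [measurable]: "D n \<in> borel_measurable borel" for n unfolding D_def by measurable
  have int_a: "integrable lborel (\<lambda>\<xi>. complex_of_real (a \<xi>) * cis (x \<bullet> \<xi>))"
    by (rule integrable_times_cis) (use test_function_integrable[OF a] in auto)
  have lim1: "(\<lambda>n. CLINT \<xi>|lborel. complex_of_real (D n \<xi>) * cis (x \<bullet> \<xi>)) \<longlonglongrightarrow> fourier_int (dir_deriv v a) x"
    unfolding fourier_int_def
  proof (rule integral_dominated_convergence[where w = "\<lambda>\<xi>. B * indicator (cball 0 (Ra + norm v)) \<xi>"])
    show "AE \<xi> in lborel. (\<lambda>n. complex_of_real (D n \<xi>) * cis (x \<bullet> \<xi>)) \<longlonglongrightarrow> complex_of_real (dir_deriv v a \<xi>) * cis (x \<bullet> \<xi>)"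
    proof (intro AE_I2 tendsto_intros)
      fix \<xi>
      have "((\<lambda>t. (a (\<xi> + t *\<^sub>R v) - a \<xi>) / t) \<longlongrightarrow> dir_deriv v a \<xi>) (at 0)"
        using DERIV_along_direction[OF a, of \<xi> v 0 UNIV] by (simp add: DERIV_def)
      from filterlim_compose[OF this \<epsilon>_at]
      show "(\<lambda>n. D n \<xi>) \<longlonglongrightarrow> dir_deriv v a \<xi>"
        by (simp add: D_def)
    qed
    \<comment> \<open>On the enlarged ball the Lipschitz bound controls the quotient; outside it
      both points miss the support of \<open>a\<close>, since \<open>\<epsilon> n \<le> 1\<close>
      allows a shift by at most \<open>norm v\<close>.\<close>
    show "AE \<xi> in lborel. norm (complex_of_real (D n \<xi>) * cis (x \<bullet> \<xi>)) \<le> B * indicator (cball 0 (Ra + norm v)) \<xi>" for n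
    proof (rule AE_I2)
      fix \<xi>
      have "\<bar>D n \<xi>\<bar> \<le> B * indicator (cball 0 (Ra + norm v)) \<xi>"
      proof (cases "norm \<xi> \<le> Ra + norm v")
        case True
        then show ?thesis
          using lipschitz_along_direction[OF a dB, of \<xi> "\<epsilon> n"] \<epsilon>(1)[of n]
          by (simp add: D_def field_simps)
      next
        case False
        have "norm \<xi> \<le> norm (\<xi> + \<epsilon> n *\<^sub>R v) + norm (\<epsilon> n *\<^sub>R v)"
          by (metis add_diff_cancel_right' norm_triangle_ineq4)
        moreover have "norm (\<epsilon> n *\<^sub>R v) \<le> norm v"
          using \<epsilon>[of n] by (simp add: mult_left_le_one_le)
        ultimately have "norm (\<xi> + \<epsilon> n *\<^sub>R v) > Ra" using False by linarith
        moreover have "norm \<xi> > Ra" using False norm_ge_zero[of v] by linarith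
        ultimately show ?thesis using False by (simp add: D_def a_supp)
      qed
      then show "norm (complex_of_real (D n \<xi>) * cis (x \<bullet> \<xi>)) \<le> B * indicator (cball 0 (Ra + norm v)) \<xi>"
        by (simp add: norm_mult)
    qed
    show "integrable lborel (\<lambda>\<xi>::'a. B * indicator (cball 0 (Ra + norm v)) \<xi> :: real)" by (rule integrable_cball_indicator)
  qed measurable
  have eq: "(CLINT \<xi>|lborel. complex_of_real (D n \<xi>) * cis (x \<bullet> \<xi>)) = (cis (- (\<epsilon> n * (x \<bullet> v))) - 1) / complex_of_real (\<epsilon> n) * fourier_int a x" for n
  proof -
    \<comment> \<open>The shifted integrand \<open>?s\<close> has the same integral as the unshifted
      one; the phase that the shift creates is taken out as a scalar.\<close>
    let ?s = "\<lambda>\<xi>. complex_of_real (a (\<xi> + \<epsilon> n *\<^sub>R v)) * cis (x \<bullet> (\<xi> + \<epsilon> n *\<^sub>R v))"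
    have s: "?s \<xi> = (\<lambda>\<xi>. complex_of_real (a \<xi>) * cis (x \<bullet> \<xi>)) (\<epsilon> n *\<^sub>R v + 1 *\<^sub>R \<xi>)" for \<xi>
      by (simp add: add.commute)
    have int_s: "integrable lborel ?s"
      unfolding s by (subst lborel_integrable_affine_iff) (use int_a in auto)
    have eq_s: "(CLINT \<xi>|lborel. ?s \<xi>) = fourier_int a x"
      unfolding s fourier_int_def by (subst lborel_integral_affine_eq) auto
    have "complex_of_real (D n \<xi>) * cis (x \<bullet> \<xi>)
      = (1 / complex_of_real (\<epsilon> n)) * (cis (- (\<epsilon> n * (x \<bullet> v))) * ?s \<xi> - complex_of_real (a \<xi>) * cis (x \<bullet> \<xi>))" for \<xi>
    proof -
      have "cis (- (\<epsilon> n * (x \<bullet> v))) * cis (x \<bullet> (\<xi> + \<epsilon> n *\<^sub>R v)) = cis (x \<bullet> \<xi>)"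
        by (simp add: cis_mult inner_add_right)
      then have "cis (- (\<epsilon> n * (x \<bullet> v))) * ?s \<xi> = complex_of_real (a (\<xi> + \<epsilon> n *\<^sub>R v)) * cis (x \<bullet> \<xi>)"
        by (metis mult.left_commute)
      then show ?thesis
        by (simp only: D_def) (simp add: left_diff_distrib diff_divide_distrib)
    qed
    then have "(CLINT \<xi>|lborel. complex_of_real (D n \<xi>) * cis (x \<bullet> \<xi>))
      = (1 / complex_of_real (\<epsilon> n)) * (CLINT \<xi>|lborel. cis (- (\<epsilon> n * (x \<bullet> v))) * ?s \<xi> - complex_of_real (a \<xi>) * cis (x \<bullet> \<xi>))"
      by (simp only: integral_mult_right_zero)
    also have "(CLINT \<xi>|lborel. cis (- (\<epsilon> n * (x \<bullet> v))) * ?s \<xi> - complex_of_real (a \<xi>) * cis (x \<bullet> \<xi>))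
      = cis (- (\<epsilon> n * (x \<bullet> v))) * (CLINT \<xi>|lborel. ?s \<xi>) - fourier_int a x"
      unfolding fourier_int_def
      by (subst Bochner_Integration.integral_diff) (use int_s int_a in \<open>auto simp only: integral_mult_right_zero intro: integrable_mult_right\<close>)
    finally show ?thesis unfolding eq_s by (simp add: field_simps)
  qed
  \<comment> \<open>The scalar in front of \<open>fourier_int a x\<close> is a difference quotient
    of this exponential at 0.\<close>
  have "((\<lambda>z. exp (- (\<i> * of_real (x \<bullet> v)) * z)) has_field_derivative - (\<i> * of_real (x \<bullet> v))) (at 0)"
    by (auto intro!: derivative_eq_intros)
  then have exp_lim: "((\<lambda>z. (exp (- (\<i> * of_real (x \<bullet> v)) * z) - 1) / z) \<longlongrightarrow> - (\<i> * of_real (x \<bullet> v))) (at 0)"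
    by (simp add: DERIV_def)
  have "filterlim (\<lambda>n. complex_of_real (\<epsilon> n)) (at 0) sequentially"
    using tendsto_of_real[OF \<epsilon>_lim, where 'a = complex] \<epsilon>(1)
    by (auto simp: filterlim_at intro!: always_eventually) (metis less_irrefl)
  from filterlim_compose[OF exp_lim this]
  have "(\<lambda>n. (cis (- (\<epsilon> n * (x \<bullet> v))) - 1) / complex_of_real (\<epsilon> n) * fourier_int a x) \<longlonglongrightarrow> - (\<i> * of_real (x \<bullet> v)) * fourier_int a x"
    by (intro tendsto_mult) (simp_all add: cis_conv_exp mult_ac)
  with lim1 have "fourier_int (dir_deriv v a) x = - (\<i> * of_real (x \<bullet> v)) * fourier_int a x"
    unfolding eq by (rule LIMSEQ_unique)
  then show ?thesis by simp
qed

lemma norm_fourier_int_le: "norm (fourier_int a x) \<le> (\<integral>\<xi>. \<bar>a \<xi>\<bar> \<partial>lborel)"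
proof -
  have "norm (fourier_int a x) \<le> (\<integral>\<xi>. norm (complex_of_real (a \<xi>) * cis (x \<bullet> \<xi>)) \<partial>lborel)"
    unfolding fourier_int_def by (rule integral_norm_bound)
  then show ?thesis by (simp add: norm_mult)
qed

text \<open>Each derivative along \<open>v\<close> multiplies the modulus of the Fourier integral by
  \<open>\<bar>x \<bullet> v\<bar>\<close>; after n of them the trivial L^1 bound is
  applied.\<close>

lemma fourier_int_power_bound:
  assumes a: "test_function a"
  shows "\<bar>x \<bullet> v\<bar> ^ n * norm (fourier_int a x) \<le> (\<integral>\<xi>. \<bar>(dir_deriv v ^^ n) a \<xi>\<bar> \<partial>lborel)"
proof -
  have "test_function ((dir_deriv v ^^ n) a) \<and> norm (fourier_int ((dir_deriv v ^^ n) a) x) = \<bar>x \<bullet> v\<bar> ^ n * norm (fourier_int a x)"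
  proof (induction n)
    case (Suc n)
    then show ?case
      using fourier_int_dir_deriv[of "(dir_deriv v ^^ n) a" v x] by (simp add: test_function_dir_deriv norm_mult)
  qed (simp add: a)
  then show ?thesis using norm_fourier_int_le[of "(dir_deriv v ^^ n) a" x] by simp
qed

text \<open>The largest coordinate controls the norm up to the factor \<open>DIM('a)\<close>, and
  its n-th power is one of the summands.\<close>

lemma norm_power_le_sum_Basis:
  fixes x :: "'a::euclidean_space"
  shows "norm x ^ n \<le> real DIM('a) ^ n * (\<Sum>b\<in>Basis. \<bar>x \<bullet> b\<bar> ^ n)"
proof -
  define m where "m = Max ((\<lambda>b. \<bar>x \<bullet> b\<bar>) ` Basis)"
  have "m \<in> (\<lambda>b. \<bar>x \<bullet> b\<bar>) ` Basis" unfolding m_def by (rule Max_in) auto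
  then obtain b where b: "b \<in> Basis" "m = \<bar>x \<bullet> b\<bar>" by auto
  have "norm x \<le> (\<Sum>b\<in>Basis. \<bar>x \<bullet> b\<bar>)" by (rule norm_le_l1)
  also have "\<dots> \<le> (\<Sum>b\<in>(Basis::'a set). m)" unfolding m_def by (intro sum_mono Max_ge) auto
  finally have "norm x \<le> real DIM('a) * m" by simp
  then have "norm x ^ n \<le> (real DIM('a) * m) ^ n" by (rule power_mono) simp
  also have "\<dots> = real DIM('a) ^ n * \<bar>x \<bullet> b\<bar> ^ n" using b by (simp add: power_mult_distrib)
  also have "\<bar>x \<bullet> b\<bar> ^ n \<le> (\<Sum>b\<in>Basis. \<bar>x \<bullet> b\<bar> ^ n)"
    using b by (intro member_le_sum) auto
  finally show ?thesis by (simp add: mult_left_mono)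
qed

text \<open>Integrating by parts n times along each basis vector controls large \<open>x\<close>;
  the L^1 bound controls small \<open>x\<close>.\<close>

theorem inv_fourier_decay:
  fixes a :: "'a::euclidean_space \<Rightarrow> real"
  assumes a: "test_function a"
  obtains C where "C \<ge> 0" "\<And>x. norm (inv_fourier a x) \<le> C / (1 + norm x) ^ n"
proof -
  define L where "L b = (\<integral>\<xi>. \<bar>(dir_deriv b ^^ n) a \<xi>\<bar> \<partial>lborel)" for b
  define c where "c = 1 / (2 * pi) ^ DIM('a)"
  have c: "c > 0" by (simp add: c_def)
  \<comment> \<open>The factor \<open>2 ^ n\<close> comes from
    \<open>(1 + u) ^ n \<le> 2 ^ n * (1 + u ^ n)\<close> for nonnegative u.\<close>
  define C where "C = c * (2 ^ n * ((\<integral>\<xi>. \<bar>a \<xi>\<bar> \<partial>lborel) + real DIM('a) ^ n * (\<Sum>b\<in>Basis. L b)))"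
  have "norm (inv_fourier a x) \<le> C / (1 + norm x) ^ n" for x
  proof -
    let ?N = "norm (fourier_int a x)"
    have "1 + norm x \<le> 2 * max 1 (norm x)" by simp
    then have "(1 + norm x) ^ n \<le> (2 * max 1 (norm x)) ^ n" by (rule power_mono) simp
    also have "\<dots> = 2 ^ n * max 1 (norm x) ^ n" by (rule power_mult_distrib)
    also have "max 1 (norm x) ^ n \<le> 1 + norm x ^ n" by (auto simp: max_def)
    finally have "(1 + norm x) ^ n * ?N \<le> 2 ^ n * (1 + norm x ^ n) * ?N"
      by (simp add: mult_right_mono)
    also have "\<dots> = 2 ^ n * (?N + norm x ^ n * ?N)" by (simp add: algebra_simps)
    also have "\<dots> \<le> 2 ^ n * ((\<integral>\<xi>. \<bar>a \<xi>\<bar> \<partial>lborel) + real DIM('a) ^ n * (\<Sum>b\<in>Basis. L b))"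
    proof (intro mult_left_mono add_mono norm_fourier_int_le)
      have "norm x ^ n * ?N \<le> real DIM('a) ^ n * (\<Sum>b\<in>Basis. \<bar>x \<bullet> b\<bar> ^ n) * ?N"
        by (intro mult_right_mono norm_power_le_sum_Basis) simp
      also have "\<dots> = real DIM('a) ^ n * (\<Sum>b\<in>Basis. \<bar>x \<bullet> b\<bar> ^ n * ?N)"
        by (simp add: sum_distrib_right)
      also have "\<dots> \<le> real DIM('a) ^ n * (\<Sum>b\<in>Basis. L b)"
        unfolding L_def by (intro mult_left_mono sum_mono fourier_int_power_bound a) simp
      finally show "norm x ^ n * ?N \<le> real DIM('a) ^ n * (\<Sum>b\<in>Basis. L b)" .
    qed simp
    finally have "c * ((1 + norm x) ^ n * ?N) \<le> C"
      unfolding C_def using c by (intro mult_left_mono) auto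
    moreover have "norm (inv_fourier a x) = c * ?N"
      by (simp add: inv_fourier_def fourier_int_def c_def norm_mult norm_divide norm_power)
    moreover have "1 + norm x > 0" by (simp add: add_pos_nonneg)
    ultimately show ?thesis
      by (simp add: field_simps)
  qed
  moreover have "C \<ge> 0"
    unfolding C_def L_def using c by (intro mult_nonneg_nonneg add_nonneg_nonneg sum_nonneg) auto
  ultimately show ?thesis by (rule that[rotated])
qed

section \<open>Littlewood-Paley kernels\<close>

lemma lborel_integral_reflect:
  fixes f :: "'a::euclidean_space \<Rightarrow> 'b::{banach, second_countable_topology}"
  assumes "f \<in> borel_measurable borel"
  shows lborel_integrable_reflect_iff: "integrable lborel (\<lambda>y. f (x - y)) \<longleftrightarrow> integrable lborel f"
    and lborel_integral_reflect_eq: "(\<integral>y. f (x - y) \<partial>lborel) = (\<integral>y. f y \<partial>lborel)"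
  using lborel_integrable_affine_iff[OF assms, of "-1" x] lborel_integral_affine_eq[OF assms, of "-1" x] by simp_all

lemma lborel_integral_translate_eq:
  fixes f :: "'a::euclidean_space \<Rightarrow> 'b::{banach, second_countable_topology}"
  assumes "f \<in> borel_measurable borel"
  shows "(\<integral>y. f (y - x) \<partial>lborel) = (\<integral>y. f y \<partial>lborel)"
  using lborel_integral_affine_eq[OF assms, of 1 "-x"] by simp

text \<open>Integrating over \<open>z\<close> first, reflection turns the kernel into its L^1 norm,
  a constant, and only \<open>u\<close> is left.\<close>

lemma integrable_convolution_pair:
  fixes u v :: "'a::euclidean_space \<Rightarrow> 'b::{real_normed_field, banach, second_countable_topology}"
  assumes u: "integrable lborel u" and v: "integrable lborel v"
  shows "integrable (lborel \<Otimes>\<^sub>M lborel) (\<lambda>(y, z). u y * v (y - z))"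
proof (rule lborel_pair.Fubini_integrable)
  have [measurable]: "u \<in> borel_measurable borel" "v \<in> borel_measurable borel"
    using u v by (auto dest: borel_measurable_integrable)
  show "(\<lambda>(y, z). u y * v (y - z)) \<in> borel_measurable (lborel \<Otimes>\<^sub>M lborel)"
    by measurable
  have "(\<integral>z. norm (u y * v (y - z)) \<partial>lborel) = norm (u y) * (\<integral>z. norm (v z) \<partial>lborel)" for y
    using lborel_integral_reflect_eq[of "\<lambda>z. norm (v z)" y] by (simp add: norm_mult)
  then show "integrable lborel (\<lambda>y. \<integral>z. norm (case (y, z) of (y, z) \<Rightarrow> u y * v (y - z)) \<partial>lborel)"
    using u by simp
  show "AE y in lborel. integrable lborel (\<lambda>z. case (y, z) of (y, z) \<Rightarrow> u y * v (y - z))"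
    using v by (simp add: lborel_integrable_reflect_iff)
qed

text \<open>Swapping the variables and reflecting \<open>v\<close> reduces this to the previous
  case.\<close>

lemma integrable_convolution_pair':
  fixes u v :: "'a::euclidean_space \<Rightarrow> 'b::{real_normed_field, banach, second_countable_topology}"
  assumes u: "integrable lborel u" and v: "integrable lborel v"
  shows "integrable (lborel \<Otimes>\<^sub>M lborel) (\<lambda>(y, z). u z * v (y - z))"
proof -
  have [measurable]: "v \<in> borel_measurable borel"
    using v by (auto dest: borel_measurable_integrable)
  have "integrable lborel (\<lambda>y. v (- y))"
    using v lborel_integrable_reflect_iff[of v 0] by simp
  from lborel_pair.integrable_product_swap[OF integrable_convolution_pair[OF u this]]
  show ?thesis by (simp add: split_beta)
qed

text \<open>The triangle inequality in multiplicative form. With \<open>c = 2 ^ K\<close> it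
  exchanges polynomial weights at two points at the price of a factor that the decay of a kernel on
  scale 2^(-K) absorbs.\<close>

lemma peetre:
  fixes x y :: "'a::real_normed_vector"
  assumes "c \<ge> 1"
  shows "1 + norm x \<le> (1 + norm y) * (1 + c * norm (y - x))"
proof -
  have "norm x \<le> norm y + norm (y - x)" by (metis norm_minus_commute norm_triangle_sub)
  also have "norm (y - x) \<le> c * norm (y - x)" using assms by (simp add: mult_le_cancel_right1)
  finally have "1 + norm x \<le> 1 + norm y + c * norm (y - x)" by simp
  also have "\<dots> \<le> (1 + norm y) * (1 + c * norm (y - x))" using assms by (simp add: algebra_simps)
  finally show ?thesis .
qed

section \<open>Low-pass kernels: scaling, decay and convolution\<close>

locale littlewood_paley =
  fixes \<phi>0 :: "'a::euclidean_space \<Rightarrow> real"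
  assumes admissible: "admissible_phi0 \<phi>0"
begin

lemma test_function_\<phi>0: "test_function \<phi>0"
  using admissible by (auto simp: admissible_phi0_def test_function_def intro!: exI[of _ "3/2"])

lemma measurable_\<phi>0 [measurable]: "\<phi>0 \<in> borel_measurable borel"
  by (rule test_function_measurable[OF test_function_\<phi>0])

definition cutoff :: "nat \<Rightarrow> 'a \<Rightarrow> real" where
  "cutoff K \<xi> = \<phi>0 ((1 / 2 ^ K) *\<^sub>R \<xi>)"

text \<open>The kernel of the filter with symbol \<open>cutoff K\<close>, see \<open>Psi_eq\<close>.
  It is defined as a dilate of one fixed function, so that bounds for all levels come from level
  0.\<close>

definition Psi :: "nat \<Rightarrow> 'a \<Rightarrow> complex" where
  "Psi K x = complex_of_real ((2 ^ K) ^ DIM('a)) * inv_fourier \<phi>0 (2 ^ K *\<^sub>R x)"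

lemma measurable_cutoff [measurable]: "cutoff K \<in> borel_measurable borel"
  unfolding cutoff_def by measurable

lemma integrable_cutoff: "integrable lborel (cutoff K)"
  using lborel_integrable_affine_iff[of \<phi>0 "1 / 2 ^ K" 0] test_function_integrable[OF test_function_\<phi>0]
  by (simp add: cutoff_def[abs_def])

lemma continuous_cutoff: "continuous_on UNIV (cutoff K)"
  unfolding cutoff_def
  by (intro continuous_on_compose2[OF test_function_continuous[OF test_function_\<phi>0]] continuous_intros) auto

lemma cutoff_bounded: obtains B where "\<And>K \<xi>. \<bar>cutoff K \<xi>\<bar> \<le> B"
proof -
  obtain B R where BR: "B \<ge> 0" "\<And>x. \<bar>\<phi>0 x\<bar> \<le> B * indicator (cball 0 R) x"
    using test_function_bounded_support[OF test_function_\<phi>0] by metis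
  have "\<bar>\<phi>0 x\<bar> \<le> B" for x
    using BR(1) BR(2)[of x] by (cases "x \<in> cball 0 R") auto
  then show ?thesis by (intro that[of B]) (simp add: cutoff_def)
qed

text \<open>\<open>cutoff K\<close> is 1 up to norm 2^K, while \<open>cutoff j\<close> vanishes from
  norm 3/2 * 2^j on, and \<open>j < K\<close> gives 2 * 2^j <= 2^K.\<close>

lemma cutoff_mult: "j < K \<Longrightarrow> cutoff j \<xi> * cutoff K \<xi> = cutoff j \<xi>"
proof -
  assume jK: "j < K"
  show ?thesis
  proof (cases "norm \<xi> \<le> 2 ^ K")
    case True
    then have "norm ((1 / 2 ^ K) *\<^sub>R \<xi>) \<le> 1" by (simp add: field_simps)
    then have "cutoff K \<xi> = 1" using admissible by (simp add: cutoff_def admissible_phi0_def)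
    then show ?thesis by simp
  next
    case False
    have "(2::real) * 2 ^ j \<le> 2 ^ K" using jK power_increasing[of "Suc j" K "2::real"] by simp
    then have "2 * 2 ^ j \<le> norm \<xi>" using False by linarith
    then have "2 * 2 ^ j / 2 ^ j \<le> norm \<xi> / 2 ^ j" by (intro divide_right_mono) auto
    moreover have "norm ((1 / 2 ^ j) *\<^sub>R \<xi>) = norm \<xi> / 2 ^ j" by simp
    moreover have "(2::real) * 2 ^ j / 2 ^ j = 2" by simp
    ultimately have "norm ((1 / 2 ^ j) *\<^sub>R \<xi>) \<ge> 3 / 2" by linarith
    then have "cutoff j \<xi> = 0" using admissible unfolding cutoff_def admissible_phi0_def by blast
    then show ?thesis by simp
  qed
qed

lemma Psi_eq: "Psi K = inv_fourier (cutoff K)"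
  using inv_fourier_scale[of \<phi>0 "2 ^ K"] by (auto simp: Psi_def cutoff_def[abs_def])

lemma measurable_Psi [measurable]: "Psi K \<in> borel_measurable borel"
  unfolding Psi_eq by measurable

lemma Psi_decay:
  obtains C where "C \<ge> 0" "\<And>K x. norm (Psi K x) \<le> C * 2 ^ (K * DIM('a)) / (1 + 2 ^ K * norm x) ^ n"
proof -
  obtain C where C: "C \<ge> 0" "\<And>x. norm (inv_fourier \<phi>0 x) \<le> C / (1 + norm x) ^ n"
    using inv_fourier_decay[OF test_function_\<phi>0] by blast
  have "norm (Psi K x) \<le> C * 2 ^ (K * DIM('a)) / (1 + 2 ^ K * norm x) ^ n" for K x
  proof -
    have "norm (Psi K x) = 2 ^ (K * DIM('a)) * norm (inv_fourier \<phi>0 (2 ^ K *\<^sub>R x))"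
      by (simp add: Psi_def norm_mult norm_power power_mult)
    also have "\<dots> \<le> 2 ^ (K * DIM('a)) * (C / (1 + norm ((2 ^ K) *\<^sub>R x)) ^ n)"
      by (intro mult_left_mono C) simp
    finally show ?thesis by (simp add: mult.commute)
  qed
  then show ?thesis using C(1) that by blast
qed

lemma Psi_bounded:
  obtains C where "C \<ge> 0" "\<And>K x. norm (Psi K x) \<le> C * 2 ^ (K * DIM('a))"
proof -
  obtain C where "C \<ge> 0" "\<And>K x. norm (Psi K x) \<le> C * 2 ^ (K * DIM('a)) / (1 + 2 ^ K * norm x) ^ 0"
    using Psi_decay[of 0] by blast
  then show ?thesis using that[of C] by simp
qed

lemma integrable_Psi_0: "integrable lborel (Psi 0)"
proof -
  obtain C where C: "C \<ge> 0" "\<And>K x. norm (Psi K x) \<le> C * 2 ^ (K * DIM('a)) / (1 + 2 ^ K * norm x) ^ Suc DIM('a)"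
    using Psi_decay by blast
  show ?thesis
  proof (rule Bochner_Integration.integrable_bound)
    show "integrable lborel (\<lambda>x::'a. C * (1 / (1 + norm x) ^ Suc DIM('a)))"
      by (intro integrable_mult_right integrable_polynomial_decay) simp
    show "AE x in lborel. norm (Psi 0 x) \<le> norm (C * (1 / (1 + norm x) ^ Suc DIM('a)))"
      using C(2)[of 0] C(1) by (intro AE_I2) (simp add: abs_of_nonneg)
  qed simp
qed

lemma Psi_scale: "Psi K x = complex_of_real (2 ^ (K * DIM('a))) * Psi 0 (2 ^ K *\<^sub>R x)"
  by (simp add: Psi_def power_mult)

lemma integrable_Psi: "integrable lborel (Psi K)"
  using lborel_integrable_affine_iff[of "Psi 0" "2 ^ K" 0] integrable_Psi_0
  by (subst Psi_scale[abs_def]) simp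

definition Psi_L1 :: real where "Psi_L1 = (\<integral>x. norm (Psi 0 x) \<partial>lborel)"

lemma Psi_L1_nonneg: "Psi_L1 \<ge> 0" by (simp add: Psi_L1_def)

lemma integral_norm_Psi: "(\<integral>x. norm (Psi K x) \<partial>lborel) = Psi_L1"
proof -
  have "(\<integral>x. norm (Psi K x) \<partial>lborel) = 2 ^ (K * DIM('a)) * (\<integral>x. norm (Psi 0 (0 + 2 ^ K *\<^sub>R x)) \<partial>lborel)"
    by (subst Psi_scale[abs_def]) (simp add: norm_mult norm_power)
  also have "(\<integral>x. norm (Psi 0 (0 + 2 ^ K *\<^sub>R x)) \<partial>lborel) = (1 / \<bar>2 ^ K\<bar> ^ DIM('a)) *\<^sub>R Psi_L1"
    unfolding Psi_L1_def by (rule lborel_integral_affine_eq) auto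
  finally show ?thesis by (simp add: power_mult)
qed

text \<open>Fourier inversion asks for an integrable transform; the rapid decay of the kernel
  supplies it.\<close>

lemma fourier_Psi: "(CLINT y|lborel. Psi K y * cis (- (y \<bullet> \<xi>))) = complex_of_real (cutoff K \<xi>)"
proof -
  obtain B where "\<And>K \<xi>. \<bar>cutoff K \<xi>\<bar> \<le> B" using cutoff_bounded by blast
  then show ?thesis
    using fourier_inversion[OF integrable_cutoff continuous_cutoff, of K B] integrable_Psi by (simp add: Psi_eq)
qed

lemma integral_Psi: "(CLINT y|lborel. Psi K y) = 1"
  using fourier_Psi[of K 0] admissible by (simp add: cutoff_def admissible_phi0_def)

text \<open>On the Fourier side this is \<open>cutoff_mult\<close>. Only \<open>Psi K\<close> is
  written as a Fourier integral; Fubini then produces the transform of \<open>Psi j\<close>, which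
  \<open>fourier_Psi\<close> evaluates.\<close>

lemma Psi_convolution:
  assumes jK: "j < K"
  shows "(CLINT y|lborel. Psi j y * Psi K (x - y)) = Psi j x"
proof -
  define c where "c = complex_of_real (1 / (2 * pi) ^ DIM('a))"
  have pair: "integrable (lborel \<Otimes>\<^sub>M lborel) (\<lambda>(y, \<xi>). Psi j y * (complex_of_real (cutoff K \<xi>) * cis ((x - y) \<bullet> \<xi>)))"
  proof (rule Bochner_Integration.integrable_bound)
    show "integrable (lborel \<Otimes>\<^sub>M lborel) (\<lambda>(y, \<xi>). norm (Psi j y) * \<bar>cutoff K \<xi>\<bar>)"
      by (rule lborel_pair.integrable_product_mult) (use integrable_Psi integrable_cutoff in auto)
  qed (auto simp: norm_mult split_beta)
  have inner: "(CLINT y|lborel. Psi j y * (complex_of_real (cutoff K \<xi>) * cis ((x - y) \<bullet> \<xi>)))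
      = complex_of_real (cutoff j \<xi>) * cis (x \<bullet> \<xi>)" for \<xi>
  proof -
    have split: "cis ((x - y) \<bullet> \<xi>) = cis (x \<bullet> \<xi>) * cis (- (y \<bullet> \<xi>))" for y
      by (simp add: cis_mult inner_diff_left)
    have "(CLINT y|lborel. Psi j y * (complex_of_real (cutoff K \<xi>) * cis ((x - y) \<bullet> \<xi>)))
      = (CLINT y|lborel. (complex_of_real (cutoff K \<xi>) * cis (x \<bullet> \<xi>)) * (Psi j y * cis (- (y \<bullet> \<xi>))))"
      by (simp only: split mult_ac)
    also have "\<dots> = (complex_of_real (cutoff K \<xi>) * cis (x \<bullet> \<xi>)) * complex_of_real (cutoff j \<xi>)"
      by (simp only: integral_mult_right_zero fourier_Psi)
    also have "\<dots> = complex_of_real (cutoff j \<xi> * cutoff K \<xi>) * cis (x \<bullet> \<xi>)" by simp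
    finally show ?thesis unfolding cutoff_mult[OF jK] .
  qed
  have "Psi j y * Psi K (x - y) = c * (CLINT \<xi>|lborel. Psi j y * (complex_of_real (cutoff K \<xi>) * cis ((x - y) \<bullet> \<xi>)))" for y
    unfolding integral_mult_right_zero by (simp add: Psi_eq[of K] inv_fourier_def c_def mult_ac)
  then have "(CLINT y|lborel. Psi j y * Psi K (x - y))
    = c * (CLINT y|lborel. CLINT \<xi>|lborel. Psi j y * (complex_of_real (cutoff K \<xi>) * cis ((x - y) \<bullet> \<xi>)))"
    by (simp only: integral_mult_right_zero)
  also have "(CLINT y|lborel. CLINT \<xi>|lborel. Psi j y * (complex_of_real (cutoff K \<xi>) * cis ((x - y) \<bullet> \<xi>)))
    = (CLINT \<xi>|lborel. CLINT y|lborel. Psi j y * (complex_of_real (cutoff K \<xi>) * cis ((x - y) \<bullet> \<xi>)))"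
    by (rule lborel_pair.Fubini_integral[OF pair, symmetric])
  also have "(CLINT \<xi>|lborel. CLINT y|lborel. Psi j y * (complex_of_real (cutoff K \<xi>) * cis ((x - y) \<bullet> \<xi>)))
    = (CLINT \<xi>|lborel. complex_of_real (cutoff j \<xi>) * cis (x \<bullet> \<xi>))"
    by (simp only: inner)
  finally show ?thesis by (simp add: c_def Psi_eq[of j] inv_fourier_def)
qed

lemma psik_0: "psik \<phi>0 0 = Psi 0"
  by (rule ext) (simp add: psik_def phik_def Psi_eq inv_fourier_def cutoff_def integral_completion)

text \<open>The symbols \<open>phik\<close> of positive index are differences of consecutive
  cutoffs.\<close>

lemma psik_Suc: "psik \<phi>0 (Suc k) x = Psi (Suc k) x - Psi k x"
proof -
  have "psik \<phi>0 (Suc k) x = inv_fourier (\<lambda>\<xi>. cutoff (Suc k) \<xi> - cutoff k \<xi>) x"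
    unfolding psik_def inv_fourier_def
    by (subst integral_completion) (simp_all add: phik_def cutoff_def)
  then show ?thesis by (simp add: inv_fourier_diff integrable_cutoff Psi_eq)
qed

text \<open>Peetre's inequality moves the weight from
  the variable of integration to the centre of the kernel.\<close>
lemma Psi_weighted_L2:
  fixes C\<phi> :: real
  assumes C\<phi>: "C\<phi> \<ge> 0"
  obtains C where "C \<ge> 0" "\<And>K x. (\<integral>\<^sup>+ y. ennreal ((norm (Psi K (y - x)))\<^sup>2 * (C\<phi> / (1 + norm y) ^ DIM('a))) \<partial>lborel)
    \<le> ennreal (C * 2 ^ (K * DIM('a)) / (1 + norm x) ^ DIM('a))"
proof -
  obtain C where C: "C \<ge> 0" "\<And>K x. norm (Psi K x) \<le> C * 2 ^ (K * DIM('a)) / (1 + 2 ^ K * norm x) ^ Suc DIM('a)"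
    using Psi_decay by blast
  define I where "I = (\<integral>(x::'a). 1 / (1 + norm x) ^ Suc DIM('a) \<partial>lborel)"
  have I: "(\<integral>\<^sup>+(x::'a). ennreal (1 / (1 + norm x) ^ Suc DIM('a)) \<partial>lborel) = ennreal I" "I \<ge> 0"
    unfolding I_def using integrable_polynomial_decay[of "Suc DIM('a)", where 'a = 'a]
    by (auto intro!: nn_integral_eq_integral)
  have "(\<integral>\<^sup>+ y. ennreal ((norm (Psi K (y - x)))\<^sup>2 * (C\<phi> / (1 + norm y) ^ DIM('a))) \<partial>lborel)
    \<le> ennreal (C\<^sup>2 * C\<phi> * I * 2 ^ (K * DIM('a)) / (1 + norm x) ^ DIM('a))" for K and x :: 'a
  proof -
    \<comment> \<open>Two kernels contribute the square of \<open>2 ^ (K * DIM('a))\<close>; the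
      affine substitution at the end takes one of these factors back.\<close>
    define A where "A = C\<^sup>2 * C\<phi> * (2 ^ (K * DIM('a)))\<^sup>2 / (1 + norm x) ^ DIM('a)"
    have A: "A \<ge> 0" using C(1) C\<phi> by (simp add: A_def)
    have pointwise: "(norm (Psi K (y - x)))\<^sup>2 * (C\<phi> / (1 + norm y) ^ DIM('a)) \<le> A * (1 / (1 + norm (- (2 ^ K) *\<^sub>R x + 2 ^ K *\<^sub>R y)) ^ Suc DIM('a))" for y
    proof -
      define t where "t = 1 + 2 ^ K * norm (y - x)"
      have t: "t \<ge> 1" by (simp add: t_def)
      have t_eq: "1 + norm (- (2 ^ K) *\<^sub>R x + 2 ^ K *\<^sub>R y) = t"
      proof -
        have "- (2 ^ K) *\<^sub>R x + 2 ^ K *\<^sub>R y = (2 ^ K) *\<^sub>R (y - x)" by (simp add: scaleR_diff_right)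
        then show ?thesis by (simp add: t_def)
      qed
      have "1 + norm x \<le> (1 + norm y) * t"
        unfolding t_def by (rule peetre) simp
      then have "(1 + norm x) ^ DIM('a) \<le> ((1 + norm y) * t) ^ DIM('a)" by (intro power_mono) auto
      then have "(1 + norm x) ^ DIM('a) \<le> (1 + norm y) ^ DIM('a) * t ^ DIM('a)"
        by (simp only: power_mult_distrib)
      moreover have "1 / a \<le> u / b" if "b \<le> a * u" "a > 0" "b > 0" for a b u :: real
        using that by (simp add: field_simps)
      ultimately have peetre: "1 / (1 + norm y) ^ DIM('a) \<le> t ^ DIM('a) / (1 + norm x) ^ DIM('a)"
        by (simp add: add_pos_nonneg)
      have "(norm (Psi K (y - x)))\<^sup>2 \<le> (C * 2 ^ (K * DIM('a)) / t ^ Suc DIM('a))\<^sup>2"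
        unfolding t_def by (intro power_mono C) simp
      then have "(norm (Psi K (y - x)))\<^sup>2 * (C\<phi> / (1 + norm y) ^ DIM('a))
         \<le> (C * 2 ^ (K * DIM('a)) / t ^ Suc DIM('a))\<^sup>2 * (C\<phi> * (t ^ DIM('a) / (1 + norm x) ^ DIM('a)))"
        using mult_left_mono[OF peetre C\<phi>] C\<phi> by (intro mult_mono) auto
      also have "\<dots> = A * (t ^ DIM('a) / (t ^ Suc DIM('a))\<^sup>2)"
        by (simp add: A_def power_divide power_mult_distrib mult_ac)
      \<comment> \<open>The squared kernel decays like t^(-2(d+1)): this pays for the t^d of
        Peetre's inequality and still leaves an integrable power.\<close>
      also have "t ^ DIM('a) / (t ^ Suc DIM('a))\<^sup>2 \<le> 1 / t ^ Suc DIM('a)"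
      proof -
        have "t ^ DIM('a) \<le> t ^ Suc DIM('a)" using t by (intro power_increasing) auto
        then show ?thesis using t by (simp add: field_simps power2_eq_square)
      qed
      finally show ?thesis using A unfolding t_eq by (simp add: mult_left_mono)
    qed
    have "(\<integral>\<^sup>+ y. ennreal ((norm (Psi K (y - x)))\<^sup>2 * (C\<phi> / (1 + norm y) ^ DIM('a))) \<partial>lborel)
      \<le> (\<integral>\<^sup>+ y. ennreal A * ennreal (1 / (1 + norm (- (2 ^ K) *\<^sub>R x + 2 ^ K *\<^sub>R y)) ^ Suc DIM('a)) \<partial>lborel)"
      using pointwise A by (intro nn_integral_mono) (simp add: ennreal_mult[symmetric] ennreal_leI)
    also have "\<dots> = ennreal A * (ennreal (1 / \<bar>2 ^ K\<bar> ^ DIM('a)) * ennreal I)"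
      unfolding I(1)[symmetric]
      by (subst nn_integral_cmult, measurable) (subst nn_integral_lborel_affine, auto)
    also have "\<dots> = ennreal (C\<^sup>2 * C\<phi> * I * 2 ^ (K * DIM('a)) / (1 + norm x) ^ DIM('a))"
      using A I(2) by (simp add: ennreal_mult[symmetric] A_def power2_eq_square power_mult) (simp add: mult_ac)
    finally show ?thesis .
  qed
  moreover have "C\<^sup>2 * C\<phi> * I \<ge> 0" using C\<phi> I(2) by simp
  ultimately show ?thesis by (rule that[rotated])
qed

end

lemma le_one_plus_powr: "0 \<le> (u::real) \<Longrightarrow> 1 \<le> p \<Longrightarrow> u \<le> 1 + u powr p"
proof (cases "u \<le> 1")
  case False
  assume "1 \<le> p"
  then have "u powr 1 \<le> u powr p" using False by (intro powr_mono) auto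
  then show ?thesis using False by simp
qed (simp add: add_increasing2)

definition Lpfun :: "real \<Rightarrow> ('a::euclidean_space \<Rightarrow> complex) \<Rightarrow> bool" where
  "Lpfun p F \<longleftrightarrow> F \<in> borel_measurable borel \<and> integrable lborel (\<lambda>x. norm (F x) powr p)"

lemma Lpfun_measurable [measurable_dest]: "Lpfun p F \<Longrightarrow> F \<in> borel_measurable borel"
  by (simp add: Lpfun_def)

section \<open>Convolution with the kernels and the dyadic blocks\<close>

context littlewood_paley
begin

definition conv :: "('a \<Rightarrow> complex) \<Rightarrow> nat \<Rightarrow> 'a \<Rightarrow> complex" where
  "conv F K x = (CLINT y|lborel. F y * Psi K (x - y))"

text \<open>A substitute for Hoelder's inequality: an L^p factor times a bounded integrable kernel
  is dominated by two integrable terms, with no conjugate exponent, which would be infinite for p =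
  1.\<close>

lemma norm_times_Psi_le:
  fixes z w :: complex
  assumes "1 \<le> p" "norm w \<le> B"
  shows "norm (z * w) \<le> norm w + B * norm z powr p"
proof -
  have "norm z * norm w \<le> (1 + norm z powr p) * norm w"
    using assms by (intro mult_right_mono le_one_plus_powr) auto
  also have "\<dots> = norm w + norm w * norm z powr p" by (simp add: algebra_simps)
  also have "norm w * norm z powr p \<le> B * norm z powr p"
    using assms by (intro mult_right_mono) auto
  finally show ?thesis by (simp add: norm_mult)
qed

lemma integrable_conv:
  assumes F: "Lpfun p F" and p: "1 \<le> p"
  shows "integrable lborel (\<lambda>y. F y * Psi K (x - y))"
proof -
  obtain C where C: "\<And>K x. norm (Psi K x) \<le> C * 2 ^ (K * DIM('a))"
    using Psi_bounded by metis
  note [measurable] = Lpfun_measurable[OF F]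
  show ?thesis
  proof (rule Bochner_Integration.integrable_bound)
    have "integrable lborel (\<lambda>y. norm (Psi K (x - y)))"
      using lborel_integrable_reflect_iff[of "Psi K" x] integrable_Psi by (intro integrable_norm) simp
    then show "integrable lborel (\<lambda>y. norm (Psi K (x - y)) + C * 2 ^ (K * DIM('a)) * norm (F y) powr p)"
      using F by (intro Bochner_Integration.integrable_add integrable_mult_right) (auto simp: Lpfun_def)
    show "AE y in lborel. norm (F y * Psi K (x - y)) \<le> norm (norm (Psi K (x - y)) + C * 2 ^ (K * DIM('a)) * norm (F y) powr p)"
      by (intro AE_I2 order_trans[OF norm_times_Psi_le[OF p C]]) simp
  qed measurable
qed

lemma measurable_conv [measurable]:
  assumes [measurable]: "F \<in> borel_measurable borel"
  shows "conv F K \<in> borel_measurable borel"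
  unfolding conv_def by measurable

text \<open>Associativity of convolution combined with \<open>Psi_convolution\<close>: a low-passed
  function is reproduced by every kernel of higher level.\<close>

lemma conv_conv:
  assumes F: "Lpfun p F" and p: "1 \<le> p" and jK: "j < K"
  shows integrable_conv_conv: "integrable lborel (\<lambda>y. conv F j y * Psi K (x - y))"
    and conv_conv_eq: "conv (conv F j) K x = conv F j x"
proof -
  obtain C where C: "\<And>K x. norm (Psi K x) \<le> C * 2 ^ (K * DIM('a))"
    using Psi_bounded by metis
  note [measurable] = Lpfun_measurable[OF F]
  let ?h = "\<lambda>(y, z). F z * Psi j (y - z) * Psi K (x - y)"
  have norm_Psi: "integrable lborel (\<lambda>y. norm (Psi j y))" for j
    using integrable_Psi by (intro integrable_norm)
  \<comment> \<open>To dominate the triple product, \<open>norm_times_Psi_le\<close> separates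
    \<open>F z\<close> from \<open>Psi K (x - y)\<close>, which leaves two convolution
    integrands.\<close>
  have pair: "integrable (lborel \<Otimes>\<^sub>M lborel) ?h"
  proof (rule Bochner_Integration.integrable_bound)
    have "integrable lborel (\<lambda>y. norm (Psi K (x - y)))"
      using lborel_integrable_reflect_iff[of "Psi K" x] integrable_Psi by (intro integrable_norm) simp
    from integrable_convolution_pair[OF this norm_Psi[of j]]
    have 1: "integrable (lborel \<Otimes>\<^sub>M lborel) (\<lambda>(y, z). norm (Psi K (x - y)) * norm (Psi j (y - z)))" .
    have 2: "integrable (lborel \<Otimes>\<^sub>M lborel) (\<lambda>(y, z). norm (F z) powr p * norm (Psi j (y - z)))"
      using F by (intro integrable_convolution_pair' norm_Psi) (simp add: Lpfun_def)
    show "integrable (lborel \<Otimes>\<^sub>M lborel) (\<lambda>w. (case w of (y, z) \<Rightarrow> norm (Psi K (x - y)) * norm (Psi j (y - z)))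
       + C * 2 ^ (K * DIM('a)) * (case w of (y, z) \<Rightarrow> norm (F z) powr p * norm (Psi j (y - z))))"
      by (intro Bochner_Integration.integrable_add 1 integrable_mult_right 2)
    show "AE w in lborel \<Otimes>\<^sub>M lborel. norm (?h w) \<le> norm ((case w of (y, z) \<Rightarrow> norm (Psi K (x - y)) * norm (Psi j (y - z)))
       + C * 2 ^ (K * DIM('a)) * (case w of (y, z) \<Rightarrow> norm (F z) powr p * norm (Psi j (y - z))))"
    proof (intro AE_I2)
      fix w :: "'a \<times> 'a"
      obtain y z where w: "w = (y, z)" by force
      have "norm (F z * Psi j (y - z) * Psi K (x - y)) = norm (F z * Psi K (x - y)) * norm (Psi j (y - z))"
        by (simp add: norm_mult mult_ac)
      also have "\<dots> \<le> (norm (Psi K (x - y)) + C * 2 ^ (K * DIM('a)) * norm (F z) powr p) * norm (Psi j (y - z))"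
        by (intro mult_right_mono norm_times_Psi_le p C) simp
      also have "\<dots> = norm (Psi K (x - y)) * norm (Psi j (y - z)) + C * 2 ^ (K * DIM('a)) * (norm (F z) powr p * norm (Psi j (y - z)))"
        by (simp add: algebra_simps)
      finally show "norm (?h w) \<le> norm ((case w of (y, z) \<Rightarrow> norm (Psi K (x - y)) * norm (Psi j (y - z)))
       + C * 2 ^ (K * DIM('a)) * (case w of (y, z) \<Rightarrow> norm (F z) powr p * norm (Psi j (y - z))))"
        unfolding w by simp
    qed
    show "?h \<in> borel_measurable (lborel \<Otimes>\<^sub>M lborel)" by measurable
  qed
  show "integrable lborel (\<lambda>y. conv F j y * Psi K (x - y))"
    using lborel_pair.integrable_fst'[OF pair] by (simp add: conv_def)
  have "conv (conv F j) K x = (CLINT z|lborel. CLINT y|lborel. F z * Psi j (y - z) * Psi K (x - y))"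
    using lborel_pair.Fubini_integral[OF pair] by (simp add: conv_def)
  also have "\<dots> = (CLINT z|lborel. F z * Psi j (x - z))"
  proof (intro Bochner_Integration.integral_cong refl)
    fix z
    have "(CLINT y|lborel. F z * Psi j (y - z) * Psi K (x - y)) = F z * (CLINT y|lborel. Psi j (y - z) * Psi K ((x - z) - (y - z)))"
      by (simp add: mult.assoc)
    also have "(CLINT y|lborel. Psi j (y - z) * Psi K ((x - z) - (y - z))) = (CLINT y|lborel. Psi j y * Psi K ((x - z) - y))"
      by (rule lborel_integral_translate_eq[where f = "\<lambda>y. Psi j y * Psi K ((x - z) - y)"]) measurable
    finally show "(CLINT y|lborel. F z * Psi j (y - z) * Psi K (x - y)) = F z * Psi j (x - z)"
      by (simp add: Psi_convolution[OF jK])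
  qed
  finally show "conv (conv F j) K x = conv F j x" by (simp add: conv_def)
qed

definition block :: "('a \<Rightarrow> complex) \<Rightarrow> nat \<Rightarrow> 'a \<Rightarrow> complex" where
  "block F k x = (if k = 0 then conv F 0 x else conv F k x - conv F (k - 1) x)"

lemma measurable_block [measurable]:
  assumes [measurable]: "F \<in> borel_measurable borel"
  shows "block F k \<in> borel_measurable borel"
  unfolding block_def by measurable

lemma sum_block: "(\<Sum>k<Suc n. block F k x) = conv F n x"
  by (induction n) (auto simp: block_def)

text \<open>Both \<open>conv F k\<close> and \<open>conv F (k - 1)\<close> have level below
  \<open>Suc k\<close>, so the kernel of level \<open>Suc k\<close> reproduces each of them.\<close>

lemma block_reproducing:
  assumes F: "Lpfun p F" and p: "1 \<le> p"
  shows integrable_block_conv: "integrable lborel (\<lambda>y. block F k y * Psi (Suc k) (x - y))"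
    and conv_block: "conv (block F k) (Suc k) x = block F k x"
proof -
  show "integrable lborel (\<lambda>y. block F k y * Psi (Suc k) (x - y))"
    using integrable_conv_conv[OF F p, of k "Suc k" x] integrable_conv_conv[OF F p, of "k - 1" "Suc k" x]
    by (cases "k = 0") (simp_all add: block_def left_diff_distrib)
  show "conv (block F k) (Suc k) x = block F k x"
  proof (cases "k = 0")
    case True
    then show ?thesis using conv_conv_eq[OF F p, of 0 "Suc 0" x] by (simp add: block_def[abs_def])
  next
    case False
    have "conv (block F k) (Suc k) x = conv (conv F k) (Suc k) x - conv (conv F (k - 1)) (Suc k) x"
      using False integrable_conv_conv[OF F p, of k "Suc k" x] integrable_conv_conv[OF F p, of "k - 1" "Suc k" x]
      by (simp add: conv_def[of _ "Suc k"] block_def left_diff_distrib)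
    then show ?thesis
      using False conv_conv_eq[OF F p, of k "Suc k" x] conv_conv_eq[OF F p, of "k - 1" "Suc k" x] by (simp add: block_def)
  qed
qed

text \<open>Links the blocks in the definition of the norm to differences of low-passed functions;
  integrability of each single convolution permits splitting the difference.\<close>

lemma dyadic_block_eq:
  assumes F: "Lpfun p (\<lambda>y. complex_of_real (f y))" and p: "1 \<le> p"
  shows "dyadic_block \<phi>0 k f x = block (\<lambda>y. complex_of_real (f y)) k x"
proof -
  have [measurable]: "(\<lambda>y. complex_of_real (f y)) \<in> borel_measurable borel"
    using F by (rule Lpfun_measurable)
  have psik: "psik \<phi>0 k = (if k = 0 then Psi 0 else (\<lambda>x. Psi k x - Psi (k - 1) x))"
    by (cases k) (auto simp: psik_0 psik_Suc)
  have "dyadic_block \<phi>0 k f x = (CLINT y|lborel. complex_of_real (f y) * psik \<phi>0 k (x - y))"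
    unfolding dyadic_block_def by (rule integral_completion) (simp add: psik)
  also have "\<dots> = block (\<lambda>y. complex_of_real (f y)) k x"
    using integrable_conv[OF F p, of k x] integrable_conv[OF F p, of "k - 1" x]
    by (cases k) (simp_all add: psik_0 psik_Suc block_def conv_def right_diff_distrib)
  finally show ?thesis .
qed

text \<open>Self-improvement by the reproducing formula \<open>b = b * Psi K\<close>: from \<open>|b| \<le> \<lambda> (1 + (|b| / \<lambda>)^p)\<close>
  with \<open>\<lambda> = 2^(K d / p) A\<close> both resulting terms are \<open>O(\<lambda>)\<close>, so Hoelder's inequality is not needed.\<close>
lemma nikolskii_sup:
  assumes p: "1 \<le> p"
  obtains C where "C > 0"
    "\<And>K b A x. \<lbrakk>A > 0; integrable lborel (\<lambda>y. b y * Psi K (x - y)); b x = conv b K x;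
       integrable lborel (\<lambda>x. norm (b x) powr p); (\<integral>x. norm (b x) powr p \<partial>lborel) \<le> A powr p\<rbrakk>
      \<Longrightarrow> norm (b x) \<le> C * 2 powr (real K * DIM('a) / p) * A"
proof -
  obtain B where B: "B \<ge> 0" "\<And>K x. norm (Psi K x) \<le> B * 2 ^ (K * DIM('a))"
    using Psi_bounded by metis
  have "norm (b x) \<le> (Psi_L1 + B + 1) * 2 powr (real K * DIM('a) / p) * A"
    if A: "A > 0" and int: "integrable lborel (\<lambda>y. b y * Psi K (x - y))" and bx: "b x = conv b K x"
      and b: "integrable lborel (\<lambda>x. norm (b x) powr p)" and bA: "(\<integral>x. norm (b x) powr p \<partial>lborel) \<le> A powr p"
    for K b A x
  proof -
    define l where "l = 2 powr (real K * DIM('a) / p) * A"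
    have l: "l > 0" using A by (simp add: l_def)
    have Psi_int: "integrable lborel (\<lambda>y. Psi K (x - y))"
      using lborel_integrable_reflect_iff[of "Psi K" x] integrable_Psi by simp
    have pointwise: "norm (b y * Psi K (x - y)) \<le> l * norm (Psi K (x - y)) + (l powr (1 - p) * (B * 2 ^ (K * DIM('a)))) * norm (b y) powr p" for y
    proof -
      have "norm (b y) / l \<le> 1 + (norm (b y) / l) powr p"
        using l p by (intro le_one_plus_powr) auto
      then have "norm (b y) \<le> l * (1 + (norm (b y) / l) powr p)"
        using l by (simp add: field_simps)
      also have "\<dots> = l + l powr (1 - p) * norm (b y) powr p"
        using l by (simp add: powr_divide powr_diff field_simps)
      finally have le: "norm (b y) \<le> l + l powr (1 - p) * norm (b y) powr p" .
      have "norm (b y * Psi K (x - y)) \<le> (l + l powr (1 - p) * norm (b y) powr p) * norm (Psi K (x - y))"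
        unfolding norm_mult by (intro mult_right_mono le) simp
      also have "\<dots> = l * norm (Psi K (x - y)) + l powr (1 - p) * norm (b y) powr p * norm (Psi K (x - y))"
        by (simp add: algebra_simps)
      also have "l powr (1 - p) * norm (b y) powr p * norm (Psi K (x - y)) \<le> l powr (1 - p) * norm (b y) powr p * (B * 2 ^ (K * DIM('a)))"
        by (intro mult_left_mono B) simp
      finally show ?thesis by (simp add: mult_ac)
    qed
    have "norm (b x) \<le> (\<integral>y. norm (b y * Psi K (x - y)) \<partial>lborel)"
      unfolding bx conv_def by (rule integral_norm_bound)
    also have "\<dots> \<le> (\<integral>y. l * norm (Psi K (x - y)) + (l powr (1 - p) * (B * 2 ^ (K * DIM('a)))) * norm (b y) powr p \<partial>lborel)"
      by (intro integral_mono Bochner_Integration.integrable_add integrable_mult_right integrable_norm int Psi_int b pointwise)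
    also have "\<dots> = l * Psi_L1 + (l powr (1 - p) * (B * 2 ^ (K * DIM('a)))) * (\<integral>x. norm (b x) powr p \<partial>lborel)"
      using Psi_int b lborel_integral_reflect_eq[of "\<lambda>y. norm (Psi K y)" x] by (simp add: integral_norm_Psi)
    also have "\<dots> \<le> l * Psi_L1 + (l powr (1 - p) * (B * 2 ^ (K * DIM('a)))) * A powr p"
      using bA B(1) by (intro add_left_mono mult_left_mono) auto
    \<comment> \<open>The choice of \<open>l\<close> makes \<open>l powr p\<close> equal to
      \<open>2 ^ (K * DIM('a)) * A powr p\<close>, so the sup bound of the kernel and the norm of
      \<open>b\<close> cancel.\<close>
    also have "(l powr (1 - p) * (B * 2 ^ (K * DIM('a)))) * A powr p = l * B"
    proof -
      have "l powr p = 2 ^ (K * DIM('a)) * A powr p"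
        using A p by (simp add: l_def powr_mult powr_powr flip: powr_realpow)
      moreover have "l powr (1 - p) = l / l powr p" using l by (simp add: powr_diff)
      moreover have "A powr p > 0" using A by simp
      ultimately show ?thesis by (simp add: field_simps)
    qed
    also have "l * Psi_L1 + l * B \<le> (Psi_L1 + B + 1) * l"
      using l by (simp add: algebra_simps)
    finally show ?thesis by (simp add: l_def mult.assoc)
  qed
  moreover have "Psi_L1 + B + 1 > 0" using Psi_L1_nonneg B(1) by linarith
  ultimately show ?thesis by (rule that[rotated])
qed

end

section \<open>Littlewood-Paley expansion\<close>

text \<open>\<open>ennreal\<close> cuts off negative values, so \<open>u\<close> and
  \<open>- u\<close> give the densities of the positive and the negative part. The two measures
  agree on boxes, a generating family closed under intersection, hence everywhere.\<close>

lemma AE_zero_if_box_integrals_zero: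
  fixes u :: "'a::euclidean_space \<Rightarrow> real"
  assumes [measurable]: "u \<in> borel_measurable borel"
    and int: "\<And>a b. integrable lborel (\<lambda>x. indicat_real (box a b) x * u x)"
    and zero: "\<And>a b. (\<integral>x. indicat_real (box a b) x * u x \<partial>lborel) = 0"
  shows "AE x in lborel. u x = 0"
proof -
  let ?E = "range (\<lambda>(a, b). box a b :: 'a set)"
  have part: "emeasure (density lborel (\<lambda>x. ennreal (v x))) (box a b) = ennreal (\<integral>x. indicat_real (box a b) x * max 0 (v x) \<partial>lborel)"
    if [measurable]: "v \<in> borel_measurable borel" and "integrable lborel (\<lambda>x. indicat_real (box a b) x * v x)" for v a b
  proof -
    have "emeasure (density lborel (\<lambda>x. ennreal (v x))) (box a b) = (\<integral>\<^sup>+x. ennreal (indicat_real (box a b) x * max 0 (v x)) \<partial>lborel)"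
      by (subst emeasure_density) (auto intro!: nn_integral_cong simp: indicator_def max_def ennreal_neg)
    also have "\<dots> = ennreal (\<integral>x. indicat_real (box a b) x * max 0 (v x) \<partial>lborel)"
      by (rule nn_integral_eq_integral, rule Bochner_Integration.integrable_bound[OF that(2)])
        (auto intro!: AE_I2 simp: indicator_def)
    finally show ?thesis .
  qed
  have eq: "(\<integral>x. indicat_real (box a b) x * max 0 (u x) \<partial>lborel) = (\<integral>x. indicat_real (box a b) x * max 0 (- u x) \<partial>lborel)" for a b
  proof -
    have "integrable lborel (\<lambda>x. indicat_real (box a b) x * max 0 (u x))" "integrable lborel (\<lambda>x. indicat_real (box a b) x * max 0 (- u x))"
      by (rule Bochner_Integration.integrable_bound[OF int[of a b]]; auto intro!: AE_I2 simp: indicator_def)+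
    then have "(\<integral>x. indicat_real (box a b) x * max 0 (u x) \<partial>lborel) - (\<integral>x. indicat_real (box a b) x * max 0 (- u x) \<partial>lborel)
      = (\<integral>x. indicat_real (box a b) x * max 0 (u x) - indicat_real (box a b) x * max 0 (- u x) \<partial>lborel)"
      by simp
    also have "\<dots> = (\<integral>x. indicat_real (box a b) x * u x \<partial>lborel)"
      by (intro Bochner_Integration.integral_cong) (auto simp: max_def indicator_def)
    finally show ?thesis using zero by simp
  qed
  have "density lborel (\<lambda>x. ennreal (u x)) = density lborel (\<lambda>x. ennreal (- u x))"
  proof (rule measure_eqI_generator_eq)
    show "Int_stable ?E" by (auto simp: Int_stable_def box_Int_box)
    show "range (\<lambda>n::nat. box (- (real n *\<^sub>R One)) (real n *\<^sub>R One)) \<subseteq> ?E" by auto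
    show "(\<Union>n::nat. box (- (real n *\<^sub>R One)) (real n *\<^sub>R One)) = (UNIV :: 'a set)"
      by (rule UN_box_eq_UNIV)
    show "emeasure (density lborel (\<lambda>x. ennreal (u x))) X = emeasure (density lborel (\<lambda>x. ennreal (- u x))) X" if "X \<in> ?E" for X
      using that int by (auto simp: part eq)
    show "emeasure (density lborel (\<lambda>x. ennreal (u x))) (box (- (real n *\<^sub>R One)) (real n *\<^sub>R One)) \<noteq> \<infinity>" for n :: nat
      using int by (simp add: part)
  qed (auto simp: borel_eq_box)
  then have "AE x in lborel. ennreal (u x) = ennreal (- u x)"
    by (intro sigma_finite_measure.density_unique[OF sigma_finite_lborel]) auto
  \<comment> \<open>Positive and negative part of a number coincide only if both are 0.\<close>
  then show ?thesis
    by eventually_elim (metis ennreal_eq_0_iff ennreal_neg linorder_linear neg_le_0_iff_le order_antisym_conv)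
qed

lemma AE_notin_frontier_box: "AE y in lborel. y \<notin> frontier (box a b :: 'a::euclidean_space set)"
proof -
  have "frontier (box a b) \<in> null_sets lebesgue"
    using negligible_convex_frontier[of "box a b"] by (simp add: negligible_iff_null_sets convex_box)
  then have "frontier (box a b) \<in> null_sets lborel"
    by (subst (asm) null_sets_completion_iff) (auto simp: borel_closed)
  then show ?thesis by (rule AE_not_in)
qed

section \<open>Convergence of the low-pass approximations, tested on boxes\<close>

context littlewood_paley
begin

text \<open>The adjoint of the filter applied to an indicator: integration runs over the first
  argument of \<open>Psi n (x - y)\<close>, not over \<open>y\<close> as in
  \<open>conv\<close>.\<close>

definition box_average :: "'a set \<Rightarrow> nat \<Rightarrow> 'a \<Rightarrow> complex" where
  "box_average A n y = (CLINT x|lborel. complex_of_real (indicat_real A x) * Psi n (x - y))"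

lemma measurable_box_average [measurable]:
  assumes [measurable]: "A \<in> sets borel" shows "box_average A n \<in> borel_measurable borel"
  unfolding box_average_def by measurable

text \<open>An approximate identity: after substituting x = y + 2^(-n) u the indicator is eventually
  constant for each u, because y has a neighbourhood inside or outside the box.\<close>

lemma box_average_tendsto:
  assumes y: "y \<notin> frontier (box a b)"
  shows "(\<lambda>n. box_average (box a b) n y) \<longlonglongrightarrow> complex_of_real (indicat_real (box a b) y)"
proof -
  let ?A = "box a b"
  have eq: "box_average ?A n y = (CLINT u|lborel. complex_of_real (indicat_real ?A (y + (1 / 2 ^ n) *\<^sub>R u)) * Psi 0 u)" for n
  proof -
    have "(CLINT u|lborel. complex_of_real (indicat_real ?A (y + (1 / 2 ^ n) *\<^sub>R u)) * Psi n ((y + (1 / 2 ^ n) *\<^sub>R u) - y))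
      = (1 / \<bar>1 / 2 ^ n\<bar> ^ DIM('a)) *\<^sub>R box_average ?A n y"
      unfolding box_average_def
      by (rule lborel_integral_affine_eq[where f = "\<lambda>x. complex_of_real (indicat_real ?A x) * Psi n (x - y)"]) auto
    moreover have "Psi n ((y + (1 / 2 ^ n) *\<^sub>R u) - y) = complex_of_real (2 ^ (n * DIM('a))) * Psi 0 u" for u
      by (subst Psi_scale) simp
    ultimately have "complex_of_real (2 ^ (n * DIM('a))) * (CLINT u|lborel. complex_of_real (indicat_real ?A (y + (1 / 2 ^ n) *\<^sub>R u)) * Psi 0 u)
      = complex_of_real (2 ^ (n * DIM('a))) * box_average ?A n y"
      by (simp only: mult.left_commute[of "complex_of_real (indicat_real _ _)"] integral_mult_right_zero)
        (simp add: scaleR_conv_of_real power_divide power_mult)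
    then show ?thesis by simp
  qed
  have "(\<lambda>n. CLINT u|lborel. complex_of_real (indicat_real ?A (y + (1 / 2 ^ n) *\<^sub>R u)) * Psi 0 u)
     \<longlonglongrightarrow> (CLINT u|lborel. complex_of_real (indicat_real ?A y) * Psi 0 u)"
  proof (rule integral_dominated_convergence[where w = "\<lambda>u. norm (Psi 0 u)"])
    show "AE u in lborel. (\<lambda>n. complex_of_real (indicat_real ?A (y + (1 / 2 ^ n) *\<^sub>R u)) * Psi 0 u) \<longlonglongrightarrow> complex_of_real (indicat_real ?A y) * Psi 0 u"
    proof (rule AE_I2)
      fix u
      have "(\<lambda>n. (1 / 2) ^ n :: real) \<longlonglongrightarrow> 0" by (rule LIMSEQ_realpow_zero) auto
      then have "(\<lambda>n. y + (1 / 2) ^ n *\<^sub>R u) \<longlonglongrightarrow> y + 0 *\<^sub>R u"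
        by (intro tendsto_add tendsto_scaleR tendsto_const)
      then have lim: "(\<lambda>n. y + (1 / 2 ^ n) *\<^sub>R u) \<longlonglongrightarrow> y" by (simp add: power_divide)
      have "\<forall>\<^sub>F n in sequentially. indicat_real ?A (y + (1 / 2 ^ n) *\<^sub>R u) = indicat_real ?A y"
      proof (cases "y \<in> ?A")
        case True
        then show ?thesis
          using topological_tendstoD[OF lim open_box True] by (auto elim!: eventually_mono)
      next
        case False
        then have out: "y \<in> - closure ?A" using y by (auto simp: frontier_def interior_open open_box)
        then show ?thesis
          using topological_tendstoD[OF lim open_Compl[OF closed_closure] out] False closure_subset[of ?A]
          by (auto elim!: eventually_mono simp: indicator_def)
      qed
      then show "(\<lambda>n. complex_of_real (indicat_real ?A (y + (1 / 2 ^ n) *\<^sub>R u)) * Psi 0 u) \<longlonglongrightarrow> complex_of_real (indicat_real ?A y) * Psi 0 u"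
        by (intro tendsto_eventually) (auto elim!: eventually_mono)
    qed
    show "AE u in lborel. norm (complex_of_real (indicat_real ?A (y + (1 / 2 ^ n) *\<^sub>R u)) * Psi 0 u) \<le> norm (Psi 0 u)" for n
      by (rule AE_I2) (auto simp: norm_mult indicator_def)
    show "integrable lborel (\<lambda>u. norm (Psi 0 u))" using integrable_Psi by (intro integrable_norm)
  qed measurable
  then show ?thesis unfolding eq integral_mult_right_zero integral_Psi by simp
qed

text \<open>Points of the box have bounded norm, so Peetre's inequality turns decay away from the
  box into decay at infinity, with a constant independent of \<open>n\<close>.\<close>

lemma box_average_decay:
  obtains C where "C \<ge> 0" "\<And>n y. norm (box_average (box a b) n y) \<le> C / (1 + norm y) ^ Suc DIM('a)"
proof -
  let ?m = "Suc DIM('a)"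
  obtain R where R: "R \<ge> 0" "\<And>x. x \<in> box a b \<Longrightarrow> norm x \<le> R"
    using bounded_box[of a b] by (metis bounded_pos less_imp_le)
  \<comment> \<open>Twice the final order of decay: one half is spent on Peetre's inequality, the
    other on integrability in \<open>x\<close>.\<close>
  obtain C where C: "C \<ge> 0" "\<And>K x. norm (Psi K x) \<le> C * 2 ^ (K * DIM('a)) / (1 + 2 ^ K * norm x) ^ (?m + ?m)"
    using Psi_decay by blast
  define I where "I = (\<integral>(x::'a). 1 / (1 + norm x) ^ ?m \<partial>lborel)"
  have I: "I \<ge> 0" unfolding I_def by (intro integral_nonneg_AE) auto
  have "norm (box_average (box a b) n y) \<le> ((1 + R) ^ ?m * C * I) / (1 + norm y) ^ ?m" for n y
  proof -
    define A where "A = (1 + R) ^ ?m * C * 2 ^ (n * DIM('a)) / (1 + norm y) ^ ?m"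
    have A: "A \<ge> 0" using R(1) C(1) by (simp add: A_def)
    let ?w = "\<lambda>x. 1 / (1 + norm (- (2 ^ n) *\<^sub>R y + 2 ^ n *\<^sub>R x)) ^ ?m"
    have w_int: "integrable lborel ?w"
      using lborel_integrable_affine_iff[of "\<lambda>x::'a. 1 / (1 + norm x) ^ ?m" "2 ^ n" "- (2 ^ n) *\<^sub>R y"]
        integrable_polynomial_decay[of ?m, where 'a = 'a] by simp
    have pointwise: "norm (complex_of_real (indicat_real (box a b) x) * Psi n (x - y)) \<le> A * ?w x" for x
    proof (cases "x \<in> box a b")
      case True
      define t where "t = 1 + 2 ^ n * norm (x - y)"
      have t: "t \<ge> 1" by (simp add: t_def)
      have t_eq: "1 + norm (- (2 ^ n) *\<^sub>R y + 2 ^ n *\<^sub>R x) = t"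
      proof -
        have "- (2 ^ n) *\<^sub>R y + 2 ^ n *\<^sub>R x = (2 ^ n) *\<^sub>R (x - y)" by (simp add: scaleR_diff_right)
        then show ?thesis by (simp add: t_def)
      qed
      have "1 + norm y \<le> (1 + norm x) * t"
        unfolding t_def by (rule peetre) simp
      also have "\<dots> \<le> (1 + R) * t"
        using R(2)[OF True] t by (intro mult_right_mono) auto
      finally have "1 + norm y \<le> (1 + R) * t" .
      then have "(1 + norm y) ^ ?m \<le> ((1 + R) * t) ^ ?m" by (intro power_mono) auto
      then have "(1 + norm y) ^ ?m \<le> (1 + R) ^ ?m * t ^ ?m"
        by (simp only: power_mult_distrib)
      moreover have "1 / t' \<le> c / u" if "u \<le> c * t'" "t' > 0" "u > 0" for c t' u :: real
        using that by (simp add: field_simps)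
      ultimately have peetre: "1 / t ^ ?m \<le> (1 + R) ^ ?m / (1 + norm y) ^ ?m"
        using t by (simp add: add_pos_nonneg)
      have "norm (complex_of_real (indicat_real (box a b) x) * Psi n (x - y)) \<le> C * 2 ^ (n * DIM('a)) / t ^ (?m + ?m)"
        using C(2)[of n "x - y"] True by (simp add: norm_mult t_def)
      also have "\<dots> = C * 2 ^ (n * DIM('a)) * (1 / t ^ ?m) * (1 / t ^ ?m)" by (simp only: power_add) simp
      also have "\<dots> \<le> C * 2 ^ (n * DIM('a)) * ((1 + R) ^ ?m / (1 + norm y) ^ ?m) * (1 / t ^ ?m)"
        using C(1) t by (intro mult_right_mono mult_left_mono peetre) auto
      also have "\<dots> = A * ?w x" unfolding t_eq A_def by simp
      finally show ?thesis .
    qed (use A in simp)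
    have "norm (box_average (box a b) n y) \<le> (\<integral>x. A * ?w x \<partial>lborel)"
      unfolding box_average_def
      by (rule order_trans[OF integral_norm_bound], rule integral_mono_AE',
          rule integrable_mult_right[OF w_int], rule AE_I2, rule pointwise) (use A in simp)
    also have "\<dots> = A * ((1 / \<bar>2 ^ n\<bar> ^ DIM('a)) *\<^sub>R I)"
      unfolding I_def integral_mult_right_zero
      by (subst lborel_integral_affine_eq[where f = "\<lambda>x. 1 / (1 + norm x) ^ ?m"]) auto
    also have "\<dots> = ((1 + R) ^ ?m * C * I) / (1 + norm y) ^ ?m"
      by (simp add: A_def power_mult)
    finally show ?thesis .
  qed
  moreover have "(1 + R) ^ ?m * C * I \<ge> 0" using R(1) C(1) I by simp
  ultimately show ?thesis by (rule that[rotated])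
qed

text \<open>Fubini moves the filter from \<open>F\<close> to the indicator, where limits can be
  taken pointwise.\<close>

lemma integral_box_conv:
  assumes F: "Lpfun p F" and p: "1 \<le> p"
  shows "(CLINT x|lborel. complex_of_real (indicat_real (box a b) x) * conv F n x) = (CLINT y|lborel. F y * box_average (box a b) n y)"
proof -
  obtain C where C: "\<And>K x. norm (Psi K x) \<le> C * 2 ^ (K * DIM('a))"
    using Psi_bounded by metis
  note [measurable] = Lpfun_measurable[OF F]
  let ?h = "\<lambda>(x, y). complex_of_real (indicat_real (box a b) x) * (F y * Psi n (x - y))"
  have box: "integrable lborel (indicat_real (box a b))"
    using emeasure_lborel_box_finite[of a b] by (intro integrable_real_indicator) (auto simp: less_top)
  have pair: "integrable (lborel \<Otimes>\<^sub>M lborel) ?h"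
  proof (rule Bochner_Integration.integrable_bound)
    have 1: "integrable (lborel \<Otimes>\<^sub>M lborel) (\<lambda>(x, y). indicat_real (box a b) x * norm (Psi n (x - y)))"
      by (intro integrable_convolution_pair box integrable_norm integrable_Psi)
    have 2: "integrable (lborel \<Otimes>\<^sub>M lborel) (\<lambda>(x, y). indicat_real (box a b) x * norm (F y) powr p)"
      using F by (intro lborel_pair.integrable_product_mult box) (simp add: Lpfun_def)
    show "integrable (lborel \<Otimes>\<^sub>M lborel) (\<lambda>w. (case w of (x, y) \<Rightarrow> indicat_real (box a b) x * norm (Psi n (x - y)))
       + C * 2 ^ (n * DIM('a)) * (case w of (x, y) \<Rightarrow> indicat_real (box a b) x * norm (F y) powr p))"
      by (intro Bochner_Integration.integrable_add 1 integrable_mult_right 2)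
    show "AE w in lborel \<Otimes>\<^sub>M lborel. norm (?h w) \<le> norm ((case w of (x, y) \<Rightarrow> indicat_real (box a b) x * norm (Psi n (x - y)))
       + C * 2 ^ (n * DIM('a)) * (case w of (x, y) \<Rightarrow> indicat_real (box a b) x * norm (F y) powr p))"
    proof (intro AE_I2)
      fix w :: "'a \<times> 'a"
      obtain x y where w: "w = (x, y)" by force
      have "norm (?h w) = indicat_real (box a b) x * norm (F y * Psi n (x - y))"
        by (simp add: w norm_mult)
      also have "\<dots> \<le> indicat_real (box a b) x * (norm (Psi n (x - y)) + C * 2 ^ (n * DIM('a)) * norm (F y) powr p)"
        by (intro mult_left_mono norm_times_Psi_le p C) simp
      finally show "norm (?h w) \<le> norm ((case w of (x, y) \<Rightarrow> indicat_real (box a b) x * norm (Psi n (x - y)))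
         + C * 2 ^ (n * DIM('a)) * (case w of (x, y) \<Rightarrow> indicat_real (box a b) x * norm (F y) powr p))"
        by (simp add: w algebra_simps)
    qed
    show "?h \<in> borel_measurable (lborel \<Otimes>\<^sub>M lborel)" by measurable
  qed
  have "(CLINT x|lborel. complex_of_real (indicat_real (box a b) x) * conv F n x)
    = (CLINT x|lborel. CLINT y|lborel. complex_of_real (indicat_real (box a b) x) * (F y * Psi n (x - y)))"
    by (simp add: conv_def)
  also have "\<dots> = (CLINT y|lborel. CLINT x|lborel. F y * (complex_of_real (indicat_real (box a b) x) * Psi n (x - y)))"
    using lborel_pair.Fubini_integral[OF pair] by (simp only: prod.case mult.left_commute)
  also have "\<dots> = (CLINT y|lborel. F y * box_average (box a b) n y)"
    by (simp only: integral_mult_right_zero box_average_def)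
  finally show "(CLINT x|lborel. complex_of_real (indicat_real (box a b) x) * conv F n x) = (CLINT y|lborel. F y * box_average (box a b) n y)" .
qed

lemma integrable_box:
  assumes F: "Lpfun p F" and p: "1 \<le> p"
  shows "integrable lborel (\<lambda>x. complex_of_real (indicat_real (box a b) x) * F x)"
proof (rule Bochner_Integration.integrable_bound)
  note [measurable] = Lpfun_measurable[OF F]
  have "integrable lborel (indicat_real (box a b))"
    using emeasure_lborel_box_finite[of a b] by (intro integrable_real_indicator) (auto simp: less_top)
  then show "integrable lborel (\<lambda>x. indicat_real (box a b) x + norm (F x) powr p)"
    using F by (auto simp: Lpfun_def)
  show "AE x in lborel. norm (complex_of_real (indicat_real (box a b) x) * F x) \<le> norm (indicat_real (box a b) x + norm (F x) powr p)"
    using le_one_plus_powr[OF norm_ge_zero p] by (intro AE_I2) (auto simp: indicator_def norm_mult)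
  show "(\<lambda>x. complex_of_real (indicat_real (box a b) x) * F x) \<in> borel_measurable lborel" by measurable
qed

text \<open>Peetre's inequality for \<^const>\<open>box_average\<close> supplies an integrable majorant although \<open>F\<close> itself
  need not be integrable.\<close>
lemma conv_box_tendsto:
  assumes F: "Lpfun p F" and p: "1 \<le> p"
  shows "(\<lambda>n. CLINT x|lborel. complex_of_real (indicat_real (box a b) x) * conv F n x)
     \<longlonglongrightarrow> (CLINT x|lborel. complex_of_real (indicat_real (box a b) x) * F x)"
proof -
  obtain C where C: "C \<ge> 0" "\<And>n y. norm (box_average (box a b) n y) \<le> C / (1 + norm y) ^ Suc DIM('a)"
    using box_average_decay by blast
  note [measurable] = Lpfun_measurable[OF F]
  have "(\<lambda>n. CLINT y|lborel. F y * box_average (box a b) n y)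
     \<longlonglongrightarrow> (CLINT y|lborel. F y * complex_of_real (indicat_real (box a b) y))"
  proof (rule integral_dominated_convergence[where w = "\<lambda>y. C * (1 / (1 + norm y) ^ Suc DIM('a)) + C * norm (F y) powr p"])
    show "AE y in lborel. (\<lambda>n. F y * box_average (box a b) n y) \<longlonglongrightarrow> F y * complex_of_real (indicat_real (box a b) y)"
      using AE_notin_frontier_box[of a b] by eventually_elim (intro tendsto_intros box_average_tendsto)
    show "integrable lborel (\<lambda>y. C * (1 / (1 + norm y) ^ Suc DIM('a)) + C * norm (F y) powr p)"
      using F by (intro Bochner_Integration.integrable_add integrable_mult_right integrable_polynomial_decay)
        (auto simp: Lpfun_def)
    show "AE y in lborel. norm (F y * box_average (box a b) n y) \<le> C * (1 / (1 + norm y) ^ Suc DIM('a)) + C * norm (F y) powr p" for n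
    proof (rule AE_I2)
      fix y :: 'a
      define v where "v = 1 / (1 + norm y) ^ Suc DIM('a)"
      have "1 \<le> (1 + norm y) ^ Suc DIM('a)" by (rule one_le_power) simp
      moreover have "0 \<le> 1 / w \<and> 1 / w \<le> 1" if "1 \<le> w" for w :: real using that by simp
      ultimately have v: "0 \<le> v" "v \<le> 1" unfolding v_def by blast+
      have "norm (F y * box_average (box a b) n y) \<le> (1 + norm (F y) powr p) * (C * v)"
        unfolding norm_mult using C(2)[of n y] p by (intro mult_mono le_one_plus_powr) (auto simp: v_def)
      also have "\<dots> = C * v + C * norm (F y) powr p * v" by (simp add: algebra_simps)
      also have "C * norm (F y) powr p * v \<le> C * norm (F y) powr p"
        using v C(1) by (intro mult_left_le) auto
      finally show "norm (F y * box_average (box a b) n y) \<le> C * (1 / (1 + norm y) ^ Suc DIM('a)) + C * norm (F y) powr p"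
        by (simp add: v_def)
    qed
  qed measurable
  then show ?thesis
    unfolding integral_box_conv[OF F p] by (simp add: mult.commute)
qed

end

section \<open>Besov balls\<close>

lemma powr_neg_summable:
  fixes c :: real
  assumes "c > 0" shows "summable (\<lambda>k::nat. 2 powr (- (real k * c)))"
proof -
  have "(\<lambda>k::nat. 2 powr (- (real k * c))) = (\<lambda>k. (2 powr (- c)) ^ k)"
    by (rule ext) (simp add: powr_powr mult.commute flip: powr_realpow)
  moreover have "summable (\<lambda>k. (2 powr (- c)) ^ k)"
    using assms by (intro summable_geometric) (simp add: powr_less_one)
  ultimately show ?thesis by simp
qed

lemma mult_le_sum_squares:
  fixes a b :: real
  assumes "a \<ge> 0" "b \<ge> 0" shows "a * b \<le> a\<^sup>2 + b\<^sup>2"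
proof -
  have "a * b \<le> 2 * (a * b)" using assms by simp
  also have "\<dots> \<le> a\<^sup>2 + b\<^sup>2" using sum_squares_bound[of a b] by (simp add: mult.assoc)
  finally show ?thesis .
qed

lemma ennreal_norm_integral_le:
  fixes f :: "'x \<Rightarrow> 'b::{banach, second_countable_topology}"
  shows "ennreal (norm (integral\<^sup>L M f)) \<le> (\<integral>\<^sup>+x. ennreal (norm (f x)) \<partial>M)"
  by (cases "integrable M f") (simp_all add: integral_norm_bound_ennreal not_integrable_integral_eq)

locale besov_ball = littlewood_paley \<phi>0 for \<phi>0 :: "'a::euclidean_space \<Rightarrow> real" +
  fixes p s :: real
  assumes p: "1 \<le> p" "p < 2" and s: "s > real DIM('a) / 2"
begin

text \<open>The unit ball for q = infinity, stated for Borel functions with complex values: each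
  block is bounded by itself.\<close>

definition in_ball :: "('a \<Rightarrow> complex) \<Rightarrow> bool" where
  "in_ball F \<longleftrightarrow> Lpfun p F \<and> (\<forall>k. Lpfun p (block F k) \<and>
     (\<integral>x. norm (block F k x) powr p \<partial>lborel) \<le> (2 powr (- (real k * s))) powr p)"

text \<open>Smoothness left after trading integrability p for t, as in a Sobolev embedding: the L^t
  norm of block \<open>k\<close> is of order
  \<open>2 powr (- (real k * \<sigma> t))\<close>.\<close>

definition \<sigma> :: "real \<Rightarrow> real" where
  "\<sigma> t = s - DIM('a) / p + DIM('a) / t"

text \<open>Follows from p >= 1 and s > d/2. It makes the L^2 norms of the blocks decay
  geometrically.\<close>

lemma \<sigma>_2_pos: "\<sigma> 2 > 0"
proof -
  have "DIM('a) / p \<le> real DIM('a)" using p by (simp add: divide_le_eq)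
  then show ?thesis using s by (simp add: \<sigma>_def)
qed

lemma in_ball_measurable [measurable_dest]: "in_ball F \<Longrightarrow> F \<in> borel_measurable borel"
  by (auto simp: in_ball_def Lpfun_def)

text \<open>Interpolation between L^p and the sup bound of \<open>nikolskii_sup\<close>: t - p
  powers are estimated uniformly, the remaining p in the mean.\<close>

lemma block_Lt:
  assumes t: "t \<ge> p"
  obtains C where "C \<ge> 0" "\<And>F k. in_ball F \<Longrightarrow> Lpfun t (block F k) \<and>
     (\<integral>x. norm (block F k x) powr t \<partial>lborel) \<le> C * 2 powr (- (real k * (t * \<sigma> t)))"
proof -
  let ?d = "real DIM('a)"
  obtain C where C: "C > 0" "\<And>K b A x. \<lbrakk>A > 0; integrable lborel (\<lambda>y. b y * Psi K (x - y)); b x = conv b K x;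
       integrable lborel (\<lambda>x. norm (b x) powr p); (\<integral>x. norm (b x) powr p \<partial>lborel) \<le> A powr p\<rbrakk>
      \<Longrightarrow> norm (b x) \<le> C * 2 powr (real K * ?d / p) * A"
    using nikolskii_sup[OF p(1)] by blast
  have "Lpfun t (block F k) \<and> (\<integral>x. norm (block F k x) powr t \<partial>lborel)
      \<le> ((C * 2 powr (?d / p)) powr (t - p)) * 2 powr (- (real k * (t * \<sigma> t)))" if F: "in_ball F" for F k
  proof -
    have [measurable]: "F \<in> borel_measurable borel" using F by (rule in_ball_measurable)
    have LpF: "Lpfun p F" and b: "integrable lborel (\<lambda>x. norm (block F k x) powr p)"
      and bA: "(\<integral>x. norm (block F k x) powr p \<partial>lborel) \<le> (2 powr (- (real k * s))) powr p"
      using F by (auto simp: in_ball_def Lpfun_def)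
    \<comment> \<open>Level \<open>Suc k\<close>, since the kernel of that level reproduces block
      \<open>k\<close>; the shift by one only enlarges the constant.\<close>
    define m where "m = C * 2 powr (real (Suc k) * ?d / p) * 2 powr (- (real k * s))"
    have sup: "norm (block F k x) \<le> m" for x
      unfolding m_def
      by (rule C(2)) (use integrable_block_conv[OF LpF p(1)] conv_block[OF LpF p(1)] b bA in auto)
    have pointwise: "norm (block F k x) powr t \<le> m powr (t - p) * norm (block F k x) powr p" for x
    proof -
      have "norm (block F k x) powr t = norm (block F k x) powr (t - p) * norm (block F k x) powr p"
        by (simp flip: powr_add)
      also have "\<dots> \<le> m powr (t - p) * norm (block F k x) powr p"
        using t sup by (intro mult_right_mono powr_mono2) auto
      finally show ?thesis .
    qed
    have int: "integrable lborel (\<lambda>x. norm (block F k x) powr t)"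
      by (rule Bochner_Integration.integrable_bound[OF integrable_mult_right[OF b, of "m powr (t - p)"]])
        (auto intro!: AE_I2 pointwise)
    have "(\<integral>x. norm (block F k x) powr t \<partial>lborel) \<le> (\<integral>x. m powr (t - p) * norm (block F k x) powr p \<partial>lborel)"
      by (intro integral_mono int integrable_mult_right b pointwise)
    also have "\<dots> = m powr (t - p) * (\<integral>x. norm (block F k x) powr p \<partial>lborel)" by simp
    also have "\<dots> \<le> m powr (t - p) * (2 powr (- (real k * s))) powr p"
      by (intro mult_left_mono bA) simp
    also have "\<dots> = ((C * 2 powr (?d / p)) powr (t - p)) * 2 powr (- (real k * (t * \<sigma> t)))"
    proof -
      have "m = (C * 2 powr (?d / p)) * 2 powr (real k * (?d / p - s))"
        by (simp add: m_def algebra_simps add_divide_distrib flip: powr_add)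
      then have "m powr (t - p) = (C * 2 powr (?d / p)) powr (t - p) * 2 powr (real k * (?d / p - s) * (t - p))"
        using C(1) by (simp add: powr_mult powr_powr)
      moreover have "(2 powr (- (real k * s))) powr p = 2 powr (- (real k * s) * p)" by (simp add: powr_powr)
      moreover have "real k * (?d / p - s) * (t - p) + - (real k * s) * p = - (real k * (t * \<sigma> t))"
        using p t by (simp add: \<sigma>_def field_simps)
      ultimately show ?thesis by (simp only: mult.assoc powr_add[symmetric])
    qed
    finally show ?thesis using int by (simp add: Lpfun_def)
  qed
  then show ?thesis by (intro that[of "(C * 2 powr (?d / p)) powr (t - p)"]) auto
qed

lemma block_L2:
  obtains C where "C \<ge> 0" "\<And>F k. in_ball F \<Longrightarrow> integrable lborel (\<lambda>x. (norm (block F k x))\<^sup>2)"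
    "\<And>F k. in_ball F \<Longrightarrow> (\<integral>x. (norm (block F k x))\<^sup>2 \<partial>lborel) \<le> C * (2 powr (- (real k * \<sigma> 2)))\<^sup>2"
proof -
  have powr2: "u powr 2 = u\<^sup>2" if "u \<ge> 0" for u :: real
    using that by (metis powr_numeral)
  obtain C where "C \<ge> 0" and C: "\<And>F k. in_ball F \<Longrightarrow> Lpfun 2 (block F k) \<and>
     (\<integral>x. norm (block F k x) powr 2 \<partial>lborel) \<le> C * 2 powr (- (real k * (2 * \<sigma> 2)))"
    using block_Lt[of 2] p by auto
  moreover have "2 powr (- (real k * (2 * \<sigma> 2))) = (2 powr (- (real k * \<sigma> 2)))\<^sup>2" for k :: nat
    by (simp add: power2_eq_square mult.left_commute flip: powr_add)
  ultimately show ?thesis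
    by (intro that[of C]) (auto simp: Lpfun_def powr2)
qed

text \<open>Arithmetic-geometric means with weight \<open>w\<close>: the block has L^2 norm of order
  \<open>w\<close>, so dividing its square by \<open>w\<close> and multiplying that of
  \<open>g\<close> by \<open>w\<close> gives the factor \<open>w\<close> in both terms.\<close>

lemma block_pairing:
  obtains C where "C \<ge> 0" "\<And>F g k. in_ball F \<Longrightarrow> g \<in> borel_measurable borel \<Longrightarrow> integrable lborel (\<lambda>x. (g x)\<^sup>2) \<Longrightarrow>
     integrable lborel (\<lambda>x. block F k x * complex_of_real (g x))"
    "\<And>F g k. in_ball F \<Longrightarrow> g \<in> borel_measurable borel \<Longrightarrow> integrable lborel (\<lambda>x. (g x)\<^sup>2) \<Longrightarrow>
     (\<integral>x. norm (block F k x * complex_of_real (g x)) \<partial>lborel) \<le> 2 powr (- (real k * \<sigma> 2)) * (C + (\<integral>x. (g x)\<^sup>2 \<partial>lborel))"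
proof -
  obtain C where C: "C \<ge> 0" and b: "\<And>F k. in_ball F \<Longrightarrow> integrable lborel (\<lambda>x. (norm (block F k x))\<^sup>2)"
    and bC: "\<And>F k. in_ball F \<Longrightarrow> (\<integral>x. (norm (block F k x))\<^sup>2 \<partial>lborel) \<le> C * (2 powr (- (real k * \<sigma> 2)))\<^sup>2"
    using block_L2 by blast
  have "integrable lborel (\<lambda>x. block F k x * complex_of_real (g x)) \<and>
    (\<integral>x. norm (block F k x * complex_of_real (g x)) \<partial>lborel) \<le> 2 powr (- (real k * \<sigma> 2)) * (C + (\<integral>x. (g x)\<^sup>2 \<partial>lborel))"
    if F: "in_ball F" and [measurable]: "g \<in> borel_measurable borel" and g: "integrable lborel (\<lambda>x. (g x)\<^sup>2)" for F g k
  proof -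
    have [measurable]: "F \<in> borel_measurable borel" using F by (rule in_ball_measurable)
    define w where "w = 2 powr (- (real k * \<sigma> 2))"
    have w: "w > 0" by (simp add: w_def)
    let ?bound = "\<lambda>x. (1 / w) * (norm (block F k x))\<^sup>2 + w * (g x)\<^sup>2"
    have pointwise: "norm (block F k x * complex_of_real (g x)) \<le> ?bound x" for x
    proof -
      define u where "u = norm (block F k x) / w"
      have "u * \<bar>g x\<bar> \<le> u\<^sup>2 + (g x)\<^sup>2"
        using mult_le_sum_squares[of u "\<bar>g x\<bar>"] w by (simp add: u_def)
      then have "w * (u * \<bar>g x\<bar>) \<le> w * (u\<^sup>2 + (g x)\<^sup>2)" using w by (intro mult_left_mono) auto
      then show ?thesis
        using w by (simp add: u_def norm_mult power_divide distrib_left power2_eq_square)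
    qed
    have bound_int: "integrable lborel ?bound"
      by (intro Bochner_Integration.integrable_add integrable_mult_right b F g)
    have int: "integrable lborel (\<lambda>x. block F k x * complex_of_real (g x))"
      by (rule Bochner_Integration.integrable_bound[OF bound_int])
        (auto intro!: AE_I2 order_trans[OF pointwise])
    have "(\<integral>x. norm (block F k x * complex_of_real (g x)) \<partial>lborel) \<le> (\<integral>x. ?bound x \<partial>lborel)"
      by (intro integral_mono integrable_norm int bound_int pointwise)
    also have "\<dots> = (1 / w) * (\<integral>x. (norm (block F k x))\<^sup>2 \<partial>lborel) + w * (\<integral>x. (g x)\<^sup>2 \<partial>lborel)"
      using b[OF F, of k] g by simp
    also have "\<dots> \<le> (1 / w) * (C * w\<^sup>2) + w * (\<integral>x. (g x)\<^sup>2 \<partial>lborel)"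
      using bC[OF F, of k] w by (intro add_right_mono mult_left_mono) (auto simp: w_def)
    also have "\<dots> = w * (C + (\<integral>x. (g x)\<^sup>2 \<partial>lborel))"
      using w by (simp add: power2_eq_square algebra_simps)
    finally show ?thesis using int by (simp add: w_def)
  qed
  then show ?thesis using C by (intro that[of C]) auto
qed

lemma summable_block_pairing:
  assumes F: "in_ball F" and [measurable]: "g \<in> borel_measurable borel" and g: "integrable lborel (\<lambda>x. (g x)\<^sup>2)"
  shows "integrable lborel (\<lambda>x. block F k x * complex_of_real (g x))"
    and "summable (\<lambda>k. \<integral>x. norm (block F k x * complex_of_real (g x)) \<partial>lborel)"
    and AE_summable_block_mult: "AE x in lborel. summable (\<lambda>k. norm (block F k x * complex_of_real (g x)))"
proof -
  have [measurable]: "F \<in> borel_measurable borel" using F by (rule in_ball_measurable)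
  obtain C where C: "C \<ge> 0" and int: "\<And>k. integrable lborel (\<lambda>x. block F k x * complex_of_real (g x))"
    and le: "\<And>k. (\<integral>x. norm (block F k x * complex_of_real (g x)) \<partial>lborel) \<le> 2 powr (- (real k * \<sigma> 2)) * (C + (\<integral>x. (g x)\<^sup>2 \<partial>lborel))"
    by (rule block_pairing, rule that, assumption) (blast intro: F assms(2) g)+
  show "integrable lborel (\<lambda>x. block F k x * complex_of_real (g x))" by (rule int)
  have "summable (\<lambda>k. 2 powr (- (real k * \<sigma> 2)) * (C + (\<integral>x. (g x)\<^sup>2 \<partial>lborel)))"
    by (intro summable_mult2 powr_neg_summable \<sigma>_2_pos)
  then show summ: "summable (\<lambda>k. \<integral>x. norm (block F k x * complex_of_real (g x)) \<partial>lborel)"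
    by (rule summable_comparison_test'[where N = 0]) (use le in auto)
  have "(\<integral>\<^sup>+x. (\<Sum>k. ennreal (norm (block F k x * complex_of_real (g x)))) \<partial>lborel)
    = (\<Sum>k. \<integral>\<^sup>+x. ennreal (norm (block F k x * complex_of_real (g x))) \<partial>lborel)"
    by (rule nn_integral_suminf) measurable
  also have "\<dots> = (\<Sum>k. ennreal (\<integral>x. norm (block F k x * complex_of_real (g x)) \<partial>lborel))"
    by (intro suminf_cong nn_integral_eq_integral integrable_norm int) auto
  also have "\<dots> \<noteq> \<infinity>"
    using summ by (subst suminf_ennreal2) auto
  finally have "AE x in lborel. (\<Sum>k. ennreal (norm (block F k x * complex_of_real (g x)))) \<noteq> \<infinity>"
    by (intro nn_integral_PInf_AE) auto
  then show "AE x in lborel. summable (\<lambda>k. norm (block F k x * complex_of_real (g x)))"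
    by eventually_elim (auto intro: summable_suminf_not_top)
qed

lemma integrable_indicator_box_square: "integrable lborel (\<lambda>x. (indicat_real (box a b) x)\<^sup>2)"
proof -
  have "(indicat_real (box a b) x)\<^sup>2 = indicat_real (box a b) x" for x
    by (simp add: indicator_def)
  then show ?thesis
    using emeasure_lborel_box_finite[of a b] by (auto intro!: integrable_real_indicator simp: less_top)
qed

text \<open>Indicators of boxes are admissible test functions in the pairing lemma, and countably
  many boxes exhaust the space.\<close>

lemma AE_summable_block:
  assumes F: "in_ball F"
  shows "AE x in lborel. summable (\<lambda>k. norm (block F k x))"
proof -
  define A where "A n = box (- (real n *\<^sub>R One)) (real n *\<^sub>R One :: 'a)" for n
  have "AE x in lborel. \<forall>n. summable (\<lambda>k. norm (block F k x * complex_of_real (indicat_real (A n) x)))"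
    unfolding AE_all_countable A_def
    by (intro allI AE_summable_block_mult F integrable_indicator_box_square) simp
  then show ?thesis
  proof eventually_elim
    case (elim x)
    obtain n where "x \<in> A n" using UN_box_eq_UNIV[where 'a = 'a] by (auto simp: A_def)
    then show ?case using elim[rule_format, of n] by simp
  qed
qed

text \<open>The partial sums are \<open>conv F n\<close>, whose box integrals tend to those of
  \<open>F\<close>; absolute summability shows that they also tend to those of the sum
  \<open>S\<close>. Functions with equal box integrals agree almost everywhere.\<close>

lemma block_expansion:
  assumes F: "in_ball F"
  shows "AE x in lborel. summable (\<lambda>k. norm (block F k x)) \<and> (\<Sum>k. block F k x) = F x"
proof -
  have [measurable]: "F \<in> borel_measurable borel" using F by (rule in_ball_measurable)
  have LpF: "Lpfun p F" using F by (simp add: in_ball_def)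
  define S where "S x = (\<Sum>k. block F k x)" for x
  have [measurable]: "S \<in> borel_measurable borel" unfolding S_def by measurable
  let ?I = "\<lambda>a b x. complex_of_real (indicat_real (box a b) x)"
  have box: "integrable lborel (\<lambda>x. ?I a b x * (S x - F x)) \<and> (CLINT x|lborel. ?I a b x * (S x - F x)) = 0" for a b
  proof -
    note sums = summable_block_pairing[OF F _ integrable_indicator_box_square, of a b]
    have eq: "(\<Sum>k. block F k x * ?I a b x) = ?I a b x * S x" for x
      by (cases "x \<in> box a b") (simp_all add: S_def)
    have int_S: "integrable lborel (\<lambda>x. ?I a b x * S x)"
      using integrable_suminf[OF sums(1) sums(3) sums(2)] by (simp add: eq)
    have S_eq: "(CLINT x|lborel. ?I a b x * S x) = (\<Sum>k. CLINT x|lborel. block F k x * ?I a b x)"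
      using integral_suminf[OF sums(1) sums(3) sums(2)] by (simp add: eq)
    have "summable (\<lambda>k. CLINT x|lborel. block F k x * ?I a b x)"
      by (rule summable_norm_cancel, rule summable_comparison_test'[where N = 0])
        (use sums(2) in \<open>auto intro: integral_norm_bound\<close>)
    then have "(\<lambda>n. \<Sum>k<Suc n. CLINT x|lborel. block F k x * ?I a b x) \<longlonglongrightarrow> (CLINT x|lborel. ?I a b x * S x)"
      unfolding S_eq by (intro LIMSEQ_Suc summable_LIMSEQ)
    moreover have "(\<Sum>k<Suc n. CLINT x|lborel. block F k x * ?I a b x) = (CLINT x|lborel. ?I a b x * conv F n x)" for n
    proof -
      have "(\<Sum>k<Suc n. CLINT x|lborel. block F k x * ?I a b x) = (CLINT x|lborel. (\<Sum>k<Suc n. block F k x * ?I a b x))"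
        by (rule Bochner_Integration.integral_sum[symmetric]) (simp add: sums(1))
      also have "\<dots> = (CLINT x|lborel. ?I a b x * conv F n x)"
        by (intro Bochner_Integration.integral_cong refl)
          (simp only: sum_distrib_right[symmetric] sum_block mult.commute)
      finally show ?thesis .
    qed
    ultimately have "(\<lambda>n. CLINT x|lborel. ?I a b x * conv F n x) \<longlonglongrightarrow> (CLINT x|lborel. ?I a b x * S x)"
      by simp
    with conv_box_tendsto[OF LpF p(1)] have "(CLINT x|lborel. ?I a b x * S x) = (CLINT x|lborel. ?I a b x * F x)"
      using LIMSEQ_unique by blast
    then show ?thesis
      using int_S integrable_box[OF LpF p(1), of a b] by (simp add: right_diff_distrib)
  qed
  have "AE x in lborel. Re (S x - F x) = 0"
  proof (rule AE_zero_if_box_integrals_zero)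
    fix a b :: 'a
    have Re: "indicat_real (box a b) x * Re (S x - F x) = Re (?I a b x * (S x - F x))" for x by simp
    show "integrable lborel (\<lambda>x. indicat_real (box a b) x * Re (S x - F x))"
      unfolding Re using box by (intro integrable_Re) blast
    show "(\<integral>x. indicat_real (box a b) x * Re (S x - F x) \<partial>lborel) = 0"
      unfolding Re using box[of a b] by (simp only: integral_Re zero_complex.sel)
  qed measurable
  moreover have "AE x in lborel. Im (S x - F x) = 0"
  proof (rule AE_zero_if_box_integrals_zero)
    fix a b :: 'a
    have Im: "indicat_real (box a b) x * Im (S x - F x) = Im (?I a b x * (S x - F x))" for x by simp
    show "integrable lborel (\<lambda>x. indicat_real (box a b) x * Im (S x - F x))"
      unfolding Im using box by (intro integrable_Im) blast
    show "(\<integral>x. indicat_real (box a b) x * Im (S x - F x) \<partial>lborel) = 0"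
      unfolding Im using box[of a b] by (simp only: integral_Im zero_complex.sel)
  qed measurable
  ultimately show ?thesis
    using AE_summable_block[OF F] by eventually_elim (auto simp: S_def complex_eq_iff)
qed

text \<open>Cauchy-Schwarz with weights \<open>w k\<close>: the square of block \<open>k\<close>
  divided by \<open>w k\<close> has integral of order \<open>w k\<close>, which is summable.\<close>

lemma ball_L2:
  assumes F: "in_ball F"
  shows "integrable lborel (\<lambda>x. (norm (F x))\<^sup>2)"
proof -
  have [measurable]: "F \<in> borel_measurable borel" using F by (rule in_ball_measurable)
  obtain C where C: "C \<ge> 0" and b: "\<And>k. integrable lborel (\<lambda>x. (norm (block F k x))\<^sup>2)"
    and bC: "\<And>k. (\<integral>x. (norm (block F k x))\<^sup>2 \<partial>lborel) \<le> C * (2 powr (- (real k * \<sigma> 2)))\<^sup>2"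
    by (rule block_L2, rule that, assumption) (blast intro: F)+
  define w where "w k = 2 powr (- (real k * \<sigma> 2))" for k :: nat
  have w: "w k > 0" for k by (simp add: w_def)
  have w_sum: "summable w" unfolding w_def by (intro powr_neg_summable \<sigma>_2_pos)
  define D where "D = (\<Sum>k. w k)"
  have D: "D \<ge> 0" unfolding D_def using w by (intro suminf_nonneg w_sum) (auto intro: less_imp_le)
  define W where "W x = ennreal D * (\<Sum>k. ennreal ((1 / w k) * (norm (block F k x))\<^sup>2))" for x
  have [measurable]: "W \<in> borel_measurable borel" unfolding W_def by measurable
  have "AE x in lborel. ennreal ((norm (F x))\<^sup>2) \<le> W x"
    using block_expansion[OF F]
  proof eventually_elim
    case (elim x)
    have "(\<lambda>n. \<Sum>k<n. block F k x) \<longlonglongrightarrow> F x"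
      using elim summable_LIMSEQ[OF summable_norm_cancel, of "\<lambda>k. block F k x"] by simp
    then have lim: "(\<lambda>n. ennreal ((norm (\<Sum>k<n. block F k x))\<^sup>2)) \<longlonglongrightarrow> ennreal ((norm (F x))\<^sup>2)"
      by (intro tendsto_intros)
    have "ennreal ((norm (\<Sum>k<n. block F k x))\<^sup>2) \<le> W x" for n
    proof -
      have "norm (\<Sum>k<n. block F k x) \<le> (\<Sum>k<n. sqrt (w k) * (norm (block F k x) / sqrt (w k)))"
        using w by (intro order_trans[OF norm_sum] sum_mono) (simp add: less_imp_neq[THEN not_sym])
      then have "(norm (\<Sum>k<n. block F k x))\<^sup>2 \<le> (\<Sum>k<n. sqrt (w k) * (norm (block F k x) / sqrt (w k)))\<^sup>2"
        by (intro power_mono) auto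
      also have "\<dots> \<le> (\<Sum>k<n. (sqrt (w k))\<^sup>2) * (\<Sum>k<n. (norm (block F k x) / sqrt (w k))\<^sup>2)"
        by (rule Cauchy_Schwarz_ineq_sum)
      also have "\<dots> = (\<Sum>k<n. w k) * (\<Sum>k<n. (1 / w k) * (norm (block F k x))\<^sup>2)"
        using w by (simp add: power_divide less_imp_le)
      also have "\<dots> \<le> D * (\<Sum>k<n. (1 / w k) * (norm (block F k x))\<^sup>2)"
        unfolding D_def using w by (intro mult_right_mono sum_le_suminf w_sum sum_nonneg) (auto simp: less_imp_le)
      finally have "ennreal ((norm (\<Sum>k<n. block F k x))\<^sup>2) \<le> ennreal D * ennreal (\<Sum>k<n. (1 / w k) * (norm (block F k x))\<^sup>2)"
        using D by (simp add: ennreal_mult'[symmetric] ennreal_leI)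
      also have "ennreal (\<Sum>k<n. (1 / w k) * (norm (block F k x))\<^sup>2) = (\<Sum>k<n. ennreal ((1 / w k) * (norm (block F k x))\<^sup>2))"
        using w by (subst sum_ennreal) (auto simp: less_imp_le)
      also have "\<dots> \<le> (\<Sum>k. ennreal ((1 / w k) * (norm (block F k x))\<^sup>2))"
        by (rule sum_le_suminf) auto
      finally show ?thesis unfolding W_def by (simp add: mult_left_mono)
    qed
    then show ?case by (intro LIMSEQ_le_const2[OF lim]) auto
  qed
  then have "(\<integral>\<^sup>+x. ennreal ((norm (F x))\<^sup>2) \<partial>lborel) \<le> (\<integral>\<^sup>+x. W x \<partial>lborel)"
    by (rule nn_integral_mono_AE)
  also have "\<dots> = ennreal D * (\<Sum>k. ennreal (\<integral>x. (1 / w k) * (norm (block F k x))\<^sup>2 \<partial>lborel))"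
  proof -
    have each: "(\<integral>\<^sup>+x. ennreal ((1 / w k) * (norm (block F k x))\<^sup>2) \<partial>lborel) = ennreal (\<integral>x. (1 / w k) * (norm (block F k x))\<^sup>2 \<partial>lborel)" for k
      using w[of k] by (intro nn_integral_eq_integral integrable_mult_right b) (auto intro: less_imp_le)
    have W: "(\<integral>\<^sup>+x. W x \<partial>lborel) = ennreal D * (\<Sum>k. \<integral>\<^sup>+x. ennreal ((1 / w k) * (norm (block F k x))\<^sup>2) \<partial>lborel)"
      unfolding W_def by (subst nn_integral_cmult) (auto simp: nn_integral_suminf)
    show ?thesis unfolding W each ..
  qed
  also have "\<dots> \<le> ennreal D * (\<Sum>k. ennreal (C * w k))"
  proof (intro mult_left_mono suminf_le ennreal_leI)
    fix k
    have "(\<integral>x. (1 / w k) * (norm (block F k x))\<^sup>2 \<partial>lborel) = (1 / w k) * (\<integral>x. (norm (block F k x))\<^sup>2 \<partial>lborel)"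
      by simp
    also have "\<dots> \<le> (1 / w k) * (C * (w k)\<^sup>2)"
      using bC[of k] w[of k] by (intro mult_left_mono) (auto simp: w_def)
    also have "\<dots> = C * w k" using w[of k] by (simp add: power2_eq_square)
    finally show "(\<integral>x. (1 / w k) * (norm (block F k x))\<^sup>2 \<partial>lborel) \<le> C * w k" .
  qed auto
  also have "\<dots> < \<infinity>"
    using C w summable_mult[OF w_sum, of C]
    by (subst suminf_ennreal2) (auto simp: less_imp_le ennreal_mult_less_top)
  finally show ?thesis by (intro integrableI_nonneg) auto
qed

section \<open>Duality between blocks and kernels\<close>

definition dual_block :: "('a \<Rightarrow> real) \<Rightarrow> nat \<Rightarrow> 'a \<Rightarrow> complex" where
  "dual_block g k y = (CLINT x|lborel. Psi (Suc k) (x - y) * complex_of_real (g x))"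

lemma measurable_dual_block [measurable]:
  assumes [measurable]: "g \<in> borel_measurable borel"
  shows "dual_block g k \<in> borel_measurable borel"
  unfolding dual_block_def by measurable

text \<open>The reproducing formula inserts the kernel of level \<open>Suc k\<close> into the block;
  Fubini then moves it onto \<open>g\<close>.\<close>

lemma block_duality:
  assumes F: "in_ball F" and [measurable]: "g \<in> borel_measurable borel" and g: "integrable lborel (\<lambda>x. (g x)\<^sup>2)"
  shows "(CLINT x|lborel. block F k x * complex_of_real (g x)) = (CLINT y|lborel. block F k y * dual_block g k y)"
proof -
  have [measurable]: "F \<in> borel_measurable borel" using F by (rule in_ball_measurable)
  have LpF: "Lpfun p F" using F by (simp add: in_ball_def)
  have b: "integrable lborel (\<lambda>x. (norm (block F k x))\<^sup>2)" using block_L2 F by blast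
  let ?h = "\<lambda>(x, y). complex_of_real (g x) * (block F k y * Psi (Suc k) (x - y))"
  have pair: "integrable (lborel \<Otimes>\<^sub>M lborel) ?h"
  proof (rule Bochner_Integration.integrable_bound)
    have 1: "integrable (lborel \<Otimes>\<^sub>M lborel) (\<lambda>(x, y). (g x)\<^sup>2 * norm (Psi (Suc k) (x - y)))"
      by (intro integrable_convolution_pair g integrable_norm integrable_Psi)
    have 2: "integrable (lborel \<Otimes>\<^sub>M lborel) (\<lambda>(x, y). (norm (block F k y))\<^sup>2 * norm (Psi (Suc k) (x - y)))"
      by (intro integrable_convolution_pair' b integrable_norm integrable_Psi)
    show "integrable (lborel \<Otimes>\<^sub>M lborel) (\<lambda>w. (case w of (x, y) \<Rightarrow> (g x)\<^sup>2 * norm (Psi (Suc k) (x - y)))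
        + (case w of (x, y) \<Rightarrow> (norm (block F k y))\<^sup>2 * norm (Psi (Suc k) (x - y))))"
      by (intro Bochner_Integration.integrable_add 1 2)
    show "AE w in lborel \<Otimes>\<^sub>M lborel. norm (?h w) \<le> norm ((case w of (x, y) \<Rightarrow> (g x)\<^sup>2 * norm (Psi (Suc k) (x - y)))
        + (case w of (x, y) \<Rightarrow> (norm (block F k y))\<^sup>2 * norm (Psi (Suc k) (x - y))))"
    proof (intro AE_I2)
      fix w :: "'a \<times> 'a"
      obtain x y where w: "w = (x, y)" by force
      have "\<bar>g x\<bar> * norm (block F k y) \<le> (g x)\<^sup>2 + (norm (block F k y))\<^sup>2"
        using mult_le_sum_squares[of "\<bar>g x\<bar>" "norm (block F k y)"] by simp
      then have "\<bar>g x\<bar> * norm (block F k y) * norm (Psi (Suc k) (x - y)) \<le> ((g x)\<^sup>2 + (norm (block F k y))\<^sup>2) * norm (Psi (Suc k) (x - y))"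
        by (rule mult_right_mono) simp
      then show "norm (?h w) \<le> norm ((case w of (x, y) \<Rightarrow> (g x)\<^sup>2 * norm (Psi (Suc k) (x - y)))
        + (case w of (x, y) \<Rightarrow> (norm (block F k y))\<^sup>2 * norm (Psi (Suc k) (x - y))))"
        by (simp add: w norm_mult algebra_simps)
    qed
    show "?h \<in> borel_measurable (lborel \<Otimes>\<^sub>M lborel)" by measurable
  qed
  have "(CLINT x|lborel. block F k x * complex_of_real (g x)) = (CLINT x|lborel. complex_of_real (g x) * conv (block F k) (Suc k) x)"
    unfolding conv_block[OF LpF p(1)] by (simp only: mult.commute)
  also have "\<dots> = (CLINT x|lborel. CLINT y|lborel. complex_of_real (g x) * (block F k y * Psi (Suc k) (x - y)))"
    by (simp only: conv_def integral_mult_right_zero)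
  also have "\<dots> = (CLINT y|lborel. CLINT x|lborel. block F k y * (Psi (Suc k) (x - y) * complex_of_real (g x)))"
    using lborel_pair.Fubini_integral[OF pair] by (simp only: prod.case mult_ac)
  also have "\<dots> = (CLINT y|lborel. block F k y * dual_block g k y)"
    by (simp only: integral_mult_right_zero dual_block_def)
  finally show ?thesis .
qed

text \<open>The expansion of \<open>F\<close> is integrated term by term, which absolute summability
  of the pairings allows.\<close>

lemma pairing_le_suminf:
  assumes F: "in_ball F" and [measurable]: "g \<in> borel_measurable borel" and g: "integrable lborel (\<lambda>x. (g x)\<^sup>2)"
  shows "ennreal (norm (CLINT x|lborel. F x * complex_of_real (g x)))
    \<le> (\<Sum>k. \<integral>\<^sup>+y. ennreal (norm (block F k y) * norm (dual_block g k y)) \<partial>lborel)"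
proof -
  have [measurable]: "F \<in> borel_measurable borel" using F by (rule in_ball_measurable)
  note sums = summable_block_pairing[OF F assms(2) g]
  have "(CLINT x|lborel. F x * complex_of_real (g x)) = (CLINT x|lborel. (\<Sum>k. block F k x * complex_of_real (g x)))"
  proof (rule integral_cong_AE)
    show "AE x in lborel. F x * complex_of_real (g x) = (\<Sum>k. block F k x * complex_of_real (g x))"
      using block_expansion[OF F]
    proof eventually_elim
      case (elim x)
      then show ?case using suminf_mult2[OF summable_norm_cancel, of "\<lambda>k. block F k x"] by auto
    qed
  qed measurable
  also have "\<dots> = (\<Sum>k. CLINT x|lborel. block F k x * complex_of_real (g x))"
    by (rule integral_suminf[OF sums(1) sums(3) sums(2)])
  finally have eq: "(CLINT x|lborel. F x * complex_of_real (g x)) = (\<Sum>k. CLINT x|lborel. block F k x * complex_of_real (g x))" .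
  have summ: "summable (\<lambda>k. norm (CLINT x|lborel. block F k x * complex_of_real (g x)))"
    by (rule summable_comparison_test'[OF sums(2), where N = 0]) (auto intro: integral_norm_bound)
  have "ennreal (norm (CLINT x|lborel. F x * complex_of_real (g x))) \<le> ennreal (\<Sum>k. norm (CLINT x|lborel. block F k x * complex_of_real (g x)))"
    unfolding eq by (intro ennreal_leI summable_norm summ)
  also have "\<dots> = (\<Sum>k. ennreal (norm (CLINT x|lborel. block F k x * complex_of_real (g x))))"
    using summ by (intro suminf_ennreal2[symmetric]) auto
  also have "\<dots> \<le> (\<Sum>k. \<integral>\<^sup>+y. ennreal (norm (block F k y) * norm (dual_block g k y)) \<partial>lborel)"
    unfolding block_duality[OF F assms(2) g]
    by (intro suminf_le order_trans[OF ennreal_norm_integral_le]) (auto simp: norm_mult)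
  finally show ?thesis .
qed

end

context besov_ball
begin

text \<open>At t = p the requirements \<open>t < 2\<close> and \<open>\<sigma> t > d/2\<close> hold
  strictly, so they persist for t slightly above p; \<open>t > p \<ge> 1\<close> keeps the conjugate
  exponent finite.\<close>

lemma exponent_choice:
  obtains t r \<eta> :: real where "p \<le> t" "1 < t" "t < 2" "r > 2" "1 / t + 1 / r = 1" "\<eta> > 0"
    "\<sigma> t = DIM('a) / 2 + 2 * \<eta>"
proof -
  let ?d = "real DIM('a)"
  define \<delta> where "\<delta> = s - ?d / 2"
  have d: "?d > 0" by simp
  have \<delta>: "\<delta> > 0" using s by (simp add: \<delta>_def)
  \<comment> \<open>The first cap is the midpoint of p and 2. The second limits the loss d/p - d/t
    to half of \<open>\<delta>\<close>.\<close>
  define t where "t = min ((p + 2) / 2) (p + \<delta> / (2 * ?d))"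
  have t: "t < 2" "p < t" "?d * (t - p) \<le> \<delta> / 2"
  proof -
    have "t \<le> (p + 2) / 2" unfolding t_def by (rule min.cobounded1)
    also have "(p + 2) / 2 < 2" using p(2) by simp
    finally show "t < 2" .
    show "p < t" using p \<delta> by (simp add: t_def)
    have "t - p \<le> \<delta> / (2 * ?d)" unfolding t_def using min.cobounded2[of "(p + 2) / 2" "p + \<delta> / (2 * ?d)"] by linarith
    then have "?d * (t - p) \<le> ?d * (\<delta> / (2 * ?d))" using d by (intro mult_left_mono) auto
    then show "?d * (t - p) \<le> \<delta> / 2" by simp
  qed
  have "?d / p - ?d / t = ?d * (t - p) / (p * t)"
    using p t by (simp add: field_simps)
  also have "\<dots> \<le> ?d * (t - p) / 1"
    using p t mult_mono[of 1 p 1 t] by (intro divide_left_mono) auto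
  finally have "\<sigma> t > ?d / 2"
    using t(3) \<delta> by (simp add: \<sigma>_def \<delta>_def)
  \<comment> \<open>\<open>t / (t - 1)\<close> is the exponent conjugate to t, and \<eta> is half
    the surplus of \<open>\<sigma> t\<close> over d/2.\<close>
  then show ?thesis
    using p t by (intro that[of t "t / (t - 1)" "(\<sigma> t - ?d / 2) / 2"]) (auto simp: field_simps)
qed

text \<open>The kernels behind \<open>dual_block\<close>, scaled so that d/2 in the exponent offsets
  the growth 2^(k d/2) of their weighted L^2 norms and \<eta> remains as decay. Level and centre
  form a single index running through a product measure space.\<close>

definition dual_kernel :: "real \<Rightarrow> nat \<times> 'a \<Rightarrow> 'a \<Rightarrow> complex" where
  "dual_kernel \<eta> = (\<lambda>(k, y) x. complex_of_real (2 powr (- (real k * (DIM('a) / 2 + \<eta>)))) * Psi (Suc k) (x - y))"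

lemma integral_dual_kernel:
  "(CLINT x|lborel. dual_kernel \<eta> (k, y) x * complex_of_real (g x))
    = complex_of_real (2 powr (- (real k * (DIM('a) / 2 + \<eta>)))) * dual_block g k y"
  by (simp only: dual_kernel_def prod.case dual_block_def mult.assoc integral_mult_right_zero)

text \<open>Young's inequality with exponents t and r on each block, after dividing the block by its
  scale \<open>A\<close> and the dual block by \<open>B\<close>. The product
  \<open>A * B = w k\<close> is summable; this uses one half \<eta> of the surplus.\<close>

lemma duality_bound_ball:
  assumes t: "p \<le> t" "1 < t" and r: "r > 2" and tr: "1 / t + 1 / r = 1" and \<eta>: "\<eta> > 0"
    and \<sigma>_t: "\<sigma> t = DIM('a) / 2 + 2 * \<eta>"
  obtains C where "C \<ge> 0"
    "\<And>F g. \<lbrakk>in_ball F; g \<in> borel_measurable borel; integrable lborel (\<lambda>x. (g x)\<^sup>2)\<rbrakk> \<Longrightarrow>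
      ennreal (norm (CLINT x|lborel. F x * complex_of_real (g x))) \<le> ennreal C *
        (1 + (\<Sum>k. \<integral>\<^sup>+y. ennreal (norm (CLINT x|lborel. dual_kernel \<eta> (k, y) x * complex_of_real (g x)) powr r) \<partial>lborel))"
proof -
  obtain C where C: "C \<ge> 0" "\<And>F k. in_ball F \<Longrightarrow> Lpfun t (block F k) \<and>
     (\<integral>x. norm (block F k x) powr t \<partial>lborel) \<le> C * 2 powr (- (real k * (t * \<sigma> t)))"
    using block_Lt[OF t(1)] by blast
  define w where "w k = 2 powr (- (real k * \<eta>))" for k :: nat
  have w: "w k > 0" "w k \<le> 1" for k
    using \<eta> powr_mono[of "- (real k * \<eta>)" 0 2] by (auto simp: w_def)
  have w_sum: "summable w" unfolding w_def by (rule powr_neg_summable[OF \<eta>])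
  define D where "D = C * (\<Sum>k. w k)"
  have "(\<Sum>k. w k) \<ge> 0" using w by (intro suminf_nonneg w_sum) (auto intro: less_imp_le)
  then have D: "D \<ge> 0" using C(1) by (simp add: D_def)
  define I where "I g k = (\<integral>\<^sup>+y. ennreal (norm (CLINT x|lborel. dual_kernel \<eta> (k, y) x * complex_of_real (g x)) powr r) \<partial>lborel)" for g k
  have "ennreal (norm (CLINT x|lborel. F x * complex_of_real (g x))) \<le> ennreal (D + 1) * (1 + (\<Sum>k. I g k))"
    if F: "in_ball F" and g_meas [measurable]: "g \<in> borel_measurable borel" and g: "integrable lborel (\<lambda>x. (g x)\<^sup>2)" for F g
  proof -
    have [measurable]: "F \<in> borel_measurable borel" using F by (rule in_ball_measurable)
    have block: "(\<integral>\<^sup>+y. ennreal (norm (block F k y) * norm (dual_block g k y)) \<partial>lborel) \<le> ennreal (C * w k) + I g k" for k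
    proof -
      define A where "A = 2 powr (- (real k * \<sigma> t))"
      define B where "B = 2 powr (real k * (DIM('a) / 2 + \<eta>))"
      have AB: "A > 0" "B > 0" by (simp_all add: A_def B_def)
      have "- (real k * \<sigma> t) + real k * (DIM('a) / 2 + \<eta>) = - (real k * \<eta>)"
        by (simp add: \<sigma>_t algebra_simps)
      then have AB_w: "A * B = w k" by (simp add: A_def B_def w_def flip: powr_add)
      have b: "integrable lborel (\<lambda>y. norm (block F k y) powr t)"
        and bC: "(\<integral>y. norm (block F k y) powr t \<partial>lborel) \<le> C * A powr t"
        using C(2)[OF F, of k] by (auto simp: Lpfun_def A_def powr_powr mult_ac)
      have kernel: "norm (CLINT x|lborel. dual_kernel \<eta> (k, y) x * complex_of_real (g x)) = norm (dual_block g k y) / B" for y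
      proof -
        have "norm (complex_of_real (2 powr (- c)) * z) = norm z / 2 powr c" for c z
          by (simp only: norm_mult norm_of_real) (simp add: powr_minus divide_inverse)
        then show ?thesis by (simp only: integral_dual_kernel B_def)
      qed
      \<comment> \<open>The factors 1/t and 1/r are dropped, and \<open>w k \<le> 1\<close> is
        dropped from the second term, which thereby becomes the integrand of
        \<open>I g k\<close>.\<close>
      have young: "norm (block F k y) * norm (dual_block g k y)
         \<le> w k * (norm (block F k y) powr t / A powr t) + (norm (dual_block g k y) / B) powr r" for y
      proof -
        define u v where "u = norm (block F k y) / A" and "v = norm (dual_block g k y) / B"
        have uv: "u \<ge> 0" "v \<ge> 0" using AB by (simp_all add: u_def v_def)
        have "u * v \<le> u powr t / t + v powr r / r"
          using t r tr uv by (intro Youngs_inequality) auto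
        also have "\<dots> \<le> u powr t + v powr r"
          using t r by (intro add_mono) (auto simp: divide_le_eq mult_le_cancel_left1)
        finally have "w k * (u * v) \<le> w k * (u powr t + v powr r)"
          using w by (intro mult_left_mono) (auto intro: less_imp_le)
        also have "\<dots> \<le> w k * u powr t + v powr r"
          using w by (simp add: distrib_left mult_left_le_one_le less_imp_le)
        finally show ?thesis
          using AB by (simp add: u_def v_def powr_divide flip: AB_w)
      qed
      have "(\<integral>\<^sup>+y. ennreal (norm (block F k y) * norm (dual_block g k y)) \<partial>lborel)
        \<le> (\<integral>\<^sup>+y. ennreal (w k * (norm (block F k y) powr t / A powr t)) + ennreal ((norm (dual_block g k y) / B) powr r) \<partial>lborel)"
        using young w by (intro nn_integral_mono) (simp add: less_imp_le flip: ennreal_plus)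
      also have "\<dots> = (\<integral>\<^sup>+y. ennreal (w k * (norm (block F k y) powr t / A powr t)) \<partial>lborel) + I g k"
        unfolding I_def kernel by (rule nn_integral_add) measurable
      also have "(\<integral>\<^sup>+y. ennreal (w k * (norm (block F k y) powr t / A powr t)) \<partial>lborel)
         = ennreal (\<integral>y. w k * (norm (block F k y) powr t / A powr t) \<partial>lborel)"
        using b w by (intro nn_integral_eq_integral) (auto simp: less_imp_le)
      also have "(\<integral>y. w k * (norm (block F k y) powr t / A powr t) \<partial>lborel) \<le> C * w k"
      proof -
        have "A powr t > 0" using AB by simp
        then have "(\<integral>y. norm (block F k y) powr t \<partial>lborel) / A powr t \<le> C"
          using bC by (simp only: pos_divide_le_eq)
        then have "w k * ((\<integral>y. norm (block F k y) powr t \<partial>lborel) / A powr t) \<le> w k * C"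
          using w by (intro mult_left_mono) (auto intro: less_imp_le)
        then show ?thesis by (simp add: mult.commute)
      qed
      finally show ?thesis by (simp add: add_right_mono ennreal_leI)
    qed
    have "ennreal (norm (CLINT x|lborel. F x * complex_of_real (g x)))
      \<le> (\<Sum>k. \<integral>\<^sup>+y. ennreal (norm (block F k y) * norm (dual_block g k y)) \<partial>lborel)"
      by (rule pairing_le_suminf[OF F g_meas g])
    also have "\<dots> \<le> (\<Sum>k. ennreal (C * w k) + I g k)"
      by (intro suminf_le block) auto
    also have "\<dots> = (\<Sum>k. ennreal (C * w k)) + (\<Sum>k. I g k)"
      by (rule suminf_add[symmetric]) auto
    also have "(\<Sum>k. ennreal (C * w k)) = ennreal D"
      unfolding D_def using C(1) w summable_mult[OF w_sum, of C] suminf_mult[OF w_sum, of C]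
      by (subst suminf_ennreal2) (auto simp: less_imp_le)
    \<comment> \<open>\<open>D + 1\<close> is a common factor: it is at least \<open>D\<close> and
      at least 1.\<close>
    also have "ennreal D + (\<Sum>k. I g k) \<le> ennreal (D + 1) * 1 + ennreal (D + 1) * (\<Sum>k. I g k)"
    proof (intro add_mono)
      show "ennreal D \<le> ennreal (D + 1) * 1" using D by (simp add: ennreal_leI)
      have "1 * (\<Sum>k. I g k) \<le> ennreal (D + 1) * (\<Sum>k. I g k)"
        using D by (intro mult_right_mono) (auto simp: ennreal_leI simp flip: ennreal_1)
      then show "(\<Sum>k. I g k) \<le> ennreal (D + 1) * (\<Sum>k. I g k)" by simp
    qed
    finally show ?thesis by (simp only: distrib_left)
  qed
  then show ?thesis using D unfolding I_def by (intro that[of "D + 1"]) auto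
qed

end

section \<open>From the Besov norm to Borel representatives in the ball\<close>

lemma enn_powr_le_1_iff:
  assumes "r > 0" shows "enn_powr a r \<le> 1 \<longleftrightarrow> a \<le> 1"
proof (cases a)
  case (real u)
  have "u powr r \<le> 1 \<longleftrightarrow> u \<le> 1"
    using real(1) assms powr_le1[of r u] gr_one_powr[of u r] by (auto simp: not_le[symmetric])
  then show ?thesis using real by (simp add: enn_powr_def)
qed (simp add: enn_powr_def)

text \<open>One term never exceeds the sum or the supremum, and comparison with 1 is unaffected by
  the powers q and 1/q.\<close>

lemma besov_norm_le_1:
  assumes norm: "besov_norm \<phi>0 s p q f \<le> 1" and q: "1 \<le> q"
  shows "ennreal (2 powr (real k * s)) * Lp_norm p (dyadic_block \<phi>0 k f) \<le> 1"
proof (cases "q = \<infinity>")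
  case True
  have "ennreal (2 powr (real k * s)) * Lp_norm p (dyadic_block \<phi>0 k f)
     \<le> (SUP k. ennreal (2 powr (real k * s)) * Lp_norm p (dyadic_block \<phi>0 k f))"
    by (rule SUP_upper) simp
  also have "\<dots> \<le> 1" using norm True by (simp add: besov_norm_def)
  finally show ?thesis .
next
  case False
  define q' where "q' = enn2real q"
  have q': "q' > 0"
    using q False by (simp add: q'_def enn2real_positive_iff less_top zero_less_one[THEN less_le_trans])
  define a where "a k = ennreal (2 powr (real k * s)) * Lp_norm p (dyadic_block \<phi>0 k f)" for k
  have "enn_powr (\<Sum>k. enn_powr (a k) q') (1 / q') \<le> 1"
    using norm False by (simp add: besov_norm_def a_def q'_def)
  then have "(\<Sum>k. enn_powr (a k) q') \<le> 1" using q' by (simp add: enn_powr_le_1_iff)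
  moreover have "enn_powr (a k) q' \<le> (\<Sum>k. enn_powr (a k) q')"
    using sum_le_suminf[of "\<lambda>k. enn_powr (a k) q'" "{k}"] by simp
  ultimately have "enn_powr (a k) q' \<le> 1" by (rule order_trans[rotated])
  then show ?thesis using q' by (simp add: enn_powr_le_1_iff a_def)
qed

lemma Lp_norm_le:
  fixes h :: "'a::euclidean_space \<Rightarrow> complex"
  assumes [measurable]: "h \<in> borel_measurable borel" and p: "1 \<le> p"
    and le: "ennreal (2 powr c) * Lp_norm p h \<le> 1"
  shows "Lpfun p h" "(\<integral>x. norm (h x) powr p \<partial>lborel) \<le> (2 powr (- c)) powr p"
proof -
  define N where "N = (\<integral>\<^sup>+x. ennreal (norm (h x) powr p) \<partial>lborel)"
  have Lp: "Lp_norm p h = enn_powr N (1 / p)"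
    by (simp add: Lp_norm_def N_def nn_integral_completion)
  \<comment> \<open>\<open>enn_powr\<close> sends infinity to infinity, so an infinite integral
    would violate the bound.\<close>
  have N: "N < \<infinity>"
  proof (rule ccontr)
    assume "\<not> N < \<infinity>"
    then have "N = \<infinity>" by (simp add: not_less top_unique)
    then show False using le by (simp add: Lp enn_powr_def ennreal_mult_top top_unique)
  qed
  then obtain u where u: "N = ennreal u" "u \<ge> 0" by (cases N) auto
  show "Lpfun p h"
    unfolding Lpfun_def using N by (auto simp: N_def intro!: integrableI_nonneg)
  then have int: "integrable lborel (\<lambda>x. norm (h x) powr p)" by (simp add: Lpfun_def)
  have "(\<integral>x. norm (h x) powr p \<partial>lborel) = u"
    using u nn_integral_eq_integral[OF int] by (simp add: N_def integral_nonneg_AE)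
  moreover have "u \<le> (2 powr (- c)) powr p"
  proof -
    have "2 powr c * u powr (1 / p) \<le> 1"
      using le u by (simp add: Lp enn_powr_def ennreal_mult[symmetric])
    then have "u powr (1 / p) \<le> 2 powr (- c)" by (simp add: powr_minus field_simps)
    then have "(u powr (1 / p)) powr p \<le> (2 powr (- c)) powr p" using p by (intro powr_mono2) auto
    then show ?thesis using p u by (simp add: powr_powr)
  qed
  ultimately show "(\<integral>x. norm (h x) powr p \<partial>lborel) \<le> (2 powr (- c)) powr p" by simp
qed

text \<open>Blocks depend on \<open>f\<close> through integrals, so a Borel function equal to
  \<open>f\<close> almost everywhere has the same blocks at every point.\<close>

lemma (in besov_ball) in_ball_representative:
  assumes f: "in_besov_unit_ball \<phi>0 s p q f" and q: "1 \<le> q"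
  obtains f' where "f' \<in> borel_measurable borel" "AE x in lborel. f x = f' x" "in_ball (\<lambda>x. complex_of_real (f' x))"
proof -
  have f_meas [measurable]: "f \<in> borel_measurable lebesgue"
    and f_int: "integrable lebesgue (\<lambda>x. \<bar>f x\<bar> powr p)" and f_norm: "besov_norm \<phi>0 s p q f \<le> 1"
    using f by (auto simp: in_besov_unit_ball_def)
  obtain f' where f'_meas [measurable]: "f' \<in> borel_measurable lborel" and eq: "AE x in lborel. f x = f' x"
    using completion_ex_borel_measurable_real[OF f_meas] by blast
  have f'_leb [measurable]: "f' \<in> borel_measurable lebesgue" by (rule measurable_completion) simp
  have eq_leb: "AE x in lebesgue. f x = f' x" using eq by (rule AE_completion)
  define F where "F x = complex_of_real (f' x)" for x
  have [measurable]: "F \<in> borel_measurable borel" unfolding F_def using f'_meas by simp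
  have "integrable lebesgue (\<lambda>x. \<bar>f' x\<bar> powr p)"
    by (rule integrable_cong_AE_imp[OF f_int]) (use eq_leb in auto)
  then have LpF: "Lpfun p F"
    by (simp add: Lpfun_def F_def integrable_completion)
  have "dyadic_block \<phi>0 k f x = block F k x" for k x
  proof -
    have [measurable]: "psik \<phi>0 k \<in> borel_measurable borel"
      by (cases k) (simp_all add: psik_0 psik_Suc[abs_def])
    have [measurable]: "(\<lambda>y. psik \<phi>0 k (x - y)) \<in> borel_measurable lebesgue"
      by (rule measurable_completion) simp
    have "dyadic_block \<phi>0 k f x = dyadic_block \<phi>0 k f' x"
      unfolding dyadic_block_def by (rule integral_cong_AE) (use eq_leb in auto)
    also have "\<dots> = block F k x"
      using dyadic_block_eq[of p f'] LpF p unfolding F_def by simp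
    finally show ?thesis .
  qed
  then have "dyadic_block \<phi>0 k f = block F k" for k by blast
  then have "ennreal (2 powr (real k * s)) * Lp_norm p (block F k) \<le> 1" for k
    using besov_norm_le_1[OF f_norm q, of k] by simp
  moreover have "block F k \<in> borel_measurable borel" for k
    using LpF by (intro measurable_block) (simp add: Lpfun_def)
  ultimately have "in_ball F"
    unfolding in_ball_def using LpF Lp_norm_le p(1) by blast
  then show ?thesis using f'_meas eq by (intro that[of f']) (auto simp: F_def[abs_def])
qed

section \<open>Orthonormal systems and bases\<close>

lemma integrable_mult_square:
  fixes f g :: "'x \<Rightarrow> 'b::{real_normed_algebra, banach, second_countable_topology}"
  assumes [measurable]: "f \<in> borel_measurable M" "g \<in> borel_measurable M"
    and "integrable M (\<lambda>x. (norm (f x))\<^sup>2)" "integrable M (\<lambda>x. (norm (g x))\<^sup>2)"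
  shows "integrable M (\<lambda>x. f x * g x)"
proof (rule Bochner_Integration.integrable_bound)
  show "integrable M (\<lambda>x. (norm (f x))\<^sup>2 + (norm (g x))\<^sup>2)"
    using assms by simp
  show "AE x in M. norm (f x * g x) \<le> norm ((norm (f x))\<^sup>2 + (norm (g x))\<^sup>2)"
  proof (rule AE_I2)
    fix x
    have "norm (f x * g x) \<le> norm (f x) * norm (g x)" by (rule norm_mult_ineq)
    also have "\<dots> \<le> (norm (f x))\<^sup>2 + (norm (g x))\<^sup>2"
      using sum_squares_bound[of "norm (f x)" "norm (g x)"]
        mult_nonneg_nonneg[OF norm_ge_zero[of "f x"] norm_ge_zero[of "g x"]] by linarith
    finally show "norm (f x * g x) \<le> norm ((norm (f x))\<^sup>2 + (norm (g x))\<^sup>2)" by simp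
  qed
qed measurable

definition L2fun :: "'x measure \<Rightarrow> ('x \<Rightarrow> real) \<Rightarrow> bool" where
  "L2fun M f \<longleftrightarrow> f \<in> borel_measurable M \<and> integrable M (\<lambda>x. (f x)\<^sup>2)"

lemma L2fun_measurable [measurable_dest]: "L2fun M f \<Longrightarrow> f \<in> borel_measurable M"
  and L2fun_square: "L2fun M f \<Longrightarrow> integrable M (\<lambda>x. (f x)\<^sup>2)"
  by (auto simp: L2fun_def)

lemma L2fun_mult: "L2fun M f \<Longrightarrow> L2fun M g \<Longrightarrow> integrable M (\<lambda>x. f x * g x)"
  by (rule integrable_mult_square) (auto simp: L2fun_def)

lemma L2fun_cmult: "L2fun M f \<Longrightarrow> L2fun M (\<lambda>x. c * f x)"
  by (auto simp: L2fun_def power_mult_distrib)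

lemma L2fun_add:
  assumes "L2fun M f" "L2fun M g" shows "L2fun M (\<lambda>x. f x + g x)"
  using assms L2fun_mult[OF assms]
  by (auto simp: L2fun_def power2_sum mult.assoc)

lemma L2fun_diff:
  assumes "L2fun M f" "L2fun M g" shows "L2fun M (\<lambda>x. f x - g x)"
  using assms L2fun_mult[OF assms]
  by (auto simp: L2fun_def power2_diff mult.assoc)

lemma L2fun_sum: "(\<And>i. i \<in> I \<Longrightarrow> L2fun M (f i)) \<Longrightarrow> L2fun M (\<lambda>x. \<Sum>i\<in>I. f i x)"
  by (induction I rule: infinite_finite_induct) (auto intro: L2fun_add, auto simp: L2fun_def)

lemma (in finite_measure) L2fun_const: "L2fun M (\<lambda>_. c)"
  by (auto simp: L2fun_def)

lemma (in finite_measure) L2fun_integrable: "L2fun M f \<Longrightarrow> integrable M f"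
  using L2fun_mult[OF _ L2fun_const, of f 1] by simp

lemma L2fun_cong_AE:
  "L2fun M f \<Longrightarrow> g \<in> borel_measurable M \<Longrightarrow> AE x in M. f x = g x \<Longrightarrow> L2fun M g"
  by (auto simp: L2fun_def elim!: integrable_cong_AE_imp)

text \<open>Allowing \<^term>\<open>e j = 0\<close> almost everywhere avoids a case distinction on the dimension
  of the space and on linear dependencies in the Gram-Schmidt process.\<close>
locale orthonormal_system = prob_space P for P :: "'x measure" +
  fixes e :: "nat \<Rightarrow> 'x \<Rightarrow> real"
  assumes L2_e: "L2fun P (e j)"
    and orthogonal: "i \<noteq> j \<Longrightarrow> (\<integral>x. e i x * e j x \<partial>P) = 0"
    and norm_e_le: "(\<integral>x. e j x * e j x \<partial>P) \<le> 1"
begin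

lemma measurable_e [measurable]: "e j \<in> borel_measurable P"
  using L2_e by (rule L2fun_measurable)

lemma bessel_residual:
  fixes c :: "nat \<Rightarrow> real"
  assumes f: "L2fun P f" and "finite J" and c: "\<And>j. j \<in> J \<Longrightarrow> c j = (\<integral>x. f x * e j x \<partial>P)"
  shows "(\<integral>x. (f x - (\<Sum>j\<in>J. c j * e j x))\<^sup>2 \<partial>P) \<le> (\<integral>x. (f x)\<^sup>2 \<partial>P) - (\<Sum>j\<in>J. (c j)\<^sup>2)"
  using assms(2,3)
proof (induction J)
  case empty
  then show ?case by simp
next
  case (insert k J)
  define g where "g x = f x - (\<Sum>j\<in>J. c j * e j x)" for x
  have g: "L2fun P g"
    unfolding g_def by (intro L2fun_diff L2fun_sum L2fun_cmult f L2_e)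
  have "(\<integral>x. g x * e k x \<partial>P) = (\<integral>x. f x * e k x - (\<Sum>j\<in>J. c j * (e j x * e k x)) \<partial>P)"
    by (simp add: g_def left_diff_distrib sum_distrib_right mult.assoc)
  also have "\<dots> = (\<integral>x. f x * e k x \<partial>P) - (\<integral>x. (\<Sum>j\<in>J. c j * (e j x * e k x)) \<partial>P)"
    by (intro Bochner_Integration.integral_diff Bochner_Integration.integrable_sum
        integrable_mult_right L2fun_mult f L2_e)
  also have "(\<integral>x. (\<Sum>j\<in>J. c j * (e j x * e k x)) \<partial>P) = (\<Sum>j\<in>J. c j * (\<integral>x. e j x * e k x \<partial>P))"
    by (simp add: Bochner_Integration.integral_sum integrable_mult_right L2fun_mult L2_e)
  also have "\<dots> = 0"
    using insert.hyps by (intro sum.neutral ballI) (auto intro: orthogonal)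
  finally have gk: "(\<integral>x. g x * e k x \<partial>P) = c k"
    using insert.prems by simp
  have "(\<integral>x. (f x - (\<Sum>j\<in>insert k J. c j * e j x))\<^sup>2 \<partial>P) = (\<integral>x. (g x - c k * e k x)\<^sup>2 \<partial>P)"
    using insert.hyps by (simp add: g_def diff_diff_eq add.commute)
  also have "\<dots> = (\<integral>x. (g x)\<^sup>2 - 2 * c k * (g x * e k x) + (c k)\<^sup>2 * (e k x * e k x) \<partial>P)"
    by (intro Bochner_Integration.integral_cong) (auto simp: power2_eq_square algebra_simps)
  also have "\<dots> = (\<integral>x. (g x)\<^sup>2 \<partial>P) - 2 * c k * (\<integral>x. g x * e k x \<partial>P) + (c k)\<^sup>2 * (\<integral>x. e k x * e k x \<partial>P)"
    using L2fun_mult[OF g L2_e[of k]] L2fun_mult[OF L2_e[of k] L2_e[of k]] L2fun_square[OF g] by simp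
  also have "\<dots> \<le> (\<integral>x. (g x)\<^sup>2 \<partial>P) - 2 * c k * c k + (c k)\<^sup>2 * 1"
    unfolding gk by (intro add_mono mult_left_mono norm_e_le) auto
  also have "\<dots> = (\<integral>x. (g x)\<^sup>2 \<partial>P) - (c k)\<^sup>2"
    by (simp add: power2_eq_square)
  also have "\<dots> \<le> (\<integral>x. (f x)\<^sup>2 \<partial>P) - (\<Sum>j\<in>J. (c j)\<^sup>2) - (c k)\<^sup>2"
    using insert unfolding g_def by auto
  finally show ?case using insert.hyps by simp
qed

lemma bessel:
  assumes f: "L2fun P f" and "finite J"
  shows "(\<Sum>j\<in>J. (\<integral>x. f x * e j x \<partial>P)\<^sup>2) \<le> (\<integral>x. (f x)\<^sup>2 \<partial>P)"
proof -
  have "0 \<le> (\<integral>x. (f x - (\<Sum>j\<in>J. (\<integral>x. f x * e j x \<partial>P) * e j x))\<^sup>2 \<partial>P)" by simp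
  also have "\<dots> \<le> (\<integral>x. (f x)\<^sup>2 \<partial>P) - (\<Sum>j\<in>J. (\<integral>x. f x * e j x \<partial>P)\<^sup>2)"
    by (rule bessel_residual[OF f assms(2)]) simp
  finally show ?thesis by simp
qed

text \<open>Real and imaginary parts are treated separately; their squares add up on both
  sides.\<close>

lemma bessel_complex:
  fixes f :: "'x \<Rightarrow> complex"
  assumes [measurable]: "f \<in> borel_measurable P"
    and f: "integrable P (\<lambda>x. (norm (f x))\<^sup>2)" and "finite J"
  shows "(\<Sum>j\<in>J. (norm (\<integral>x. f x * complex_of_real (e j x) \<partial>P))\<^sup>2) \<le> (\<integral>x. (norm (f x))\<^sup>2 \<partial>P)"
proof -
  have Re: "L2fun P (\<lambda>x. Re (f x))"
    unfolding L2fun_def by (auto intro!: Bochner_Integration.integrable_bound[OF f] simp: abs_Re_le_cmod power_mono cmod_power2)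
  have Im: "L2fun P (\<lambda>x. Im (f x))"
    unfolding L2fun_def by (auto intro!: Bochner_Integration.integrable_bound[OF f] simp: abs_Im_le_cmod power_mono cmod_power2)
  have int: "integrable P (\<lambda>x. f x * complex_of_real (e j x))" for j
    by (rule integrable_mult_square) (use f L2fun_square[OF L2_e] in auto)
  have "(norm (\<integral>x. f x * complex_of_real (e j x) \<partial>P))\<^sup>2
     = (\<integral>x. Re (f x) * e j x \<partial>P)\<^sup>2 + (\<integral>x. Im (f x) * e j x \<partial>P)\<^sup>2" for j
    using int[of j] by (simp add: cmod_power2 flip: integral_Re integral_Im)
  then have "(\<Sum>j\<in>J. (norm (\<integral>x. f x * complex_of_real (e j x) \<partial>P))\<^sup>2) =
    (\<Sum>j\<in>J. (\<integral>x. Re (f x) * e j x \<partial>P)\<^sup>2) + (\<Sum>j\<in>J. (\<integral>x. Im (f x) * e j x \<partial>P)\<^sup>2)"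
    by (simp add: sum.distrib)
  also have "\<dots> \<le> (\<integral>x. (Re (f x))\<^sup>2 \<partial>P) + (\<integral>x. (Im (f x))\<^sup>2 \<partial>P)"
    by (intro add_mono bessel Re Im assms)
  also have "\<dots> = (\<integral>x. (norm (f x))\<^sup>2 \<partial>P)"
    using Re Im by (simp add: cmod_power2 L2fun_square)
  finally show ?thesis .
qed

end

text \<open>The normalising factor is \<open>1 / 0 = 0\<close> if \<^term>\<open>u n\<close> depends linearly on its predecessors.\<close>
fun gram_schmidt :: "'x measure \<Rightarrow> (nat \<Rightarrow> 'x \<Rightarrow> real) \<Rightarrow> nat \<Rightarrow> 'x \<Rightarrow> real" where
  "gram_schmidt P u n =
    (let g = (\<lambda>x. u n x - (\<Sum>j<n. (\<integral>y. u n y * gram_schmidt P u j y \<partial>P) * gram_schmidt P u j x))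
     in (\<lambda>x. g x / sqrt (\<integral>y. (g y)\<^sup>2 \<partial>P)))"

declare gram_schmidt.simps [simp del]

locale square_integrable_sequence = prob_space P for P :: "'x measure" +
  fixes u :: "nat \<Rightarrow> 'x \<Rightarrow> real"
  assumes L2_u: "L2fun P (u n)"
begin

abbreviation e :: "nat \<Rightarrow> 'x \<Rightarrow> real" where "e \<equiv> gram_schmidt P u"

text \<open>The residual before normalisation; with it \<open>e_eq\<close> replaces the recursion
  equation, which would loop as a rewrite rule.\<close>

definition g :: "nat \<Rightarrow> 'x \<Rightarrow> real" where
  "g n x = u n x - (\<Sum>j<n. (\<integral>y. u n y * e j y \<partial>P) * e j x)"

lemma e_eq: "e n x = g n x / sqrt (\<integral>y. (g n y)\<^sup>2 \<partial>P)"
  unfolding g_def by (subst gram_schmidt.simps) (simp add: Let_def)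

lemma L2_e: "L2fun P (e n)"
proof (induction n rule: less_induct)
  case (less n)
  have "L2fun P (g n)"
    unfolding g_def by (intro L2fun_diff L2_u L2fun_sum L2fun_cmult less) auto
  then have "L2fun P (\<lambda>x. (1 / sqrt (\<integral>y. (g n y)\<^sup>2 \<partial>P)) * g n x)" by (rule L2fun_cmult)
  then show ?case by (simp add: e_eq[abs_def])
qed

lemma L2_g: "L2fun P (g n)"
  unfolding g_def by (intro L2fun_diff L2_u L2fun_sum L2fun_cmult L2_e)

text \<open>Division by 0 yields the zero function itself, not merely a function vanishing almost
  everywhere.\<close>

lemma norm_e: "e n = (\<lambda>_. 0) \<or> (\<integral>x. e n x * e n x \<partial>P) = 1"
proof (cases "(\<integral>y. (g n y)\<^sup>2 \<partial>P) = 0")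
  case True
  then show ?thesis by (simp add: e_eq[abs_def])
next
  case False
  have "(\<integral>y. (g n y)\<^sup>2 \<partial>P) \<ge> 0" by simp
  then have "e n x * e n x = (g n x)\<^sup>2 / (\<integral>y. (g n y)\<^sup>2 \<partial>P)" for x
    by (simp add: e_eq power2_eq_square)
  then show ?thesis using False by simp
qed

lemma orthogonal_less: "i < n \<Longrightarrow> (\<integral>x. e n x * e i x \<partial>P) = 0"
proof (induction n arbitrary: i rule: less_induct)
  case (less n)
  have orth: "(\<integral>x. e j x * e i x \<partial>P) = 0" if "j < n" "j \<noteq> i" for j
    using that less.IH[of j i] less.IH[of i j] less.prems
    by (cases "i < j") (auto simp: mult.commute)
  define c where "c j = (\<integral>y. u n y * e j y \<partial>P)" for j
  have "(\<integral>x. g n x * e i x \<partial>P) = (\<integral>x. u n x * e i x - (\<Sum>j<n. c j * (e j x * e i x)) \<partial>P)"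
    by (simp add: g_def c_def left_diff_distrib sum_distrib_right mult.assoc)
  also have "\<dots> = c i - (\<Sum>j<n. c j * (\<integral>x. e j x * e i x \<partial>P))"
    unfolding c_def
    by (subst Bochner_Integration.integral_diff, intro L2fun_mult L2_u L2_e,
        intro Bochner_Integration.integrable_sum integrable_mult_right L2fun_mult L2_e,
        subst Bochner_Integration.integral_sum, intro integrable_mult_right L2fun_mult L2_e,
        simp only: integral_mult_right_zero)
  also have "(\<Sum>j<n. c j * (\<integral>x. e j x * e i x \<partial>P)) = (\<Sum>j\<in>{i}. c j * (\<integral>x. e j x * e i x \<partial>P))"
    using less.prems orth by (intro sum.mono_neutral_right) auto
  \<comment> \<open>If \<open>e i\<close> is the zero function, then \<open>c i = 0\<close> as well,
    so the identity survives the degenerate case.\<close>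
  also have "\<dots> = c i"
    using norm_e[of i] by (auto simp: c_def)
  finally show ?case by (simp add: e_eq[of n])
qed

sublocale orthonormal_system P e
proof
  show "L2fun P (e j)" for j by (rule L2_e)
  show "(\<integral>x. e i x * e j x \<partial>P) = 0" if "i \<noteq> j" for i j
    using orthogonal_less[of i j] orthogonal_less[of j i] that
    by (cases "i < j") (auto simp: mult.commute)
  show "(\<integral>x. e j x * e j x \<partial>P) \<le> 1" for j
    using norm_e[of j] by auto
qed

section \<open>Closure of the span and Parseval's identity\<close>

definition span_e :: "('x \<Rightarrow> real) set" where
  "span_e = {h. \<exists>n a. h = (\<lambda>x. \<Sum>j<n. a j * e j x)}"

lemma span_e_add:
  assumes "h1 \<in> span_e" "h2 \<in> span_e" shows "(\<lambda>x. h1 x + h2 x) \<in> span_e"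
proof -
  obtain n a m b where h: "h1 = (\<lambda>x. \<Sum>j<n. a j * e j x)" "h2 = (\<lambda>x. \<Sum>j<m. b j * e j x)"
    using assms by (auto simp: span_e_def)
  define k where "k = max n m"
  define c where "c j = (if j < n then a j else 0) + (if j < m then b j else 0)" for j
  have "(\<Sum>j<n. a j * e j x) = (\<Sum>j<k. (if j < n then a j else 0) * e j x)" for x
    by (rule sum.mono_neutral_cong_left) (auto simp: k_def)
  moreover have "(\<Sum>j<m. b j * e j x) = (\<Sum>j<k. (if j < m then b j else 0) * e j x)" for x
    by (rule sum.mono_neutral_cong_left) (auto simp: k_def)
  ultimately have "(\<lambda>x. h1 x + h2 x) = (\<lambda>x. \<Sum>j<k. c j * e j x)"
    by (simp add: h c_def distrib_right sum.distrib)
  then show ?thesis by (auto simp: span_e_def)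
qed

lemma span_e_cmult:
  assumes "h \<in> span_e" shows "(\<lambda>x. c * h x) \<in> span_e"
proof -
  obtain n a where "h = (\<lambda>x. \<Sum>j<n. a j * e j x)" using assms by (auto simp: span_e_def)
  then have "(\<lambda>x. c * h x) = (\<lambda>x. \<Sum>j<n. (c * a j) * e j x)"
    by (simp add: sum_distrib_left mult.assoc)
  then show ?thesis by (auto simp: span_e_def)
qed

lemma L2_span_e: "h \<in> span_e \<Longrightarrow> L2fun P h"
  by (auto simp: span_e_def intro!: L2fun_sum L2fun_cmult L2_e)

text \<open>Membership in the L^2 closure of the span, phrased with squared distances;
  \<open>integral_square_add_le\<close> then stands in for the triangle inequality.\<close>

definition approximable :: "('x \<Rightarrow> real) \<Rightarrow> bool" where
  "approximable f \<longleftrightarrow> L2fun P f \<and> (\<forall>\<epsilon>>0. \<exists>h\<in>span_e. (\<integral>x. (f x - h x)\<^sup>2 \<partial>P) < \<epsilon>)"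

lemma integral_square_add_le:
  assumes "L2fun P f" "L2fun P h"
  shows "(\<integral>x. (f x + h x)\<^sup>2 \<partial>P) \<le> 2 * (\<integral>x. (f x)\<^sup>2 \<partial>P) + 2 * (\<integral>x. (h x)\<^sup>2 \<partial>P)"
proof -
  have "(\<integral>x. (f x + h x)\<^sup>2 \<partial>P) \<le> (\<integral>x. 2 * (f x)\<^sup>2 + 2 * (h x)\<^sup>2 \<partial>P)"
    using L2fun_square[OF L2fun_add[OF assms]] L2fun_square[OF assms(1)] L2fun_square[OF assms(2)]
    by (intro integral_mono) (auto simp: sum_squares_bound power2_sum mult.assoc
        intro: order_trans[OF _ sum_squares_bound])
  then show ?thesis
    using L2fun_square[OF assms(1)] L2fun_square[OF assms(2)] by simp
qed

lemma approximable_limit: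
  assumes f: "L2fun P f" and lim: "\<And>\<epsilon>. \<epsilon> > 0 \<Longrightarrow> \<exists>v. approximable v \<and> (\<integral>x. (f x - v x)\<^sup>2 \<partial>P) < \<epsilon>"
  shows "approximable f"
  unfolding approximable_def
proof (intro conjI f allI impI)
  fix \<epsilon> :: real assume "\<epsilon> > 0"
  then obtain v where v: "approximable v" "(\<integral>x. (f x - v x)\<^sup>2 \<partial>P) < \<epsilon> / 4"
    using lim[of "\<epsilon> / 4"] by auto
  then obtain h where h: "h \<in> span_e" "(\<integral>x. (v x - h x)\<^sup>2 \<partial>P) < \<epsilon> / 4"
    using \<open>\<epsilon> > 0\<close> unfolding approximable_def by (meson zero_less_divide_iff zero_less_numeral)
  have "(\<integral>x. (f x - h x)\<^sup>2 \<partial>P) = (\<integral>x. ((f x - v x) + (v x - h x))\<^sup>2 \<partial>P)" by simp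
  also have "\<dots> \<le> 2 * (\<integral>x. (f x - v x)\<^sup>2 \<partial>P) + 2 * (\<integral>x. (v x - h x)\<^sup>2 \<partial>P)"
    using v(1) by (intro integral_square_add_le L2fun_diff f L2_span_e[OF h(1)]) (auto simp: approximable_def)
  also have "\<dots> < \<epsilon>" using v(2) h(2) by simp
  finally show "\<exists>h\<in>span_e. (\<integral>x. (f x - h x)\<^sup>2 \<partial>P) < \<epsilon>" using h(1) by blast
qed

lemma approximable_add:
  assumes f: "approximable f" and v: "approximable v" shows "approximable (\<lambda>x. f x + v x)"
  unfolding approximable_def
proof (intro conjI allI impI)
  have L2: "L2fun P f" "L2fun P v" using assms by (auto simp: approximable_def)
  then show "L2fun P (\<lambda>x. f x + v x)" by (rule L2fun_add)
  fix \<epsilon> :: real assume "\<epsilon> > 0"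
  then have "\<epsilon> / 4 > 0" by simp
  then obtain h k where h: "h \<in> span_e" "(\<integral>x. (f x - h x)\<^sup>2 \<partial>P) < \<epsilon> / 4"
    and k: "k \<in> span_e" "(\<integral>x. (v x - k x)\<^sup>2 \<partial>P) < \<epsilon> / 4"
    using assms unfolding approximable_def by meson
  have "(\<integral>x. (f x + v x - (h x + k x))\<^sup>2 \<partial>P) = (\<integral>x. ((f x - h x) + (v x - k x))\<^sup>2 \<partial>P)"
    by (simp add: algebra_simps)
  also have "\<dots> \<le> 2 * (\<integral>x. (f x - h x)\<^sup>2 \<partial>P) + 2 * (\<integral>x. (v x - k x)\<^sup>2 \<partial>P)"
    by (intro integral_square_add_le L2fun_diff L2 L2_span_e h k)
  also have "\<dots> < \<epsilon>" using h(2) k(2) by simp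
  finally show "\<exists>h\<in>span_e. (\<integral>x. (f x + v x - h x)\<^sup>2 \<partial>P) < \<epsilon>"
    by (intro bexI[OF _ span_e_add[OF h(1) k(1)]])
qed

lemma approximable_cmult:
  assumes f: "approximable f" shows "approximable (\<lambda>x. c * f x)"
proof (cases "c = 0")
  case True
  have "(\<lambda>x. 0) \<in> span_e" using span_e_cmult[of _ 0] by (auto simp: span_e_def intro!: exI[of _ 0])
  then show ?thesis
    by (auto simp: approximable_def True L2fun_const intro!: bexI[of _ "\<lambda>x. 0"])
next
  case False
  show ?thesis
    unfolding approximable_def
  proof (intro conjI allI impI)
    show "L2fun P (\<lambda>x. c * f x)" using f by (auto simp: approximable_def L2fun_cmult)
    fix \<epsilon> :: real assume "\<epsilon> > 0"
    then have "\<epsilon> / c\<^sup>2 > 0" using False by simp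
    then obtain h where h: "h \<in> span_e" "(\<integral>x. (f x - h x)\<^sup>2 \<partial>P) < \<epsilon> / c\<^sup>2"
      using f unfolding approximable_def by meson
    have "(\<integral>x. (c * f x - c * h x)\<^sup>2 \<partial>P) = c\<^sup>2 * (\<integral>x. (f x - h x)\<^sup>2 \<partial>P)"
      by (simp add: right_diff_distrib[symmetric] power_mult_distrib)
    also have "\<dots> < \<epsilon>" using h(2) False by (simp add: field_simps)
    finally show "\<exists>h\<in>span_e. (\<integral>x. (c * f x - h x)\<^sup>2 \<partial>P) < \<epsilon>"
      by (intro bexI[OF _ span_e_cmult[OF h(1)]])
  qed
qed

lemma approximable_cong_AE:
  assumes "approximable f" "h \<in> borel_measurable P" "AE x in P. f x = h x"
  shows "approximable h"
proof (rule approximable_limit)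
  show L2h: "L2fun P h" using assms by (auto simp: approximable_def intro: L2fun_cong_AE)
  have "(\<integral>x. (h x - f x)\<^sup>2 \<partial>P) = 0"
    using assms(3) by (intro integral_eq_zero_AE) auto
  then show "\<exists>v. approximable v \<and> (\<integral>x. (h x - v x)\<^sup>2 \<partial>P) < \<epsilon>" if "\<epsilon> > 0" for \<epsilon>
    using that assms(1) by auto
qed

text \<open>Dominated convergence in L^2: the difference is at most twice the majorant, whose square
  is integrable.\<close>

lemma approximable_sequence:
  assumes f: "\<And>n. approximable (f n)" and w: "L2fun P w"
    and bound: "\<And>n x. x \<in> space P \<Longrightarrow> \<bar>f n x\<bar> \<le> w x"
    and lim: "\<And>x. x \<in> space P \<Longrightarrow> (\<lambda>n. f n x) \<longlonglongrightarrow> v x" and v: "L2fun P v"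
  shows "approximable v"
proof (rule approximable_limit[OF v])
  fix \<epsilon> :: real assume "\<epsilon> > 0"
  have [measurable]: "f n \<in> borel_measurable P" for n
    using f[of n] by (auto simp: approximable_def L2fun_def)
  have [measurable]: "v \<in> borel_measurable P" using v by (auto simp: L2fun_def)
  have "(\<lambda>n. \<integral>x. (v x - f n x)\<^sup>2 \<partial>P) \<longlonglongrightarrow> (\<integral>x. 0 \<partial>P)"
  proof (rule integral_dominated_convergence[where w = "\<lambda>x. (2 * w x)\<^sup>2"])
    show "integrable P (\<lambda>x. (2 * w x)\<^sup>2)"
      using L2fun_square[OF L2fun_cmult[OF w]] .
    show "AE x in P. (\<lambda>n. (v x - f n x)\<^sup>2) \<longlonglongrightarrow> 0"
    proof (rule AE_I2)
      fix x assume x: "x \<in> space P"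
      have "(\<lambda>n. (v x - f n x)\<^sup>2) \<longlonglongrightarrow> (v x - v x)\<^sup>2"
        by (intro tendsto_intros lim x)
      then show "(\<lambda>n. (v x - f n x)\<^sup>2) \<longlonglongrightarrow> 0" by simp
    qed
    show "AE x in P. norm ((v x - f n x)\<^sup>2) \<le> (2 * w x)\<^sup>2" for n
    proof (rule AE_I2)
      fix x assume x: "x \<in> space P"
      have "\<bar>v x\<bar> \<le> w x"
        using bound[OF x] by (intro tendsto_upperbound[OF tendsto_rabs[OF lim[OF x]]]) auto
      then have "\<bar>v x - f n x\<bar> \<le> 2 * w x" using bound[OF x, of n] by linarith
      then show "norm ((v x - f n x)\<^sup>2) \<le> (2 * w x)\<^sup>2"
        by (metis abs_ge_zero norm_power power2_abs power_mono real_norm_def abs_idempotent)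
    qed
  qed auto
  then have "\<forall>\<^sub>F n in sequentially. (\<integral>x. (v x - f n x)\<^sup>2 \<partial>P) < \<epsilon>"
    using \<open>\<epsilon> > 0\<close> by (intro order_tendstoD(2)) auto
  then show "\<exists>v'. approximable v' \<and> (\<integral>x. (v x - v' x)\<^sup>2 \<partial>P) < \<epsilon>"
    using f by (auto simp: eventually_sequentially)
qed

text \<open>\<open>u n\<close> is its projection plus the residual, a multiple of
  \<open>e n\<close>. If the residual has norm 0, this identity holds only almost
  everywhere.\<close>

lemma approximable_u: "approximable (u n)"
proof -
  have e_appr: "e j \<in> span_e" for j
  proof -
    have "e j = (\<lambda>x. \<Sum>i<Suc j. (if i = j then 1 else 0) * e i x)" by (rule ext) simp
    then show ?thesis unfolding span_e_def by (intro CollectI exI)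
  qed
  define c where "c j = (\<integral>y. u n y * e j y \<partial>P)" for j
  define h where "h x = (\<Sum>j<n. c j * e j x) + sqrt (\<integral>y. (g n y)\<^sup>2 \<partial>P) * e n x" for x
  have h: "h \<in> span_e"
    unfolding h_def by (intro span_e_add span_e_cmult e_appr) (auto simp: span_e_def)
  have AE: "AE x in P. h x = u n x"
  proof (cases "(\<integral>y. (g n y)\<^sup>2 \<partial>P) = 0")
    case True
    then have "AE x in P. (g n x)\<^sup>2 = 0"
      using L2fun_square[OF L2_g] by (subst (asm) integral_nonneg_eq_0_iff_AE) auto
    then show ?thesis
      by eventually_elim (simp add: h_def True, simp add: g_def c_def)
  next
    case False
    then have "h x = u n x" for x by (auto simp: h_def e_eq[of n] g_def c_def)
    then show ?thesis by simp
  qed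
  have "approximable h"
    unfolding approximable_def by (intro conjI allI impI bexI[OF _ h] L2_span_e[OF h]) simp
  then show ?thesis
    by (rule approximable_cong_AE[OF _ L2fun_measurable[OF L2_u] AE])
qed

text \<open>Completing squares shows that no element of the span is closer to \<open>f\<close> than
  the Fourier sum of the same length. Hence approximability leaves no gap in Bessel's
  inequality.\<close>

lemma approximable_imp_parseval:
  assumes f: "approximable f"
  shows "(\<lambda>j. (\<integral>x. f x * e j x \<partial>P)\<^sup>2) sums (\<integral>x. (f x)\<^sup>2 \<partial>P)"
proof -
  have L2: "L2fun P f" using f by (simp add: approximable_def)
  define c where "c j = (\<integral>x. f x * e j x \<partial>P)" for j
  have upper: "(\<Sum>j<n. (c j)\<^sup>2) \<le> (\<integral>x. (f x)\<^sup>2 \<partial>P)" for n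
    unfolding c_def by (rule bessel[OF L2]) simp
  have summ: "summable (\<lambda>j. (c j)\<^sup>2)"
    by (rule bounded_imp_summable[of _ "\<integral>x. (f x)\<^sup>2 \<partial>P"])
      (simp, simp only: lessThan_Suc_atMost[symmetric] upper)
  have "(\<integral>x. (f x)\<^sup>2 \<partial>P) \<le> (\<Sum>j. (c j)\<^sup>2) + \<epsilon>" if "\<epsilon> > 0" for \<epsilon>
  proof -
    obtain n a where a: "(\<integral>x. (f x - (\<Sum>j<n. a j * e j x))\<^sup>2 \<partial>P) < \<epsilon>"
      using f \<open>\<epsilon> > 0\<close> by (auto simp: approximable_def span_e_def)
    define h where "h x = (\<Sum>j<n. a j * e j x)" for x
    have h: "L2fun P h" unfolding h_def by (intro L2fun_sum L2fun_cmult L2_e)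
    have fh: "(\<integral>x. f x * h x \<partial>P) = (\<Sum>j<n. a j * c j)"
    proof -
      have "(\<integral>x. f x * h x \<partial>P) = (\<integral>x. (\<Sum>j<n. a j * (f x * e j x)) \<partial>P)"
        by (simp add: h_def sum_distrib_left mult_ac)
      also have "\<dots> = (\<Sum>j<n. a j * c j)"
        unfolding c_def by (subst Bochner_Integration.integral_sum)
          (intro integrable_mult_right L2fun_mult L2 L2_e, simp only: integral_mult_right_zero)
      finally show ?thesis .
    qed
    define d where "d j = (\<integral>x. e j x * e j x \<partial>P)" for j
    have eh: "(\<integral>x. e j x * h x \<partial>P) = a j * d j" if "j < n" for j
    proof -
      have "(\<integral>x. e j x * h x \<partial>P) = (\<integral>x. (\<Sum>i<n. a i * (e j x * e i x)) \<partial>P)"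
        by (simp add: h_def sum_distrib_left mult_ac)
      also have "\<dots> = (\<Sum>i<n. a i * (\<integral>x. e j x * e i x \<partial>P))"
        by (subst Bochner_Integration.integral_sum)
          (intro integrable_mult_right L2fun_mult L2_e, simp only: integral_mult_right_zero)
      also have "\<dots> = (\<Sum>i\<in>{j}. a i * (\<integral>x. e j x * e i x \<partial>P))"
        using that by (intro sum.mono_neutral_right) (auto simp: orthogonal)
      finally show ?thesis by (simp add: d_def)
    qed
    have hh: "(\<integral>x. (h x)\<^sup>2 \<partial>P) = (\<Sum>j<n. a j * (a j * d j))"
    proof -
      have "(h x)\<^sup>2 = (\<Sum>j<n. a j * e j x) * h x" for x
        by (simp add: power2_eq_square h_def)
      then have "(\<integral>x. (h x)\<^sup>2 \<partial>P) = (\<integral>x. (\<Sum>j<n. a j * (e j x * h x)) \<partial>P)"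
        by (simp add: sum_distrib_right mult.assoc)
      also have "\<dots> = (\<Sum>j<n. a j * (\<integral>x. e j x * h x \<partial>P))"
        by (subst Bochner_Integration.integral_sum)
          (intro integrable_mult_right L2fun_mult L2_e h, simp only: integral_mult_right_zero)
      finally show ?thesis by (simp add: eh)
    qed
    have "(\<integral>x. (f x - h x)\<^sup>2 \<partial>P) = (\<integral>x. (f x)\<^sup>2 + (h x)\<^sup>2 - 2 * (f x * h x) \<partial>P)"
      by (simp add: power2_diff mult.assoc)
    also have "\<dots> = (\<integral>x. (f x)\<^sup>2 \<partial>P) + (\<Sum>j<n. a j * (a j * d j)) - 2 * (\<Sum>j<n. a j * c j)"
      using L2fun_square[OF L2] L2fun_square[OF h] L2fun_mult[OF L2 h] by (simp add: hh fh)
    \<comment> \<open>The termwise difference is \<open>(c j - a j)\<^sup>2\<close> if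
      \<open>e j\<close> has norm 1, and 0 if \<open>e j\<close> is the zero function.\<close>
    also have "\<dots> \<ge> (\<integral>x. (f x)\<^sup>2 \<partial>P) - (\<Sum>j<n. (c j)\<^sup>2)"
    proof -
      have "0 \<le> (\<Sum>j<n. (c j)\<^sup>2 + a j * (a j * d j) - 2 * (a j * c j))"
      proof (rule sum_nonneg)
        fix j
        show "0 \<le> (c j)\<^sup>2 + a j * (a j * d j) - 2 * (a j * c j)"
        proof (cases "e j = (\<lambda>_. 0)")
          case True
          then show ?thesis by (simp add: c_def d_def)
        next
          case False
          then have "d j = 1" using norm_e[of j] by (simp add: d_def)
          then have "(c j)\<^sup>2 + a j * (a j * d j) - 2 * (a j * c j) = (c j - a j)\<^sup>2"
            by (simp add: power2_eq_square algebra_simps)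
          then show ?thesis by simp
        qed
      qed
      then show ?thesis by (simp add: sum.distrib sum_subtractf sum_distrib_left)
    qed
    finally have "(\<integral>x. (f x)\<^sup>2 \<partial>P) \<le> (\<Sum>j<n. (c j)\<^sup>2) + \<epsilon>"
      using a unfolding h_def by linarith
    also have "(\<Sum>j<n. (c j)\<^sup>2) \<le> (\<Sum>j. (c j)\<^sup>2)"
      by (rule sum_le_suminf[OF summ]) auto
    finally show ?thesis by simp
  qed
  then have "(\<integral>x. (f x)\<^sup>2 \<partial>P) \<le> (\<Sum>j. (c j)\<^sup>2)" by (rule field_le_epsilon)
  moreover have "(\<Sum>j. (c j)\<^sup>2) \<le> (\<integral>x. (f x)\<^sup>2 \<partial>P)"
    by (rule suminf_le_const[OF summ upper])
  ultimately show ?thesis using summ by (simp add: sums_iff c_def)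
qed

end

text \<open>Indicators of the countable family are orthonormalised, and a monotone class argument
  shows that the result is complete. Generation up to null sets is what a density over the completed
  measure \<open>lebesgue\<close> can offer.\<close>

lemma (in prob_space) exists_orthonormal_basis:
  assumes E: "countable E" "Int_stable E" "E \<subseteq> sets M"
    and gen: "\<And>A. A \<in> sets M \<Longrightarrow> \<exists>B\<in>sigma_sets (space M) E. AE x in M. x \<in> A \<longleftrightarrow> x \<in> B"
  obtains e where "orthonormal_system M e" "e 0 = (\<lambda>_. 1)"
    "\<And>f. L2fun M f \<Longrightarrow> (\<lambda>j. (\<integral>x. f x * e j x \<partial>M)\<^sup>2) sums (\<integral>x. (f x)\<^sup>2 \<partial>M)"
proof -
  \<comment> \<open>The constant 1 comes first so that Gram-Schmidt keeps it as \<open>e 0\<close>;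
    inserting the empty set makes the enumerated family nonempty.\<close>
  define u where "u n = (if n = 0 then (\<lambda>_. 1) else indicat_real (from_nat_into (insert {} E) (n - 1)))" for n
  have E_u: "\<exists>n. u n = indicat_real A" if A: "A \<in> E" for A
  proof -
    obtain n where "from_nat_into (insert {} E) n = A"
      using from_nat_into_surj[of "insert {} E" A] A E(1) by auto
    then show ?thesis by (intro exI[of _ "Suc n"]) (simp add: u_def)
  qed
  have "from_nat_into (insert {} E) n \<in> sets M" for n
    using from_nat_into[of "insert {} E" n] E(3) by auto
  moreover have L2_indicator: "L2fun M (indicat_real A)" if "A \<in> sets M" for A
    unfolding L2fun_def
    using that by (intro conjI integrable_const_bound[of _ 1]) (auto split: split_indicator)
  ultimately have "L2fun M (u n)" for n
    by (simp add: u_def L2fun_const)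
  then interpret square_integrable_sequence M u
    by unfold_locales
  have one: "approximable (\<lambda>_. 1)" using approximable_u[of 0] by (simp add: u_def)
  have zero: "approximable (\<lambda>_. 0)" using approximable_cmult[OF one, of 0] by simp
  have E_sets: "sigma_sets (space M) E \<subseteq> sets M" by (rule sets.sigma_sets_subset[OF E(3)])
  \<comment> \<open>Dynkin's argument: intersection stability leaves complements and disjoint
    unions, which are linear operations and dominated limits.\<close>
  have sigma: "approximable (indicat_real A)" if "A \<in> sigma_sets (space M) E" for A
    using E(2) order_trans[OF E(3) sets.space_closed] that
  proof (induction rule: sigma_sets_induct_disjoint)
    case (basic A) then show ?case using E_u[of A] approximable_u by metis
  next
    case empty then show ?case using zero by (simp add: indicator_def of_bool_def)
  next
    case (compl A)
    have "approximable (\<lambda>x. 1 + (-1) * indicat_real A x)"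
      by (intro approximable_add approximable_cmult one compl)
    then show ?case
      using E_sets compl(1) by (rule_tac approximable_cong_AE) (auto split: split_indicator)
  next
    case (union A)
    have A: "A i \<in> sets M" for i using union(2) E_sets by auto
    show ?case
    proof (rule approximable_sequence[where w = "\<lambda>_. 1"])
      show "approximable (\<lambda>x. \<Sum>i<n. indicat_real (A i) x)" for n
        by (induction n) (auto intro: approximable_add union zero)
      have eq: "(\<Sum>i<n. indicat_real (A i) x) = indicat_real (\<Union>i<n. A i) x" for n x
        using union(1) by (subst indicator_UN_disjoint) (auto simp: disjoint_family_on_def)
      show "\<bar>\<Sum>i<n. indicat_real (A i) x\<bar> \<le> 1" for n x
        unfolding eq by (simp split: split_indicator)
      show "(\<lambda>n. \<Sum>i<n. indicat_real (A i) x) \<longlonglongrightarrow> indicat_real (\<Union> (range A)) x" for x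
        unfolding eq by (rule LIMSEQ_indicator_UN)
      show "L2fun M (\<lambda>_. 1)" by (rule L2fun_const)
      show "L2fun M (indicat_real (\<Union> (range A)))" using A by (intro L2_indicator) auto
    qed
  qed
  have set: "approximable (indicat_real A)" if A: "A \<in> sets M" for A
  proof -
    obtain B where B: "B \<in> sigma_sets (space M) E" "AE x in M. x \<in> A \<longleftrightarrow> x \<in> B"
      using gen[OF A] by blast
    show ?thesis
      using A B(2) by (intro approximable_cong_AE[OF sigma[OF B(1)]]) (auto elim!: eventually_mono split: split_indicator)
  qed
  have L2_mono: "L2fun M v" if "v \<in> borel_measurable M" "L2fun M w" "\<And>x. x \<in> space M \<Longrightarrow> \<bar>v x\<bar> \<le> w x" for v w
    unfolding L2fun_def
  proof (intro conjI that(1) Bochner_Integration.integrable_bound[OF L2fun_square[OF that(2)]] AE_I2)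
    fix x assume "x \<in> space M"
    then have "\<bar>v x\<bar> \<le> w x" by (rule that(3))
    then show "norm ((v x)\<^sup>2) \<le> norm ((w x)\<^sup>2)" by (simp add: abs_le_square_iff[symmetric])
  qed (use that(1) in measurable)
  \<comment> \<open>Every function in the construction from below is dominated by the final one, up
    to a nonzero scalar; this keeps it square integrable.\<close>
  have nonneg: "approximable v" if "v \<in> borel_measurable M" "\<And>x. 0 \<le> v x" "L2fun M v" for v
    using that
  proof (induction rule: borel_measurable_induct_real)
    case (set A) then show ?case using \<open>\<And>A. A \<in> sets M \<Longrightarrow> approximable (indicat_real A)\<close> by simp
  next
    case (mult v c)
    show ?case
    proof (cases "c = 0")
      case True then show ?thesis using zero by simp
    next
      case False
      have "L2fun M (\<lambda>x. (1 / c) * (c * v x))" using mult.prems by (rule L2fun_cmult)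
      then have "L2fun M v" using False by simp
      then show ?thesis using mult by (intro approximable_cmult) auto
    qed
  next
    case (add v w)
    have "L2fun M v" by (rule L2_mono[OF _ add.prems]) (use add in auto)
    moreover have "L2fun M w" by (rule L2_mono[OF _ add.prems]) (use add in auto)
    ultimately show ?case using add by (intro approximable_add) auto
  next
    case (seq U)
    have U: "U i x \<le> v x" if "x \<in> space M" for i x
      using seq.hyps that by (intro incseq_le[of "\<lambda>i. U i x"]) (auto simp: incseq_def le_fun_def)
    show ?case
    proof (rule approximable_sequence[where f = U and w = v])
      show "approximable (U n)" for n
        by (rule seq.IH, rule L2_mono[OF _ seq.prems]) (use seq.hyps U in auto)
      show "\<bar>U n x\<bar> \<le> v x" if "x \<in> space M" for n x
        using U[OF that] seq.hyps by auto
    qed (use seq in auto)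
  qed
  have all: "approximable f" if f: "L2fun M f" for f
  proof -
    have [measurable]: "f \<in> borel_measurable M" using f by (simp add: L2fun_def)
    have abs: "L2fun M (\<lambda>x. \<bar>f x\<bar>)" using f by (simp add: L2fun_def)
    have "L2fun M (\<lambda>x. max 0 (f x))" by (rule L2_mono[OF _ abs]) auto
    then have "approximable (\<lambda>x. max 0 (f x))" by (intro nonneg) auto
    moreover have "L2fun M (\<lambda>x. max 0 (- f x))" by (rule L2_mono[OF _ abs]) auto
    then have "approximable (\<lambda>x. max 0 (- f x))" by (intro nonneg) auto
    ultimately have "approximable (\<lambda>x. max 0 (f x) + (-1) * max 0 (- f x))"
      by (intro approximable_add approximable_cmult)
    moreover have "(\<lambda>x. max 0 (f x) + (-1) * max 0 (- f x)) = f" by (auto simp: max_def)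
    ultimately show ?thesis by simp
  qed
  show ?thesis
  proof (rule that[of "gram_schmidt M u"])
    show "orthonormal_system M (gram_schmidt M u)" by unfold_locales
    show "gram_schmidt M u 0 = (\<lambda>_. 1)"
      by (subst gram_schmidt.simps) (simp add: u_def Let_def prob_space)
  qed (intro approximable_imp_parseval all)
qed

section \<open>Gaussian noise\<close>

text \<open>The index type is arbitrary because the sample space of \<open>pregaussian\<close>
  consists of real functions on a function type.\<close>

definition gauss_noise :: "('i \<Rightarrow> real) measure" where
  "gauss_noise = PiM UNIV (\<lambda>_. std_normal_distribution)"

lemma prob_space_std_normal: "prob_space std_normal_distribution"
  by (rule prob_space_normal_density) simp

lemma prob_space_gauss_noise: "prob_space gauss_noise"
  unfolding gauss_noise_def by (intro prob_space_PiM prob_space_std_normal)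

lemma measurable_gauss_noise_component [measurable]:
  "(\<lambda>\<omega>. \<omega> i) \<in> borel_measurable gauss_noise"
proof -
  have "(\<lambda>\<omega>. \<omega> i) \<in> gauss_noise \<rightarrow>\<^sub>M std_normal_distribution"
    unfolding gauss_noise_def by (rule measurable_component_singleton) simp
  then show ?thesis by (simp add: measurable_def)
qed

lemma distr_gauss_noise_component:
  "distr gauss_noise borel (\<lambda>\<omega>. \<omega> i) = std_normal_distribution"
proof -
  have "distr gauss_noise std_normal_distribution (\<lambda>\<omega>. \<omega> i) = std_normal_distribution"
    unfolding gauss_noise_def
    by (rule distr_PiM_component) (auto intro: prob_space_std_normal)
  moreover have "distr gauss_noise borel (\<lambda>\<omega>. \<omega> i) = distr gauss_noise std_normal_distribution (\<lambda>\<omega>. \<omega> i)"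
    by (rule distr_cong) auto
  ultimately show ?thesis by simp
qed

lemma indep_vars_gauss_noise:
  "prob_space.indep_vars gauss_noise (\<lambda>_. borel) (\<lambda>i \<omega>. \<omega> i) I"
proof -
  interpret prob_space gauss_noise by (rule prob_space_gauss_noise)
  have "indep_vars (\<lambda>_. borel) (\<lambda>i \<omega>. \<omega> i) (UNIV :: 'a set)"
  proof (subst indep_vars_iff_distr_eq_PiM')
    have *: "sets (PiM UNIV (\<lambda>_::'a. borel::real measure)) = sets (PiM UNIV (\<lambda>_::'a. std_normal_distribution))"
      by (rule sets_PiM_cong) auto
    show "distr gauss_noise (Pi\<^sub>M UNIV (\<lambda>_::'a. borel)) (\<lambda>x. \<lambda>i\<in>UNIV. x i) =
      (\<Pi>\<^sub>M i\<in>UNIV. distr gauss_noise borel (\<lambda>\<omega>. \<omega> i))"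
      unfolding distr_gauss_noise_component
      using * by (simp add: gauss_noise_def restrict_UNIV distr_id2)
  qed auto
  then show ?thesis by (rule indep_vars_subset) auto
qed

text \<open>Independence factors the characteristic function, so variances add. The map
  \<open>\<iota>\<close> selects distinct coordinates, and \<open>c'\<close> carries the
  coefficients to its image.\<close>

lemma char_gauss_noise_sum:
  fixes c :: "'j \<Rightarrow> real" and \<iota> :: "'j \<Rightarrow> 'i"
  assumes "finite J" and inj: "inj_on \<iota> J"
  shows "char (distr gauss_noise borel (\<lambda>\<omega>. \<Sum>j\<in>J. c j * \<omega> (\<iota> j))) t
    = complex_of_real (exp (- ((\<Sum>j\<in>J. (c j)\<^sup>2) * t\<^sup>2) / 2))"
proof -
  interpret prob_space "gauss_noise :: ('i \<Rightarrow> real) measure" by (rule prob_space_gauss_noise)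
  define c' where "c' = c \<circ> inv_into J \<iota>"
  have c': "c' (\<iota> j) = c j" if "j \<in> J" for j
    using that inj by (simp add: c'_def)
  have "indep_vars (\<lambda>_. borel) (\<lambda>i \<omega>. c' i * \<omega> i) (\<iota> ` J)"
    by (rule indep_vars_compose2[OF indep_vars_gauss_noise, where Y = "\<lambda>i x. c' i * x"]) simp
  then have "char (distr gauss_noise borel (\<lambda>\<omega>. \<Sum>i\<in>\<iota> ` J. c' i * \<omega> i)) t
      = (\<Prod>i\<in>\<iota> ` J. char (distr gauss_noise borel (\<lambda>\<omega>. c' i * \<omega> i)) t)"
    by (rule char_distr_sum)
  then have "char (distr gauss_noise borel (\<lambda>\<omega>. \<Sum>j\<in>J. c j * \<omega> (\<iota> j))) t
      = (\<Prod>j\<in>J. char (distr gauss_noise borel (\<lambda>\<omega>. c j * \<omega> (\<iota> j))) t)"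
    by (simp add: sum.reindex[OF inj] prod.reindex[OF inj] c')
  also have "\<dots> = (\<Prod>j\<in>J. char std_normal_distribution (t * c j))"
  proof (rule prod.cong)
    fix j
    have "char (distr gauss_noise borel (\<lambda>\<omega>. c j * \<omega> (\<iota> j))) t
       = char (distr gauss_noise borel (\<lambda>\<omega>. \<omega> (\<iota> j))) (t * c j)"
      by (simp add: char_def integral_distr mult.assoc)
    then show "char (distr gauss_noise borel (\<lambda>\<omega>. c j * \<omega> (\<iota> j))) t
       = char std_normal_distribution (t * c j)"
      by (simp add: distr_gauss_noise_component)
  qed simp
  also have "\<dots> = complex_of_real (\<Prod>j\<in>J. exp (- (t * c j)\<^sup>2 / 2))"
    by (simp add: char_std_normal_distribution)
  also have "(\<Prod>j\<in>J. exp (- (t * c j)\<^sup>2 / 2)) = exp (\<Sum>j\<in>J. - (t * c j)\<^sup>2 / 2)"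
    using assms by (simp add: exp_sum)
  also have "(\<Sum>j\<in>J. - (t * c j)\<^sup>2 / 2) = - ((\<Sum>j\<in>J. (c j)\<^sup>2) * t\<^sup>2) / 2"
    by (simp add: sum_distrib_left sum_distrib_right sum_divide_distrib sum_negf power_mult_distrib mult.commute)
  finally show ?thesis .
qed

lemma (in prob_space) std_normal_of_char:
  assumes [measurable]: "X \<in> borel_measurable M"
    and v: "v > 0" and char: "\<And>t. char (distr M borel X) t = complex_of_real (exp (- (v * t\<^sup>2) / 2))"
  shows "distr M borel (\<lambda>\<omega>. X \<omega> / sqrt v) = std_normal_distribution"
proof (rule Levy_uniqueness)
  show "real_distribution (distr M borel (\<lambda>\<omega>. X \<omega> / sqrt v))"
    by (rule real_distribution_distr) simp
  show "real_distribution std_normal_distribution"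
    by (rule real_dist_normal_dist)
  show "char (distr M borel (\<lambda>\<omega>. X \<omega> / sqrt v)) = char std_normal_distribution"
  proof
    fix t
    have "char (distr M borel (\<lambda>\<omega>. X \<omega> / sqrt v)) t = char (distr M borel X) (t / sqrt v)"
      by (simp add: char_def integral_distr)
    also have "\<dots> = char std_normal_distribution t"
      using v by (simp add: char char_std_normal_distribution power_divide)
    finally show "char (distr M borel (\<lambda>\<omega>. X \<omega> / sqrt v)) t = char std_normal_distribution t" .
  qed
qed

text \<open>Characteristic functions determine laws. For \<open>v = 0\<close> the law is the point
  mass at 0, which has no density; there the definition asks for vanishing almost surely.\<close>

lemma (in prob_space) centered_normal_rv_of_char:
  assumes [measurable]: "X \<in> borel_measurable M"
    and v: "v \<ge> 0" and char: "\<And>t. char (distr M borel X) t = complex_of_real (exp (- (v * t\<^sup>2) / 2))"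
  shows "centered_normal_rv M X v"
proof (cases "v = 0")
  case True
  have "distr M borel X = return borel 0"
  proof (rule Levy_uniqueness)
    interpret R: prob_space "return borel (0::real)" by (rule prob_space_return) simp
    show "real_distribution (return borel 0)"
      by unfold_locales auto
    show "char (distr M borel X) = char (return borel 0)"
      by (rule ext) (simp add: char True, simp add: char_def integral_return)
  qed (rule real_distribution_distr, simp)
  then have "AE x in distr M borel X. x = 0"
    by (simp only:) (simp add: AE_return)
  then have "AE \<omega> in M. X \<omega> = 0"
    by (subst (asm) AE_distr_iff) auto
  then show ?thesis
    using True by (simp add: centered_normal_rv_def)
next
  case False
  then have v: "v > 0" using v by simp
  have "distributed M lborel (\<lambda>\<omega>. X \<omega> / sqrt v) std_normal_density"
    unfolding distributed_def
    using std_normal_of_char[OF _ v char] by (auto cong: distr_cong)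
  then have "distributed M lborel X (normal_density 0 (sqrt v))"
    using normal_standard_normal_convert[of "sqrt v" X 0] v by simp
  then show ?thesis using v by (simp add: centered_normal_rv_def)
qed

definition normal_abs_moment :: "real \<Rightarrow> ennreal" where
  "normal_abs_moment r = (\<integral>\<^sup>+ x. ennreal (\<bar>x\<bar> powr r) \<partial>std_normal_distribution)"

text \<open>Dominated by 1 plus an even moment of order at least \<open>r\<close>.\<close>

lemma normal_abs_moment_finite:
  assumes "r \<ge> 0"
  shows "normal_abs_moment r < \<infinity>"
proof -
  interpret prob_space std_normal_distribution by (rule prob_space_std_normal)
  define n where "n = nat \<lceil>r\<rceil>"
  have n: "r \<le> real (2 * n)" unfolding n_def using assms by linarith
  have "normal_abs_moment r \<le> (\<integral>\<^sup>+ x. ennreal (1 + x ^ (2 * n)) \<partial>std_normal_distribution)"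
    unfolding normal_abs_moment_def
  proof (intro nn_integral_mono ennreal_leI)
    fix x :: real
    show "\<bar>x\<bar> powr r \<le> 1 + x ^ (2 * n)"
    proof (cases "\<bar>x\<bar> \<le> 1")
      case True
      then have "\<bar>x\<bar> powr r \<le> 1" using assms by (simp add: powr_le1)
      then show ?thesis by (simp add: add_increasing2)
    next
      case False
      then have "\<bar>x\<bar> powr r \<le> \<bar>x\<bar> powr real (2 * n)" using n by (intro powr_mono) auto
      also have "\<dots> = x ^ (2 * n)" using False by (subst powr_realpow) (auto simp: power_even_abs)
      finally show ?thesis by simp
    qed
  qed
  also have "\<dots> < \<infinity>"
  proof -
    have "integrable std_normal_distribution (\<lambda>x. 1 + x ^ (2 * n))"
      by (intro Bochner_Integration.integrable_add integrable_std_normal_distribution_moment) simp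
    then show ?thesis
      by (subst nn_integral_eq_integral) auto
  qed
  finally show ?thesis .
qed

text \<open>Dividing by the standard deviation \<open>sqrt v\<close> reduces to the standard normal
  law, except for \<open>v = 0\<close>.\<close>

lemma (in prob_space) nn_integral_powr_of_char:
  assumes [measurable]: "X \<in> borel_measurable M"
    and v: "v \<ge> 0" and char: "\<And>t. char (distr M borel X) t = complex_of_real (exp (- (v * t\<^sup>2) / 2))"
    and r: "r > 0"
  shows "(\<integral>\<^sup>+ \<omega>. ennreal (\<bar>X \<omega>\<bar> powr r) \<partial>M) = ennreal (v powr (r / 2)) * normal_abs_moment r"
proof (cases "v = 0")
  case True
  then have "AE \<omega> in M. X \<omega> = 0"
    using centered_normal_rv_of_char[OF _ v char] by (simp add: centered_normal_rv_def)
  then have "(\<integral>\<^sup>+ \<omega>. ennreal (\<bar>X \<omega>\<bar> powr r) \<partial>M) = (\<integral>\<^sup>+ \<omega>. 0 \<partial>M)"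
    by (intro nn_integral_cong_AE) auto
  then show ?thesis using True by simp
next
  case False
  then have v: "v > 0" using v by simp
  have "normal_abs_moment r = (\<integral>\<^sup>+ \<omega>. ennreal (\<bar>X \<omega> / sqrt v\<bar> powr r) \<partial>M)"
    unfolding normal_abs_moment_def
    by (subst std_normal_of_char[symmetric, OF _ v char]) (simp_all add: nn_integral_distr)
  then have "ennreal (v powr (r / 2)) * normal_abs_moment r
     = (\<integral>\<^sup>+ \<omega>. ennreal (v powr (r / 2)) * ennreal (\<bar>X \<omega> / sqrt v\<bar> powr r) \<partial>M)"
    by (simp add: nn_integral_cmult)
  also have "\<dots> = (\<integral>\<^sup>+ \<omega>. ennreal (\<bar>X \<omega>\<bar> powr r) \<partial>M)"
  proof (intro nn_integral_cong)
    fix \<omega>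
    have "v powr (r / 2) = sqrt v powr r"
      using v by (simp add: powr_half_sqrt[symmetric] powr_powr)
    then show "ennreal (v powr (r / 2)) * ennreal (\<bar>X \<omega> / sqrt v\<bar> powr r) = ennreal (\<bar>X \<omega>\<bar> powr r)"
      using v by (simp add: ennreal_mult[symmetric] powr_divide abs_divide)
  qed
  finally show ?thesis by simp
qed

lemma gauss_noise_moment:
  fixes c :: "'j \<Rightarrow> real" and \<iota> :: "'j \<Rightarrow> 'i"
  assumes "finite J" "inj_on \<iota> J" "r > 0"
  shows "(\<integral>\<^sup>+ \<omega>. ennreal (\<bar>\<Sum>i\<in>J. c i * \<omega> (\<iota> i)\<bar> powr r) \<partial>gauss_noise)
     = ennreal ((\<Sum>i\<in>J. (c i)\<^sup>2) powr (r / 2)) * normal_abs_moment r"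
proof -
  interpret prob_space "gauss_noise :: ('i \<Rightarrow> real) measure" by (rule prob_space_gauss_noise)
  show ?thesis
    by (rule nn_integral_powr_of_char) (use assms in \<open>auto simp: char_gauss_noise_sum sum_nonneg\<close>)
qed

text \<open>Real and imaginary part are real Gaussian sums of no larger variance. The factor
  \<open>2 powr r\<close> comes from bounding the modulus by twice the larger part, the extra 1 in
  the exponent from adding the two parts.\<close>

lemma gauss_noise_moment_complex:
  fixes c :: "'j \<Rightarrow> complex" and \<iota> :: "'j \<Rightarrow> 'i"
  assumes J: "finite J" "inj_on \<iota> J" and r: "r > 0"
  shows "(\<integral>\<^sup>+ \<omega>. ennreal (norm (\<Sum>i\<in>J. c i * complex_of_real (\<omega> (\<iota> i))) powr r) \<partial>gauss_noise)
     \<le> ennreal (2 powr (r + 1)) * normal_abs_moment r * ennreal ((\<Sum>i\<in>J. (norm (c i))\<^sup>2) powr (r / 2))"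
proof -
  let ?v = "\<Sum>i\<in>J. (norm (c i))\<^sup>2"
  have bound: "norm z powr r \<le> 2 powr r * \<bar>Re z\<bar> powr r + 2 powr r * \<bar>Im z\<bar> powr r" for z
  proof -
    have "norm z \<le> 2 * max \<bar>Re z\<bar> \<bar>Im z\<bar>"
      using cmod_le[of z] by linarith
    then have "norm z powr r \<le> (2 * max \<bar>Re z\<bar> \<bar>Im z\<bar>) powr r"
      using r by (intro powr_mono2) auto
    also have "\<dots> = 2 powr r * max \<bar>Re z\<bar> \<bar>Im z\<bar> powr r" by (simp add: powr_mult)
    also have "\<dots> \<le> 2 powr r * \<bar>Re z\<bar> powr r + 2 powr r * \<bar>Im z\<bar> powr r"
      by (auto simp: max_def)
    finally show ?thesis .
  qed
  have "(\<integral>\<^sup>+ \<omega>. ennreal (norm (\<Sum>i\<in>J. c i * complex_of_real (\<omega> (\<iota> i))) powr r) \<partial>gauss_noise)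
    \<le> (\<integral>\<^sup>+ \<omega>. ennreal (2 powr r) * ennreal (\<bar>\<Sum>i\<in>J. Re (c i) * \<omega> (\<iota> i)\<bar> powr r)
         + ennreal (2 powr r) * ennreal (\<bar>\<Sum>i\<in>J. Im (c i) * \<omega> (\<iota> i)\<bar> powr r) \<partial>gauss_noise)"
  proof (rule nn_integral_mono)
    fix \<omega> :: "'i \<Rightarrow> real"
    show "ennreal (norm (\<Sum>i\<in>J. c i * complex_of_real (\<omega> (\<iota> i))) powr r) \<le> ennreal (2 powr r) * ennreal (\<bar>\<Sum>i\<in>J. Re (c i) * \<omega> (\<iota> i)\<bar> powr r)
         + ennreal (2 powr r) * ennreal (\<bar>\<Sum>i\<in>J. Im (c i) * \<omega> (\<iota> i)\<bar> powr r)"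
      using bound[of "\<Sum>i\<in>J. c i * complex_of_real (\<omega> (\<iota> i))"]
      by (simp add: ennreal_mult[symmetric] ennreal_plus[symmetric] del: ennreal_plus)
  qed
  also have "\<dots> = ennreal (2 powr r) * (ennreal ((\<Sum>i\<in>J. (Re (c i))\<^sup>2) powr (r / 2)) * normal_abs_moment r)
      + ennreal (2 powr r) * (ennreal ((\<Sum>i\<in>J. (Im (c i))\<^sup>2) powr (r / 2)) * normal_abs_moment r)"
    by (simp add: nn_integral_add nn_integral_cmult gauss_noise_moment J r)
  also have "\<dots> \<le> ennreal (2 powr r) * (ennreal (?v powr (r / 2)) * normal_abs_moment r)
      + ennreal (2 powr r) * (ennreal (?v powr (r / 2)) * normal_abs_moment r)"
    by (intro add_mono mult_left_mono mult_right_mono ennreal_leI powr_mono2 sum_mono)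
      (use r in \<open>auto simp: cmod_power2 sum_nonneg\<close>)
  also have "\<dots> = ennreal (2 powr (r + 1)) * normal_abs_moment r * ennreal (?v powr (r / 2))"
    by (simp add: powr_add ennreal_mult mult_ac flip: mult_2)
  finally show ?thesis .
qed

section \<open>A chaining criterion\<close>

text \<open>Supplies the block boundaries of the random series. Convergence without a rate suffices,
  as boundaries may be placed as late as needed.\<close>

lemma sequence_with_fast_decay:
  fixes \<tau> :: "nat \<Rightarrow> ennreal"
  assumes lim: "\<tau> \<longlonglongrightarrow> 0" and fin: "\<tau> 1 < \<infinity>" and \<epsilon>: "\<And>n. \<epsilon> n > 0" "\<epsilon> 0 = 1"
  obtains a :: "nat \<Rightarrow> nat" and T :: real
  where "a 0 = 1" "mono a" "\<And>n. n \<le> a n" "T \<ge> 0" "\<And>n. \<tau> (a n) \<le> ennreal (T * \<epsilon> n)"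
proof -
  \<comment> \<open>The first boundary is prescribed as 1, so \<open>T\<close> has to cover
    \<open>\<tau> 1\<close>; the summand 1 keeps the targets \<open>T * \<epsilon> n\<close>
    positive.\<close>
  define T where "T = 1 + enn2real (\<tau> 1)"
  have T: "T \<ge> 1" by (simp add: T_def)
  have "\<exists>b. \<forall>m\<ge>b. \<tau> m \<le> ennreal (T * \<epsilon> n)" for n
  proof -
    have "0 < ennreal (T * \<epsilon> n)" using T \<epsilon>(1)[of n] by simp
    then have "\<forall>\<^sub>F m in sequentially. \<tau> m < ennreal (T * \<epsilon> n)"
      by (rule order_tendstoD(2)[OF lim])
    then show ?thesis by (auto simp: eventually_sequentially intro: less_imp_le)
  qed
  then obtain b where b: "\<And>n m. m \<ge> b n \<Longrightarrow> \<tau> m \<le> ennreal (T * \<epsilon> n)" by metis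
  \<comment> \<open>Summing the thresholds makes the boundaries monotone while each exceeds its own
    threshold.\<close>
  define a where "a n = (if n = 0 then 1 else n + 1 + (\<Sum>i\<le>n. b i))" for n
  show ?thesis
  proof (rule that[of a T])
    show "a 0 = 1" by (simp add: a_def)
    have "a n \<le> a (Suc n)" for n by (auto simp: a_def)
    then show "mono a" by (simp add: mono_iff_le_Suc)
    show "n \<le> a n" for n by (simp add: a_def)
    show "T \<ge> 0" using T by simp
    show "\<tau> (a n) \<le> ennreal (T * \<epsilon> n)" for n
    proof (cases "n = 0")
      case True
      have "\<tau> 1 = ennreal (enn2real (\<tau> 1))" using fin by simp
      also have "\<dots> \<le> ennreal T" by (intro ennreal_leI) (simp add: T_def)
      finally show ?thesis using True \<epsilon>(2) by (simp add: a_def)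
    next
      case False
      have "b n \<le> (\<Sum>i\<le>n. b i)" by (rule member_le_sum) auto
      then show ?thesis using False by (intro b) (simp add: a_def)
    qed
  qed
qed

text \<open>The probabilistic argument, freed of Besov spaces: \<open>F\<close> is controlled
  through a family of kernels \<open>\<kappa>\<close> over a measure space \<open>N\<close>. The
  condition on \<open>e 0\<close> allows centring by dropping one index, and \<open>parseval\<close>
  identifies the covariance.\<close>

locale gaussian_chaining = orthonormal_system P e for P :: "'x measure" and e +
  fixes F :: "('x \<Rightarrow> real) set" and N :: "'b measure" and \<kappa> :: "'b \<Rightarrow> 'x \<Rightarrow> complex"
    and r C :: real
  assumes e_0: "e 0 = (\<lambda>_. 1)"
    and parseval: "L2fun P f \<Longrightarrow> (\<lambda>j. (\<integral>x. f x * e j x \<partial>P)\<^sup>2) sums (\<integral>x. (f x)\<^sup>2 \<partial>P)"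
    and F_L2: "f \<in> F \<Longrightarrow> L2fun P f"
    and sigma_finite_N: "sigma_finite_measure N"
    and measurable_\<kappa> [measurable]: "(\<lambda>(z, x). \<kappa> z x) \<in> borel_measurable (N \<Otimes>\<^sub>M P)"
    and \<kappa>_L2: "z \<in> space N \<Longrightarrow> integrable P (\<lambda>x. (norm (\<kappa> z x))\<^sup>2)"
    and r: "r > 0"
    and \<kappa>_finite: "(\<integral>\<^sup>+ z. ennreal ((\<integral>x. (norm (\<kappa> z x))\<^sup>2 \<partial>P) powr (r / 2)) \<partial>N) < \<infinity>"
    and C: "C \<ge> 0"
    and duality_bound: "f \<in> F \<Longrightarrow> finite J \<Longrightarrow>
      ennreal \<bar>\<integral>x. f x * (\<Sum>j\<in>J. a j * e j x) \<partial>P\<bar> \<le>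
        ennreal C * (1 + (\<integral>\<^sup>+ z. ennreal (norm (\<integral>x. \<kappa> z x * complex_of_real (\<Sum>j\<in>J. a j * e j x) \<partial>P) powr r) \<partial>N))"
begin

definition coef :: "'b \<Rightarrow> nat \<Rightarrow> complex" where
  "coef z j = (\<integral>x. \<kappa> z x * complex_of_real (e j x) \<partial>P)"

sublocale N: sigma_finite_measure N by (rule sigma_finite_N)

lemma measurable_coef [measurable]: "(\<lambda>z. coef z j) \<in> borel_measurable N"
  unfolding coef_def by measurable

lemma measurable_\<kappa>_section [measurable]: "z \<in> space N \<Longrightarrow> \<kappa> z \<in> borel_measurable P"
  using measurable_compose[OF measurable_Pair1' measurable_\<kappa>, of z] by simp

lemma summable_coef: "z \<in> space N \<Longrightarrow> summable (\<lambda>j. (norm (coef z j))\<^sup>2)"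
  unfolding coef_def
  by (intro bounded_imp_summable bessel_complex[THEN order_trans, OF _ \<kappa>_L2]
      zero_le_power2 measurable_\<kappa>_section) (auto simp flip: lessThan_Suc_atMost)

text \<open>Up to the factor \<open>K\<close>, a bound for the expected
  \<open>noise_integral\<close> of every finite index set beyond \<open>m\<close>.\<close>

definition tail :: "nat \<Rightarrow> ennreal" where
  "tail m = (\<integral>\<^sup>+ z. ennreal ((\<Sum>j. (norm (coef z (j + m)))\<^sup>2) powr (r / 2)) \<partial>N)"

lemma coef_tail_le:
  assumes "z \<in> space N"
  shows "(\<Sum>j. (norm (coef z (j + m)))\<^sup>2) \<le> (\<integral>x. (norm (\<kappa> z x))\<^sup>2 \<partial>P)"
proof (rule suminf_le_const)
  show "summable (\<lambda>j. (norm (coef z (j + m)))\<^sup>2)"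
    using summable_coef[OF assms] by (rule summable_ignore_initial_segment)
  fix n
  have "(\<Sum>j<n. (norm (coef z (j + m)))\<^sup>2) = (\<Sum>j\<in>(\<lambda>j. j + m) ` {..<n}. (norm (coef z j))\<^sup>2)"
    by (subst sum.reindex) auto
  also have "\<dots> \<le> (\<integral>x. (norm (\<kappa> z x))\<^sup>2 \<partial>P)"
    unfolding coef_def using assms by (intro bessel_complex \<kappa>_L2 measurable_\<kappa>_section) auto
  finally show "(\<Sum>j<n. (norm (coef z (j + m)))\<^sup>2) \<le> (\<integral>x. (norm (\<kappa> z x))\<^sup>2 \<partial>P)" .
qed

lemma tail_finite: "tail m < \<infinity>"
proof -
  have "tail m \<le> (\<integral>\<^sup>+ z. ennreal ((\<integral>x. (norm (\<kappa> z x))\<^sup>2 \<partial>P) powr (r / 2)) \<partial>N)"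
    unfolding tail_def using r
    by (intro nn_integral_mono ennreal_leI powr_mono2 coef_tail_le suminf_nonneg
        summable_ignore_initial_segment summable_coef) auto
  with \<kappa>_finite show ?thesis by (rule le_less_trans[rotated])
qed

text \<open>For fixed \<open>z\<close> this is the remainder of a convergent series; Bessel's
  inequality and \<open>\<kappa>_finite\<close> provide the majorant.\<close>

lemma tail_tendsto_0: "tail \<longlonglongrightarrow> 0"
proof -
  have "tail \<longlonglongrightarrow> (\<integral>\<^sup>+ z. 0 \<partial>N)"
    unfolding tail_def
  proof (rule nn_integral_dominated_convergence[OF _ _ _ _ \<kappa>_finite])
    show "AE z in N. ennreal ((\<Sum>j. (norm (coef z (j + m)))\<^sup>2) powr (r / 2))
       \<le> ennreal ((\<integral>x. (norm (\<kappa> z x))\<^sup>2 \<partial>P) powr (r / 2))" for m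
      using r
      by (intro AE_I2 ennreal_leI powr_mono2 coef_tail_le suminf_nonneg
        summable_ignore_initial_segment summable_coef) auto
    show "AE z in N. (\<lambda>m. ennreal ((\<Sum>j. (norm (coef z (j + m)))\<^sup>2) powr (r / 2))) \<longlonglongrightarrow> 0"
    proof (rule AE_I2)
      fix z assume "z \<in> space N"
      then have "(\<lambda>m. \<Sum>j. (norm (coef z (j + m)))\<^sup>2) \<longlonglongrightarrow> 0"
        using suminf_exist_split2[OF summable_coef] by simp
      then have "(\<lambda>m. (\<Sum>j. (norm (coef z (j + m)))\<^sup>2) powr (r / 2)) \<longlonglongrightarrow> 0"
        using r \<open>z \<in> space N\<close> by (intro tendsto_zero_powrI[where b = "r / 2"])
          (auto intro!: always_eventually suminf_nonneg summable_ignore_initial_segment summable_coef)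
      then show "(\<lambda>m. ennreal ((\<Sum>j. (norm (coef z (j + m)))\<^sup>2) powr (r / 2))) \<longlonglongrightarrow> 0"
        by (simp add: tendsto_ennreal_iff flip: ennreal_0)
    qed
  qed measurable
  then show ?thesis by simp
qed

text \<open>Coordinates at constant functions: infinitely many distinct indices that exist for every
  type \<open>'x\<close>.\<close>

definition \<xi> :: "nat \<Rightarrow> (('x \<Rightarrow> real) \<Rightarrow> real) \<Rightarrow> real" where
  "\<xi> j \<omega> = \<omega> (\<lambda>_. real j)"

lemma inj_const: "inj_on (\<lambda>j (_::'x). real j) J"
  by (auto simp: inj_on_def fun_eq_iff)

lemma measurable_\<xi> [measurable]: "\<xi> j \<in> borel_measurable gauss_noise"
  unfolding \<xi>_def by measurable

text \<open>The integral in \<open>duality_bound\<close> for the test function with random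
  coefficients \<open>\<xi> j \<omega>\<close>.\<close>

definition noise_integral :: "nat set \<Rightarrow> (('x \<Rightarrow> real) \<Rightarrow> real) \<Rightarrow> ennreal" where
  "noise_integral J \<omega> = (\<integral>\<^sup>+ z. ennreal (norm (\<Sum>j\<in>J. coef z j * complex_of_real (\<xi> j \<omega>)) powr r) \<partial>N)"

lemma measurable_noise_integral [measurable]: "noise_integral J \<in> borel_measurable gauss_noise"
  unfolding noise_integral_def by measurable

definition K :: ennreal where "K = ennreal (2 powr (r + 1)) * normal_abs_moment r"

lemma K_finite: "K < \<infinity>"
  unfolding K_def using normal_abs_moment_finite[of r] r by (simp add: ennreal_mult_less_top)

text \<open>Fubini takes the expectation for each \<open>z\<close> separately; there the sum is
  Gaussian, and its squared coefficients are part of the remainder in \<open>tail m\<close>.\<close>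

lemma nn_integral_noise_integral:
  assumes "finite J" and J: "J \<subseteq> {m..}"
  shows "(\<integral>\<^sup>+ \<omega>. noise_integral J \<omega> \<partial>gauss_noise) \<le> K * tail m"
proof -
  interpret gauss: prob_space "gauss_noise :: (('x \<Rightarrow> real) \<Rightarrow> real) measure"
    by (rule prob_space_gauss_noise)
  interpret pair_sigma_finite "gauss_noise :: (('x \<Rightarrow> real) \<Rightarrow> real) measure" N ..
  have "(\<integral>\<^sup>+ \<omega>. noise_integral J \<omega> \<partial>gauss_noise) =
    (\<integral>\<^sup>+ z. \<integral>\<^sup>+ \<omega>. ennreal (norm (\<Sum>j\<in>J. coef z j * complex_of_real (\<xi> j \<omega>)) powr r) \<partial>gauss_noise \<partial>N)"
    unfolding noise_integral_def by (rule Fubini'[symmetric]) measurable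
  also have "\<dots> \<le> (\<integral>\<^sup>+ z. K * ennreal ((\<Sum>j. (norm (coef z (j + m)))\<^sup>2) powr (r / 2)) \<partial>N)"
  proof (rule nn_integral_mono)
    fix z assume z: "z \<in> space N"
    have "(\<Sum>j\<in>J. (norm (coef z j))\<^sup>2) = (\<Sum>j\<in>(\<lambda>j. j - m) ` J. (norm (coef z (j + m)))\<^sup>2)"
    proof (subst sum.reindex)
      show "inj_on (\<lambda>j. j - m) J"
        using J by (auto simp: inj_on_def subset_iff) (metis le_add_diff_inverse2)
    qed (use J in \<open>auto simp: subset_iff intro!: sum.cong\<close>)
    also have "\<dots> \<le> (\<Sum>j. (norm (coef z (j + m)))\<^sup>2)"
      using assms by (intro sum_le_suminf summable_ignore_initial_segment summable_coef z) auto
    finally have le: "(\<Sum>j\<in>J. (norm (coef z j))\<^sup>2) \<le> (\<Sum>j. (norm (coef z (j + m)))\<^sup>2)" .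
    have "(\<integral>\<^sup>+ \<omega>. ennreal (norm (\<Sum>j\<in>J. coef z j * complex_of_real (\<xi> j \<omega>)) powr r) \<partial>gauss_noise)
       \<le> K * ennreal ((\<Sum>j\<in>J. (norm (coef z j))\<^sup>2) powr (r / 2))"
      unfolding \<xi>_def K_def by (rule gauss_noise_moment_complex[OF assms(1) inj_const r])
    also have "\<dots> \<le> K * ennreal ((\<Sum>j. (norm (coef z (j + m)))\<^sup>2) powr (r / 2))"
      using le r by (intro mult_left_mono ennreal_leI powr_mono2) (auto intro: sum_nonneg)
    finally show "(\<integral>\<^sup>+ \<omega>. ennreal (norm (\<Sum>j\<in>J. coef z j * complex_of_real (\<xi> j \<omega>)) powr r) \<partial>gauss_noise)
       \<le> K * ennreal ((\<Sum>j. (norm (coef z (j + m)))\<^sup>2) powr (r / 2))" .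
  qed
  also have "\<dots> = K * tail m"
    unfolding tail_def by (rule nn_integral_cmult) measurable
  finally show ?thesis .
qed

definition block :: "nat set \<Rightarrow> ('x \<Rightarrow> real) \<Rightarrow> (('x \<Rightarrow> real) \<Rightarrow> real) \<Rightarrow> real" where
  "block J f \<omega> = (\<Sum>j\<in>J. (\<integral>x. f x * e j x \<partial>P) * \<xi> j \<omega>)"

lemma measurable_block [measurable]: "block J f \<in> borel_measurable gauss_noise"
  unfolding block_def by measurable

text \<open>The duality bound is not homogeneous in the test function; applying it to the multiple \<open>t h\<close>
  and dividing by \<open>t\<close> makes the constant term small.\<close>
lemma block_bound:
  assumes f: "f \<in> F" and J: "finite J" and t: "t > 0"
  shows "ennreal \<bar>block J f \<omega>\<bar> \<le> ennreal (C / t) * (1 + ennreal (t powr r) * noise_integral J \<omega>)"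
proof -
  define h where "h x = (\<Sum>j\<in>J. (t * \<xi> j \<omega>) * e j x)" for x
  have "(\<integral>x. f x * h x \<partial>P) = (\<integral>x. (\<Sum>j\<in>J. (t * \<xi> j \<omega>) * (f x * e j x)) \<partial>P)"
    by (simp add: h_def sum_distrib_left mult_ac)
  also have "\<dots> = (\<Sum>j\<in>J. (t * \<xi> j \<omega>) * (\<integral>x. f x * e j x \<partial>P))"
    by (subst Bochner_Integration.integral_sum)
      (intro integrable_mult_right L2fun_mult L2_e F_L2 f, simp only: integral_mult_right_zero)
  also have "\<dots> = t * block J f \<omega>"
    by (simp add: block_def sum_distrib_left mult_ac)
  finally have f_h: "(\<integral>x. f x * h x \<partial>P) = t * block J f \<omega>" .
  have \<kappa>_h: "(\<integral>x. \<kappa> z x * complex_of_real (h x) \<partial>P) = of_real t * (\<Sum>j\<in>J. coef z j * complex_of_real (\<xi> j \<omega>))"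
    if z: "z \<in> space N" for z
  proof -
    have int: "integrable P (\<lambda>x. \<kappa> z x * complex_of_real (e j x))" for j
      by (rule integrable_mult_square) (use z \<kappa>_L2 L2fun_square[OF L2_e] in auto)
    have "(\<integral>x. \<kappa> z x * complex_of_real (h x) \<partial>P)
      = (\<integral>x. (\<Sum>j\<in>J. complex_of_real (t * \<xi> j \<omega>) * (\<kappa> z x * complex_of_real (e j x))) \<partial>P)"
      by (simp add: h_def sum_distrib_left mult_ac)
    also have "\<dots> = (\<Sum>j\<in>J. complex_of_real (t * \<xi> j \<omega>) * (\<integral>x. \<kappa> z x * complex_of_real (e j x) \<partial>P))"
      by (subst Bochner_Integration.integral_sum)
        (intro integrable_mult_right int, simp only: integral_mult_right_zero)
    also have "\<dots> = of_real t * (\<Sum>j\<in>J. coef z j * complex_of_real (\<xi> j \<omega>))"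
      by (simp add: coef_def sum_distrib_left mult_ac)
    finally show ?thesis .
  qed
  have "ennreal t * ennreal \<bar>block J f \<omega>\<bar> = ennreal \<bar>\<integral>x. f x * h x \<partial>P\<bar>"
    using t by (simp add: f_h abs_mult ennreal_mult)
  also have "\<dots> \<le> ennreal C * (1 + (\<integral>\<^sup>+ z. ennreal (norm (\<integral>x. \<kappa> z x * complex_of_real (h x) \<partial>P) powr r) \<partial>N))"
    unfolding h_def by (rule duality_bound[OF f J])
  also have "(\<integral>\<^sup>+ z. ennreal (norm (\<integral>x. \<kappa> z x * complex_of_real (h x) \<partial>P) powr r) \<partial>N)
    = (\<integral>\<^sup>+ z. ennreal (t powr r) * ennreal (norm (\<Sum>j\<in>J. coef z j * complex_of_real (\<xi> j \<omega>)) powr r) \<partial>N)"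
    using t by (intro nn_integral_cong) (simp add: \<kappa>_h norm_mult powr_mult ennreal_mult)
  also have "\<dots> = ennreal (t powr r) * noise_integral J \<omega>"
    unfolding noise_integral_def by (rule nn_integral_cmult) measurable
  finally have *: "ennreal t * ennreal \<bar>block J f \<omega>\<bar> \<le> ennreal C * (1 + ennreal (t powr r) * noise_integral J \<omega>)" .
  have "ennreal \<bar>block J f \<omega>\<bar> = ennreal (1 / t) * (ennreal t * ennreal \<bar>block J f \<omega>\<bar>)"
    using t by (simp add: mult.assoc[symmetric] ennreal_mult[symmetric])
  also have "\<dots> \<le> ennreal (1 / t) * (ennreal C * (1 + ennreal (t powr r) * noise_integral J \<omega>))"
    by (intro mult_left_mono *) simp
  also have "\<dots> = ennreal (C / t) * (1 + ennreal (t powr r) * noise_integral J \<omega>)"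
    using t C by (simp add: mult.assoc[symmetric] ennreal_mult[symmetric])
  finally show ?thesis .
qed

text \<open>For \<open>j \<noteq> 0\<close> the vector \<open>e j\<close> is orthogonal to
  constants, so centring leaves the coefficients unchanged; each coefficient of the centred
  difference is at most its L^2 norm \<open>bb_rho\<close>.\<close>

lemma block_lipschitz:
  assumes f: "f \<in> F" and g: "g \<in> F" and J: "finite J" "0 \<notin> J"
  shows "\<bar>block J f \<omega> - block J g \<omega>\<bar> \<le> bb_rho P f g * (\<Sum>j\<in>J. \<bar>\<xi> j \<omega>\<bar>)"
proof -
  define u where "u x = (f x - (\<integral>y. f y \<partial>P)) - (g x - (\<integral>y. g y \<partial>P))" for x
  have u: "L2fun P u"
    unfolding u_def by (intro L2fun_diff L2fun_const F_L2 f g)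
  have coef_u: "(\<integral>x. f x * e j x \<partial>P) - (\<integral>x. g x * e j x \<partial>P) = (\<integral>x. u x * e j x \<partial>P)" if "j \<in> J" for j
  proof -
    have "j \<noteq> 0" using that J by metis
    then have e_mean: "(\<integral>x. e j x \<partial>P) = 0" using orthogonal[of 0 j] by (simp add: e_0)
    have "(\<integral>x. u x * e j x \<partial>P) = (\<integral>x. f x * e j x - g x * e j x + ((\<integral>y. g y \<partial>P) - (\<integral>y. f y \<partial>P)) * e j x \<partial>P)"
      unfolding u_def by (intro Bochner_Integration.integral_cong) (auto simp: algebra_simps)
    also have "\<dots> = (\<integral>x. f x * e j x \<partial>P) - (\<integral>x. g x * e j x \<partial>P)"
      using L2fun_mult[OF F_L2[OF f] L2_e[of j]] L2fun_mult[OF F_L2[OF g] L2_e[of j]] L2fun_integrable[OF L2_e[of j]]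
      by (simp add: e_mean)
    finally show ?thesis by simp
  qed
  have "block J f \<omega> - block J g \<omega> = (\<Sum>j\<in>J. (\<integral>x. u x * e j x \<partial>P) * \<xi> j \<omega>)"
    unfolding block_def by (simp add: coef_u[symmetric] left_diff_distrib sum_subtractf)
  also have "\<bar>\<dots>\<bar> \<le> (\<Sum>j\<in>J. \<bar>\<integral>x. u x * e j x \<partial>P\<bar> * \<bar>\<xi> j \<omega>\<bar>)"
    by (rule order_trans[OF sum_abs]) (simp add: abs_mult)
  also have "\<dots> \<le> (\<Sum>j\<in>J. bb_rho P f g * \<bar>\<xi> j \<omega>\<bar>)"
  proof (intro sum_mono mult_right_mono)
    fix j
    have "(\<integral>x. u x * e j x \<partial>P)\<^sup>2 \<le> (\<integral>x. (u x)\<^sup>2 \<partial>P)"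
      using bessel[OF u, of "{j}"] by simp
    then show "\<bar>\<integral>x. u x * e j x \<partial>P\<bar> \<le> bb_rho P f g"
      unfolding bb_rho_def u_def[symmetric] using real_le_rsqrt by fastforce
  qed simp
  finally show ?thesis by (simp add: sum_distrib_left)
qed

text \<open>Dropping index 0 subtracts the squared mean and turns the second moment into the
  variance.\<close>

lemma parseval_centered:
  assumes f: "L2fun P f"
  shows "(\<lambda>j. (\<integral>x. f x * e (Suc j) x \<partial>P)\<^sup>2) sums (\<integral>x. (f x - (\<integral>y. f y \<partial>P))\<^sup>2 \<partial>P)"
proof -
  have "(\<lambda>j. (\<integral>x. f x * e (Suc j) x \<partial>P)\<^sup>2) sums ((\<integral>x. (f x)\<^sup>2 \<partial>P) - (\<integral>x. f x * e 0 x \<partial>P)\<^sup>2)"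
    using parseval[OF f] by (subst sums_Suc_iff) simp
  also have "(\<integral>x. (f x)\<^sup>2 \<partial>P) - (\<integral>x. f x * e 0 x \<partial>P)\<^sup>2 = variance f"
    using variance_eq[OF L2fun_integrable[OF f] L2fun_square[OF f]] by (simp add: e_0)
  finally show ?thesis .
qed

text \<open>By bilinearity the quadratic form is the variance of one function, to which Parseval's
  identity applies.\<close>

lemma bb_cov_sum:
  fixes a :: "('x \<Rightarrow> real) \<Rightarrow> real"
  assumes "finite S" "S \<subseteq> F"
  defines "h \<equiv> (\<lambda>x. \<Sum>f\<in>S. a f * f x)"
  shows "(\<Sum>f\<in>S. \<Sum>g\<in>S. a f * a g * bb_cov P f g) = (\<integral>x. (h x - (\<integral>y. h y \<partial>P))\<^sup>2 \<partial>P)"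
proof -
  have L2: "L2fun P f" if "f \<in> S" for f using that assms F_L2 by auto
  define c where "c f x = f x - (\<integral>y. f y \<partial>P)" for f :: "'x \<Rightarrow> real" and x
  have c: "L2fun P (c f)" if "f \<in> S" for f
    unfolding c_def using that by (intro L2fun_diff L2fun_const L2)
  have "(\<integral>y. h y \<partial>P) = (\<Sum>f\<in>S. a f * (\<integral>y. f y \<partial>P))"
    unfolding h_def by (simp add: Bochner_Integration.integral_sum L2 L2fun_integrable)
  then have "h x - (\<integral>y. h y \<partial>P) = (\<Sum>f\<in>S. a f * c f x)" for x
    by (simp add: h_def c_def right_diff_distrib sum_subtractf)
  then have "(\<integral>x. (h x - (\<integral>y. h y \<partial>P))\<^sup>2 \<partial>P) = (\<integral>x. (\<Sum>f\<in>S. \<Sum>g\<in>S. (a f * a g) * (c f x * c g x)) \<partial>P)"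
    by (simp add: power2_eq_square sum_product mult_ac)
  also have "\<dots> = (\<Sum>f\<in>S. \<Sum>g\<in>S. a f * a g * (\<integral>x. c f x * c g x \<partial>P))"
    by (simp add: Bochner_Integration.integral_sum Bochner_Integration.integrable_sum L2fun_mult c)
  finally show ?thesis by (simp add: bb_cov_def c_def)
qed

theorem pregaussian: "pregaussian P F"
proof -
  interpret gauss: prob_space "gauss_noise :: (('x \<Rightarrow> real) \<Rightarrow> real) measure"
    by (rule prob_space_gauss_noise)
  \<comment> \<open>Chosen to cancel the factor \<open>(2 ^ n) powr r\<close> that
    \<open>block_bound\<close> produces with \<open>t = 2 ^ n\<close>.\<close>
  define \<epsilon> where "\<epsilon> n = (1 / 2 ^ n) powr r" for n :: nat
  have \<epsilon>: "\<epsilon> n > 0" "\<epsilon> 0 = 1" for n by (simp_all add: \<epsilon>_def)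
  obtain a T where a: "a 0 = 1" "mono a" "\<And>n. n \<le> a n" and T: "T \<ge> 0"
    and tail_a: "\<And>n. tail (a n) \<le> ennreal (T * \<epsilon> n)"
    by (rule sequence_with_fast_decay[of tail \<epsilon>, OF tail_tendsto_0 tail_finite \<epsilon>]) blast
  \<comment> \<open>Since \<open>a 0 = 1\<close>, index 0 lies in no block; this is what centres the
    process.\<close>
  define J where "J n = {a n..<a (Suc n)}" for n
  have J: "finite (J n)" "0 \<notin> J n" "J n \<subseteq> {a n..}" for n
    using monoD[OF a(2), of 0 n] a(1) by (auto simp: J_def)
  have J_Union: "(\<Sum>i<n. sum g (J i)) = sum g {1..<a n}" for n and g :: "nat \<Rightarrow> real"
  proof (induction n)
    case (Suc n)
    have "a 0 \<le> a n" "a n \<le> a (Suc n)" using a(2) by (auto intro: monoD)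
    then show ?case using Suc a(1) by (simp add: J_def sum.atLeastLessThan_concat)
  qed (simp add: a(1))

  \<comment> \<open>A bound uniform over \<open>F\<close> with expectation of order 2^(-n). Unlike a
    supremum over a possibly uncountable \<open>F\<close>, it is measurable by construction.\<close>
  define S where "S n \<omega> = ennreal (C / 2 ^ n) * (1 + ennreal ((2 ^ n) powr r) * noise_integral (J n) \<omega>)" for n \<omega>
  have S_meas [measurable]: "S n \<in> borel_measurable gauss_noise" for n
    unfolding S_def by measurable
  have block_le_S: "ennreal \<bar>block (J n) f \<omega>\<bar> \<le> S n \<omega>" if "f \<in> F" for f n \<omega>
    unfolding S_def by (rule block_bound[OF that J(1)]) simp
  have "(\<integral>\<^sup>+ \<omega>. (\<Sum>n. S n \<omega>) \<partial>gauss_noise) < \<infinity>"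
  proof -
    obtain K' where K': "K = ennreal K'" "K' \<ge> 0"
      using K_finite by (metis enn2real_nonneg ennreal_enn2real_if infinity_ennreal_def less_irrefl)
    have "(\<integral>\<^sup>+ \<omega>. (\<Sum>n. S n \<omega>) \<partial>gauss_noise) = (\<Sum>n. \<integral>\<^sup>+ \<omega>. S n \<omega> \<partial>gauss_noise)"
      by (rule nn_integral_suminf) measurable
    also have "\<dots> \<le> (\<Sum>n. ennreal (C * (1 + K' * T) * (1 / 2) ^ n))"
    proof (rule suminf_le)
      fix n
      have "(\<integral>\<^sup>+ \<omega>. S n \<omega> \<partial>gauss_noise)
         = ennreal (C / 2 ^ n) * (1 + ennreal ((2 ^ n) powr r) * (\<integral>\<^sup>+ \<omega>. noise_integral (J n) \<omega> \<partial>gauss_noise))"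
        unfolding S_def by (simp add: nn_integral_cmult nn_integral_add gauss.emeasure_space_1)
      also have "\<dots> \<le> ennreal (C / 2 ^ n) * (1 + ennreal ((2 ^ n) powr r) * (ennreal K' * ennreal (T * \<epsilon> n)))"
        unfolding K'(1)[symmetric]
        by (intro mult_left_mono add_left_mono nn_integral_noise_integral[OF J(1) J(3), THEN order_trans] tail_a) auto
      also have "\<dots> = ennreal (C / 2 ^ n * (1 + (2 ^ n) powr r * (K' * (T * \<epsilon> n))))"
        using C K' T less_imp_le[OF \<epsilon>(1)[of n]]
        by (simp add: ennreal_mult ennreal_plus del: times_divide_eq_left)
      also have "(2 ^ n) powr r * (K' * (T * \<epsilon> n)) = K' * T"
        by (simp add: \<epsilon>_def powr_divide)
      finally show "(\<integral>\<^sup>+ \<omega>. S n \<omega> \<partial>gauss_noise) \<le> ennreal (C * (1 + K' * T) * (1 / 2) ^ n)"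
        by (simp add: power_divide)
    qed auto
    also have "\<dots> < \<infinity>"
    proof -
      have "summable (\<lambda>n. C * (1 + K' * T) * (1 / 2) ^ n)"
        by (intro summable_mult summable_geometric) auto
      then show ?thesis
        using C K' T by (subst suminf_ennreal2) auto
    qed
    finally show ?thesis .
  qed
  then have good_AE: "AE \<omega> in gauss_noise. (\<Sum>n. S n \<omega>) < \<infinity>"
    using nn_integral_PInf_AE[of "\<lambda>\<omega>. \<Sum>n. S n \<omega>" gauss_noise] by (auto simp: less_top)

  define good where "good \<omega> \<longleftrightarrow> (\<Sum>n. S n \<omega>) < \<infinity>" for \<omega>
  have [measurable]: "Measurable.pred gauss_noise good"
    unfolding good_def by measurable
  define s where "s n \<omega> = enn2real (S n \<omega>)" for n \<omega>
  have s_summable: "summable (\<lambda>n. s n \<omega>)" and S_eq: "S n \<omega> = ennreal (s n \<omega>)" if "good \<omega>" for n \<omega>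
  proof -
    have "S n \<omega> < \<infinity>" for n
      using that sum_le_suminf[of "\<lambda>n. S n \<omega>" "{n}"] by (auto simp: good_def)
    then show S_eq: "S n \<omega> = ennreal (s n \<omega>)" for n by (simp add: s_def)
    show "summable (\<lambda>n. s n \<omega>)"
    proof (rule summable_suminf_not_top)
      show "(\<Sum>n. ennreal (s n \<omega>)) \<noteq> \<top>"
        using that unfolding good_def S_eq by simp
    qed (simp add: s_def)
  qed
  have s_nonneg: "s n \<omega> \<ge> 0" for n \<omega> by (simp add: s_def)
  have block_le: "\<bar>block (J n) f \<omega>\<bar> \<le> s n \<omega>" if "f \<in> F" "good \<omega>" for f n \<omega>
    using block_le_S[OF that(1), of n \<omega>] by (simp add: S_eq[OF that(2)] s_nonneg)

  \<comment> \<open>The value 0 off \<open>good\<close> makes the path properties hold at every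
    sample point and changes nothing almost surely.\<close>
  define G where "G f \<omega> = (if good \<omega> then \<Sum>n. block (J n) f \<omega> else 0)" for f \<omega>
  have G_meas [measurable]: "G f \<in> borel_measurable gauss_noise" for f
    unfolding G_def by measurable
  have block_summable: "summable (\<lambda>n. block (J n) f \<omega>)" if "f \<in> F" "good \<omega>" for f \<omega>
    by (rule summable_comparison_test'[OF s_summable[OF that(2)]]) (use block_le[OF that] in auto)
  have G_tail: "\<bar>G f \<omega> - (\<Sum>n<m. block (J n) f \<omega>)\<bar> \<le> (\<Sum>n. s (n + m) \<omega>)" if "f \<in> F" "good \<omega>" for f \<omega> m
  proof -
    have "G f \<omega> - (\<Sum>n<m. block (J n) f \<omega>) = (\<Sum>n. block (J (n + m)) f \<omega>)"
      unfolding G_def using that suminf_minus_initial_segment[OF block_summable[OF that]] by simp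
    also have "\<bar>\<dots>\<bar> \<le> (\<Sum>n. s (n + m) \<omega>)"
    proof -
      have s: "summable (\<lambda>n. s (n + m) \<omega>)"
        using s_summable[OF that(2)] by (rule summable_ignore_initial_segment)
      have abs: "summable (\<lambda>n. \<bar>block (J (n + m)) f \<omega>\<bar>)"
        by (rule summable_comparison_test'[OF s]) (simp add: block_le that)
      have "\<bar>\<Sum>n. block (J (n + m)) f \<omega>\<bar> \<le> (\<Sum>n. \<bar>block (J (n + m)) f \<omega>\<bar>)"
        by (rule summable_rabs[OF abs])
      also have "\<dots> \<le> (\<Sum>n. s (n + m) \<omega>)"
        by (intro suminf_le abs s block_le that)
      finally show ?thesis .
    qed
    finally show ?thesis .
  qed

  have bounded: "bounded ((\<lambda>f. G f \<omega>) ` F)" for \<omega>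
  proof (cases "good \<omega>")
    case True
    then show ?thesis
      using G_tail[OF _ True, of _ 0] by (intro boundedI[of _ "\<Sum>n. s n \<omega>"]) auto
  next
    case False
    then show ?thesis by (intro boundedI[of _ 0]) (auto simp: G_def)
  qed

  \<comment> \<open>Tails are small uniformly over \<open>F\<close>, and the finitely many remaining
    terms are Lipschitz in \<open>bb_rho\<close> with a constant \<open>L\<close> depending on the
    sample.\<close>
  have continuous: "\<exists>\<delta>>0. \<forall>f\<in>F. \<forall>g\<in>F. bb_rho P f g < \<delta> \<longrightarrow> \<bar>G f \<omega> - G g \<omega>\<bar> < \<eta>" if "\<eta> > 0" for \<omega> \<eta>
  proof (cases "good \<omega>")
    case True
    have "(\<lambda>m. \<Sum>n. s (n + m) \<omega>) \<longlonglongrightarrow> 0"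
      using suminf_exist_split2[OF s_summable[OF True]] by simp
    then have "\<forall>\<^sub>F m in sequentially. (\<Sum>n. s (n + m) \<omega>) < \<eta> / 3"
      using that by (intro order_tendstoD(2)) auto
    then obtain m where m: "(\<Sum>n. s (n + m) \<omega>) < \<eta> / 3"
      by (auto simp: eventually_sequentially)
    define L where "L = (\<Sum>j\<in>{1..<a m}. \<bar>\<xi> j \<omega>\<bar>)"
    have L: "L \<ge> 0" unfolding L_def by (rule sum_nonneg) simp
    \<comment> \<open>The summand 1 avoids division by 0 if \<open>L = 0\<close>.\<close>
    define \<delta> where "\<delta> = \<eta> / (3 * (L + 1))"
    have "\<delta> > 0" using that L by (simp add: \<delta>_def)
    moreover have "\<bar>G f \<omega> - G g \<omega>\<bar> < \<eta>" if fg: "f \<in> F" "g \<in> F" "bb_rho P f g < \<delta>" for f g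
    proof -
      have partial: "(\<Sum>n<m. block (J n) f \<omega>) = block {1..<a m} f \<omega>" for f
        unfolding block_def by (rule J_Union)
      have "\<bar>block {1..<a m} f \<omega> - block {1..<a m} g \<omega>\<bar> \<le> bb_rho P f g * L"
        unfolding L_def by (rule block_lipschitz[OF fg(1,2)]) auto
      also have "\<dots> \<le> \<delta> * (L + 1)"
        using fg(3) L \<open>\<delta> > 0\<close> by (intro mult_mono) auto
      also have "\<dots> = \<eta> / 3" using L by (simp add: \<delta>_def field_simps)
      finally show ?thesis
        using G_tail[OF fg(1) True, of m] G_tail[OF fg(2) True, of m] m unfolding partial by linarith
    qed
    ultimately show ?thesis by blast
  next
    case False
    then show ?thesis using that by (intro exI[of _ 1]) (auto simp: G_def)
  qed

  \<comment> \<open>A linear combination is an almost sure limit of finite Gaussian sums;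
    characteristic functions pass to the limit, and the variances converge by Parseval's
    identity.\<close>
  have normal: "centered_normal_rv gauss_noise (\<lambda>\<omega>. \<Sum>f\<in>U. b f * G f \<omega>)
      (\<Sum>f\<in>U. \<Sum>g\<in>U. b f * b g * bb_cov P f g)" if U: "finite U" "U \<subseteq> F" for U b
  proof (rule gauss.centered_normal_rv_of_char)
    define h where "h x = (\<Sum>f\<in>U. b f * f x)" for x
    have h: "L2fun P h"
      unfolding h_def using U by (intro L2fun_sum L2fun_cmult F_L2) auto
    define v where "v = (\<Sum>f\<in>U. \<Sum>g\<in>U. b f * b g * bb_cov P f g)"
    have v: "v = (\<integral>x. (h x - (\<integral>y. h y \<partial>P))\<^sup>2 \<partial>P)"
      unfolding v_def h_def by (rule bb_cov_sum[OF U])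
    show "(\<Sum>f\<in>U. \<Sum>g\<in>U. b f * b g * bb_cov P f g) \<ge> 0"
      unfolding v_def[symmetric] v by simp
    show "(\<lambda>\<omega>. \<Sum>f\<in>U. b f * G f \<omega>) \<in> borel_measurable gauss_noise" by measurable
    define X where "X m \<omega> = block {1..<a m} h \<omega>" for m \<omega>
    have [measurable]: "X m \<in> borel_measurable gauss_noise" for m
      unfolding X_def by measurable
    have coef_h: "(\<integral>x. h x * e j x \<partial>P) = (\<Sum>f\<in>U. b f * (\<integral>x. f x * e j x \<partial>P))" for j
    proof -
      have "(\<integral>x. h x * e j x \<partial>P) = (\<integral>x. (\<Sum>f\<in>U. b f * (f x * e j x)) \<partial>P)"
        by (simp add: h_def sum_distrib_right mult.assoc)
      also have "\<dots> = (\<Sum>f\<in>U. b f * (\<integral>x. f x * e j x \<partial>P))"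
        using U by (subst Bochner_Integration.integral_sum)
          (auto intro!: integrable_mult_right L2fun_mult L2_e F_L2)
      finally show ?thesis .
    qed
    have X_eq: "X m \<omega> = (\<Sum>f\<in>U. b f * (\<Sum>n<m. block (J n) f \<omega>))" for m \<omega>
    proof -
      have "X m \<omega> = (\<Sum>j\<in>{1..<a m}. \<Sum>f\<in>U. b f * ((\<integral>x. f x * e j x \<partial>P) * \<xi> j \<omega>))"
        by (simp add: X_def block_def coef_h sum_distrib_right mult.assoc)
      also have "\<dots> = (\<Sum>f\<in>U. b f * block {1..<a m} f \<omega>)"
        by (subst sum.swap) (simp add: block_def sum_distrib_left)
      also have "\<dots> = (\<Sum>f\<in>U. b f * (\<Sum>n<m. block (J n) f \<omega>))"
        by (simp add: block_def J_Union)
      finally show ?thesis .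
    qed
    have X_lim: "AE \<omega> in gauss_noise. (\<lambda>m. X m \<omega>) \<longlonglongrightarrow> (\<Sum>f\<in>U. b f * G f \<omega>)"
      using good_AE
    proof eventually_elim
      case (elim \<omega>)
      then have good: "good \<omega>" by (simp add: good_def)
      have "(\<lambda>m. \<Sum>n<m. block (J n) f \<omega>) \<longlonglongrightarrow> G f \<omega>" if "f \<in> F" for f
        using summable_LIMSEQ[OF block_summable[OF that good]] good by (simp add: G_def)
      then show ?case unfolding X_eq using U by (intro tendsto_intros) auto
    qed
    have char_X: "char (distr gauss_noise borel (X m)) t
      = complex_of_real (exp (- ((\<Sum>j\<in>{1..<a m}. (\<integral>x. h x * e j x \<partial>P)\<^sup>2) * t\<^sup>2) / 2))" for m t
      using char_gauss_noise_sum[OF _ inj_const, of "{1..<a m}" "\<lambda>j. \<integral>x. h x * e j x \<partial>P" t]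
      unfolding X_def block_def \<xi>_def by simp
    have v_lim: "(\<lambda>m. \<Sum>j\<in>{1..<a m}. (\<integral>x. h x * e j x \<partial>P)\<^sup>2) \<longlonglongrightarrow> v"
    proof -
      have "(\<lambda>m. \<Sum>j<m. (\<integral>x. h x * e (Suc j) x \<partial>P)\<^sup>2) \<longlonglongrightarrow> v"
        using parseval_centered[OF h] by (simp add: sums_def v)
      \<comment> \<open>The indices from 1 below \<open>a m\<close> are \<open>a m - 1\<close> terms
        of the series shifted by one.\<close>
      moreover have "filterlim (\<lambda>m. a m - 1) sequentially sequentially"
      proof (rule filterlim_at_top_mono)
        show "filterlim (\<lambda>m::nat. m - 1) sequentially sequentially"
          by (rule filterlim_minus_const_nat_at_top)
        show "\<forall>\<^sub>F m in sequentially. m - 1 \<le> a m - 1"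
          using a(3) by (intro always_eventually allI diff_le_mono)
      qed
      ultimately have "(\<lambda>m. \<Sum>j<a m - 1. (\<integral>x. h x * e (Suc j) x \<partial>P)\<^sup>2) \<longlonglongrightarrow> v"
        by (rule filterlim_compose)
      moreover have "(\<Sum>j<a m - 1. (\<integral>x. h x * e (Suc j) x \<partial>P)\<^sup>2) = (\<Sum>j\<in>{1..<a m}. (\<integral>x. h x * e j x \<partial>P)\<^sup>2)" for m
      proof -
        have "a m \<ge> 1" using monoD[OF a(2), of 0 m] a(1) by simp
        then show ?thesis
          using sum.shift_bounds_Suc_ivl[of "\<lambda>j. (\<integral>x. h x * e j x \<partial>P)\<^sup>2" 0 "a m - 1"]
          by (simp add: atLeast0LessThan)
      qed
      ultimately show ?thesis by simp
    qed
    fix t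
    have "(\<lambda>m. char (distr gauss_noise borel (X m)) t) \<longlonglongrightarrow> char (distr gauss_noise borel (\<lambda>\<omega>. \<Sum>f\<in>U. b f * G f \<omega>)) t"
    proof -
      have "(\<lambda>m. (CLINT \<omega>|gauss_noise. iexp (t * X m \<omega>))) \<longlonglongrightarrow> (CLINT \<omega>|gauss_noise. iexp (t * (\<Sum>f\<in>U. b f * G f \<omega>)))"
      proof (rule integral_dominated_convergence[where w = "\<lambda>_. 1"])
        show "AE \<omega> in gauss_noise. (\<lambda>m. iexp (t * X m \<omega>)) \<longlonglongrightarrow> iexp (t * (\<Sum>f\<in>U. b f * G f \<omega>))"
          using X_lim by eventually_elim (intro tendsto_intros)
      qed auto
      then show ?thesis by (simp add: char_def integral_distr)
    qed
    moreover have "(\<lambda>m. char (distr gauss_noise borel (X m)) t) \<longlonglongrightarrow> complex_of_real (exp (- (v * t\<^sup>2) / 2))"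
      unfolding char_X by (intro tendsto_intros v_lim) simp
    ultimately show "char (distr gauss_noise borel (\<lambda>\<omega>. \<Sum>f\<in>U. b f * G f \<omega>)) t
       = complex_of_real (exp (- ((\<Sum>f\<in>U. \<Sum>g\<in>U. b f * b g * bb_cov P f g) * t\<^sup>2) / 2))"
      unfolding v_def[symmetric] by (rule LIMSEQ_unique)
  qed

  show ?thesis
    unfolding pregaussian_def
  proof (intro conjI exI[of _ gauss_noise] exI[of _ G] ballI allI impI)
    show "f \<in> borel_measurable P" "integrable P (\<lambda>x. (f x)\<^sup>2)" if "f \<in> F" for f
      using F_L2[OF that] by (auto simp: L2fun_def)
    show "\<exists>\<delta>>0. \<forall>f\<in>F. \<forall>g\<in>F. bb_rho P f g < \<delta> \<longrightarrow> \<bar>G f \<omega> - G g \<omega>\<bar> < \<eta>" if "\<eta> > 0" for \<omega> \<eta>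
      by (rule continuous[OF that])
  qed (auto intro: normal bounded gauss.prob_space_axioms)
qed

end

section \<open>Weighted densities\<close>

text \<open>Finite intersections of a countable base.\<close>

lemma borel_countable_Int_stable_generator:
  obtains E :: "'a::second_countable_topology set set"
  where "countable E" "Int_stable E" "E \<subseteq> sets borel" "sets borel = sigma_sets UNIV E"
proof -
  obtain B :: "'a set set" where B: "countable B" "topological_basis B"
    using ex_countable_basis by blast
  define E where "E = Inter ` {F. finite F \<and> F \<subseteq> B}"
  have "countable E"
    unfolding E_def by (intro countable_image countable_Collect_finite_subset B)
  moreover have "Int_stable E"
    unfolding Int_stable_def E_def
  proof (intro ballI)
    fix S T assume "S \<in> Inter ` {F. finite F \<and> F \<subseteq> B}" "T \<in> Inter ` {F. finite F \<and> F \<subseteq> B}"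
    then obtain F G where "S = \<Inter>F" "T = \<Inter>G" "finite F" "finite G" "F \<subseteq> B" "G \<subseteq> B" by auto
    then show "S \<inter> T \<in> Inter ` {F. finite F \<and> F \<subseteq> B}"
      by (intro image_eqI[of _ _ "F \<union> G"]) auto
  qed
  moreover have E_borel: "E \<subseteq> sets borel"
    using B(2) unfolding E_def by (auto intro!: borel_open open_Inter simp: topological_basis_open subset_eq)
  moreover have "sets borel = sigma_sets UNIV E"
  proof
    have "B \<subseteq> E" unfolding E_def by (auto intro!: image_eqI[of _ _ "{_}"])
    then have "sigma_sets UNIV B \<subseteq> sigma_sets UNIV E" by (rule sigma_sets_mono')
    moreover have "sets borel = sigma_sets UNIV B"
      by (subst borel_eq_countable_basis[OF B]) simp
    ultimately show "sets borel \<subseteq> sigma_sets UNIV E" by simp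
    show "sigma_sets UNIV E \<subseteq> sets borel"
      using sets.sigma_sets_subset[OF E_borel] by simp
  qed
  ultimately show ?thesis by (rule that)
qed

text \<open>The density is bounded in terms of \<open>1 + norm x\<close>, the form of weight used in
  Peetre's inequality, and P is kept on the Lebesgue sets.\<close>

locale besov_weighted = besov_ball \<phi>0 p s for \<phi>0 :: "'a::euclidean_space \<Rightarrow> real" and p s :: real +
  fixes \<phi> :: "'a \<Rightarrow> real" and C\<phi> :: real
  assumes measurable_\<phi> [measurable]: "\<phi> \<in> borel_measurable lebesgue"
    and \<phi>_nonneg: "\<phi> x \<ge> 0"
    and prob_\<phi>: "prob_space (density lebesgue (\<lambda>x. ennreal (\<phi> x)))"
    and C\<phi>: "C\<phi> \<ge> 0"
    and \<phi>_bound: "AE x in lebesgue. \<phi> x \<le> C\<phi> / (1 + norm x) ^ DIM('a)"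
begin

abbreviation P :: "'a measure" where "P \<equiv> density lebesgue (\<lambda>x. ennreal (\<phi> x))"

sublocale P: prob_space P by (rule prob_\<phi>)

lemma AE_P:
  assumes "AE x in lborel. Q x" shows "AE x in P. Q x"
proof -
  have "AE x in lebesgue. Q x" using assms by (rule AE_completion)
  then show ?thesis by (subst AE_density) (auto elim: eventually_mono)
qed

lemma measurable_lebesgueI: "f \<in> borel_measurable borel \<Longrightarrow> f \<in> borel_measurable lebesgue"
  by (rule measurable_completion) simp

lemma integral_P:
  fixes f :: "'a \<Rightarrow> 'b::{banach, second_countable_topology}"
  shows "f \<in> borel_measurable lebesgue \<Longrightarrow> integral\<^sup>L P f = (\<integral>x. \<phi> x *\<^sub>R f x \<partial>lebesgue)"
  by (rule integral_density) (auto simp: \<phi>_nonneg)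

lemma \<phi>_le: "AE x in lebesgue. \<phi> x \<le> C\<phi>"
  using \<phi>_bound
proof eventually_elim
  case (elim x)
  have "1 \<le> (1 + norm x) ^ DIM('a)" by (rule one_le_power) simp
  then have "C\<phi> / (1 + norm x) ^ DIM('a) \<le> C\<phi> / 1" using C\<phi>
    by (intro divide_left_mono) (auto simp: add_pos_nonneg)
  with elim show ?case by simp
qed

text \<open>Boundedness of \<open>\<phi>\<close> gives (\<phi> h)^2 <= C\<phi> \<phi> h^2. Integrals
  against P thus become Lebesgue integrals against a square-integrable Borel function, as the
  duality bound requires.\<close>

lemma density_times_L2:
  assumes h: "L2fun P h"
  obtains g where "g \<in> borel_measurable borel" "AE x in lborel. \<phi> x * h x = g x" "integrable lborel (\<lambda>x. (g x)\<^sup>2)"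
proof -
  have [measurable]: "h \<in> borel_measurable lebesgue" using h by (simp add: L2fun_def)
  have "(\<lambda>x. \<phi> x * h x) \<in> borel_measurable lebesgue" by measurable
  from completion_ex_borel_measurable_real[OF this]
  obtain g where g [measurable]: "g \<in> borel_measurable borel" and eq: "AE x in lborel. \<phi> x * h x = g x"
    by auto
  note [measurable] = measurable_lebesgueI[OF g]
  have "integrable lebesgue (\<lambda>x. \<phi> x *\<^sub>R (h x)\<^sup>2)"
    using h by (subst (asm) L2fun_def, subst (asm) integrable_density) (auto simp: \<phi>_nonneg)
  then have int: "integrable lebesgue (\<lambda>x. C\<phi> * (\<phi> x * (h x)\<^sup>2))" by simp
  have "integrable lebesgue (\<lambda>x. (\<phi> x * h x)\<^sup>2)"
  proof (rule Bochner_Integration.integrable_bound[OF int])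
    show "AE x in lebesgue. norm ((\<phi> x * h x)\<^sup>2) \<le> norm (C\<phi> * (\<phi> x * (h x)\<^sup>2))"
      using \<phi>_le
    proof eventually_elim
      case (elim x)
      have "\<phi> x * (\<phi> x * (h x)\<^sup>2) \<le> C\<phi> * (\<phi> x * (h x)\<^sup>2)"
        using elim \<phi>_nonneg[of x] by (intro mult_right_mono) auto
      then show ?case using \<phi>_nonneg[of x] C\<phi> by (simp add: power_mult_distrib power2_eq_square mult_ac)
    qed
  qed measurable
  then have "integrable lebesgue (\<lambda>x. (g x)\<^sup>2)"
    by (rule integrable_cong_AE_imp) (use AE_completion[OF eq] in auto)
  then show ?thesis
    using eq by (intro that[of g]) (auto simp: integrable_completion)
qed

lemma integral_P_times:
  fixes h g :: "'a \<Rightarrow> real" and u u' :: "'a \<Rightarrow> complex"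
  assumes h: "h \<in> borel_measurable lebesgue" and g: "g \<in> borel_measurable borel" and eq: "AE x in lborel. \<phi> x * h x = g x"
    and u: "u \<in> borel_measurable lebesgue" and u': "u' \<in> borel_measurable borel" and u_eq: "AE x in lborel. u x = u' x"
  shows "(CLINT x|P. u x * complex_of_real (h x)) = (CLINT x|lborel. u' x * complex_of_real (g x))"
proof -
  note [measurable] = h g u u' measurable_lebesgueI[OF g] measurable_lebesgueI[OF u']
  have "(CLINT x|P. u x * complex_of_real (h x)) = (CLINT x|lebesgue. \<phi> x *\<^sub>R (u x * complex_of_real (h x)))"
    by (rule integral_P) measurable
  also have "\<dots> = (CLINT x|lebesgue. u' x * complex_of_real (g x))"
  proof (rule integral_cong_AE)
    show "AE x in lebesgue. \<phi> x *\<^sub>R (u x * complex_of_real (h x)) = u' x * complex_of_real (g x)"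
      using AE_completion[OF eq] AE_completion[OF u_eq]
    proof eventually_elim
      case (elim x)
      show ?case unfolding elim(2) elim(1)[symmetric] by (simp add: scaleR_conv_of_real mult_ac)
    qed
  qed measurable
  also have "\<dots> = (CLINT x|lborel. u' x * complex_of_real (g x))"
    by (rule integral_completion) simp
  finally show ?thesis .
qed

lemma nn_integral_P_le:
  assumes [measurable]: "u \<in> borel_measurable borel" and u: "\<And>x. u x \<ge> 0"
  shows "(\<integral>\<^sup>+x. ennreal (u x) \<partial>P) \<le> (\<integral>\<^sup>+x. ennreal (u x * (C\<phi> / (1 + norm x) ^ DIM('a))) \<partial>lborel)"
proof -
  have [measurable]: "u \<in> borel_measurable lebesgue" by (rule measurable_lebesgueI) simp
  have "(\<integral>\<^sup>+x. ennreal (u x) \<partial>P) = (\<integral>\<^sup>+x. ennreal (\<phi> x) * ennreal (u x) \<partial>lebesgue)"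
    by (rule nn_integral_density) measurable
  also have "\<dots> \<le> (\<integral>\<^sup>+x. ennreal (u x * (C\<phi> / (1 + norm x) ^ DIM('a))) \<partial>lebesgue)"
  proof (rule nn_integral_mono_AE)
    show "AE x in lebesgue. ennreal (\<phi> x) * ennreal (u x) \<le> ennreal (u x * (C\<phi> / (1 + norm x) ^ DIM('a)))"
      using \<phi>_bound
    proof eventually_elim
      case (elim x)
      have "\<phi> x * u x \<le> u x * (C\<phi> / (1 + norm x) ^ DIM('a))"
        using mult_left_mono[OF elim u[of x]] by (simp only: mult.commute)
      then show ?case using \<phi>_nonneg u by (simp add: ennreal_leI flip: ennreal_mult)
    qed
  qed
  also have "\<dots> = (\<integral>\<^sup>+x. ennreal (u x * (C\<phi> / (1 + norm x) ^ DIM('a))) \<partial>lborel)"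
    by (rule nn_integral_completion)
  finally show ?thesis .
qed

lemma measurable_dual_kernel [measurable]: "dual_kernel \<eta> z \<in> borel_measurable borel"
  by (cases z) (simp add: dual_kernel_def)

lemma measurable_dual_kernel_pair:
  "(\<lambda>(z, x). dual_kernel \<eta> z x) \<in> borel_measurable ((count_space UNIV \<Otimes>\<^sub>M lborel) \<Otimes>\<^sub>M P)"
proof -
  \<comment> \<open>The sets of \<open>P\<close> are the Lebesgue sets, so Borel measurability is
    routed through the identity.\<close>
  have [measurable]: "(\<lambda>x. x) \<in> borel_measurable P"
    using measurable_lebesgueI[of "\<lambda>x. x"] by simp
  have [measurable]: "(\<lambda>w. snd w) \<in> borel_measurable ((count_space (UNIV :: nat set) \<Otimes>\<^sub>M (lborel :: 'a measure)) \<Otimes>\<^sub>M P)"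
    using measurable_compose[OF measurable_snd \<open>(\<lambda>x. x) \<in> borel_measurable P\<close>] .
  have "(\<lambda>w. complex_of_real (2 powr (- (real k * (DIM('a) / 2 + \<eta>)))) * Psi (Suc k) (snd w - snd (fst w)))
     \<in> borel_measurable ((count_space (UNIV :: nat set) \<Otimes>\<^sub>M lborel) \<Otimes>\<^sub>M P)" for k
    by measurable
  moreover have "(\<lambda>w. fst (fst w)) \<in> ((count_space (UNIV :: nat set) \<Otimes>\<^sub>M (lborel :: 'a measure)) \<Otimes>\<^sub>M P) \<rightarrow>\<^sub>M count_space UNIV"
    by measurable
  ultimately have "(\<lambda>w. complex_of_real (2 powr (- (real (fst (fst w)) * (DIM('a) / 2 + \<eta>)))) * Psi (Suc (fst (fst w))) (snd w - snd (fst w)))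
     \<in> borel_measurable ((count_space (UNIV :: nat set) \<Otimes>\<^sub>M lborel) \<Otimes>\<^sub>M P)"
    by (rule measurable_compose_countable)
  then show ?thesis by (simp add: dual_kernel_def split_beta)
qed

text \<open>The growth 2^(k d) in \<open>Psi_weighted_L2\<close> is cancelled by the squared scaling
  factor; 2^(-2 k \<eta>) and the weight at the centre \<open>y\<close> remain.\<close>

lemma dual_kernel_L2:
  obtains C where "C \<ge> 0" "\<And>k y. integrable P (\<lambda>x. (norm (dual_kernel \<eta> (k, y) x))\<^sup>2)"
    "\<And>k y. (\<integral>x. (norm (dual_kernel \<eta> (k, y) x))\<^sup>2 \<partial>P) \<le> C * (2 powr (- (real k * (2 * \<eta>)))) / (1 + norm y) ^ DIM('a)"
proof -
  let ?d = "DIM('a)"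
  obtain C where C: "C \<ge> 0" "\<And>K x. (\<integral>\<^sup>+ y. ennreal ((norm (Psi K (y - x)))\<^sup>2 * (C\<phi> / (1 + norm y) ^ ?d)) \<partial>lborel)
    \<le> ennreal (C * 2 ^ (K * ?d) / (1 + norm x) ^ ?d)"
    by (rule Psi_weighted_L2[OF C\<phi>]) blast
  have "integrable P (\<lambda>x. (norm (dual_kernel \<eta> (k, y) x))\<^sup>2) \<and>
    (\<integral>x. (norm (dual_kernel \<eta> (k, y) x))\<^sup>2 \<partial>P) \<le> (C * 2 ^ ?d) * (2 powr (- (real k * (2 * \<eta>)))) / (1 + norm y) ^ ?d" for k y
  proof -
    define w where "w = (2 powr (- (real k * (?d / 2 + \<eta>))))\<^sup>2"
    have w: "w \<ge> 0" by (simp add: w_def)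
    have meas: "dual_kernel \<eta> (k, y) \<in> borel_measurable P"
      using measurable_lebesgueI[OF measurable_dual_kernel] by simp
    have sq: "(norm (dual_kernel \<eta> (k, y) x))\<^sup>2 = w * (norm (Psi (Suc k) (x - y)))\<^sup>2" for x
      by (simp add: dual_kernel_def norm_mult power_mult_distrib w_def)
    have "(\<integral>\<^sup>+x. ennreal ((norm (dual_kernel \<eta> (k, y) x))\<^sup>2) \<partial>P)
      = (\<integral>\<^sup>+x. ennreal w * ennreal ((norm (Psi (Suc k) (x - y)))\<^sup>2) \<partial>P)"
      unfolding sq using w by (simp add: ennreal_mult)
    also have "\<dots> = ennreal w * (\<integral>\<^sup>+x. ennreal ((norm (Psi (Suc k) (x - y)))\<^sup>2) \<partial>P)"
    proof (rule nn_integral_cmult)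
      have "(\<lambda>x. (norm (Psi (Suc k) (x - y)))\<^sup>2) \<in> borel_measurable lebesgue"
        by (rule measurable_lebesgueI) measurable
      then show "(\<lambda>x. ennreal ((norm (Psi (Suc k) (x - y)))\<^sup>2)) \<in> borel_measurable P"
        by simp
    qed
    also have "\<dots> \<le> ennreal w * ennreal (C * 2 ^ (Suc k * ?d) / (1 + norm y) ^ ?d)"
      by (intro mult_left_mono order_trans[OF nn_integral_P_le C(2)]) auto
    also have "\<dots> = ennreal (w * (C * 2 ^ (Suc k * ?d) / (1 + norm y) ^ ?d))"
      using w C(1) by (intro ennreal_mult[symmetric]) auto
    finally have le: "(\<integral>\<^sup>+x. ennreal ((norm (dual_kernel \<eta> (k, y) x))\<^sup>2) \<partial>P) \<le> ennreal (w * (C * 2 ^ (Suc k * ?d) / (1 + norm y) ^ ?d))" .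
    have int: "integrable P (\<lambda>x. (norm (dual_kernel \<eta> (k, y) x))\<^sup>2)"
      using meas le by (intro integrableI_nonneg) (auto intro: le_less_trans)
    have "ennreal (\<integral>x. (norm (dual_kernel \<eta> (k, y) x))\<^sup>2 \<partial>P) \<le> ennreal (w * (C * 2 ^ (Suc k * ?d) / (1 + norm y) ^ ?d))"
      using le by (subst nn_integral_eq_integral[OF int, symmetric]) auto
    then have "(\<integral>x. (norm (dual_kernel \<eta> (k, y) x))\<^sup>2 \<partial>P) \<le> w * (C * 2 ^ (Suc k * ?d) / (1 + norm y) ^ ?d)"
      using w C(1) by (subst (asm) ennreal_le_iff) auto
    also have "w * (C * 2 ^ (Suc k * ?d) / (1 + norm y) ^ ?d) = (C * 2 ^ ?d) * (w * 2 ^ (k * ?d)) / (1 + norm y) ^ ?d"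
      by (simp add: power_add mult_ac)
    also have "w * 2 ^ (k * ?d) = 2 powr (- (real k * (2 * \<eta>)))"
    proof -
      have "w = 2 powr (- (real k * (?d / 2 + \<eta>)) + - (real k * (?d / 2 + \<eta>)))"
        by (simp only: w_def power2_eq_square powr_add)
      moreover have "(2::real) ^ (k * ?d) = 2 powr (real k * ?d)"
        by (simp flip: powr_realpow)
      ultimately have "w * 2 ^ (k * ?d) = 2 powr ((- (real k * (?d / 2 + \<eta>)) + - (real k * (?d / 2 + \<eta>))) + real k * ?d)"
        by (simp only: powr_add)
      also have "(- (real k * (?d / 2 + \<eta>)) + - (real k * (?d / 2 + \<eta>))) + real k * ?d = - (real k * (2 * \<eta>))"
        by (simp add: algebra_simps)
      finally show ?thesis .
    qed
    finally show ?thesis using int by simp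
  qed
  then show ?thesis using C(1) by (intro that[of "C * 2 ^ ?d"]) auto
qed

text \<open>The power r/2 turns the borderline weight of order d into one of order d r/2 > d, which
  is integrable; the sum over levels is geometric since \<eta> > 0.\<close>

lemma dual_kernel_finite:
  assumes \<eta>: "\<eta> > 0" and r: "r > 2"
  shows "(\<integral>\<^sup>+z. ennreal ((\<integral>x. (norm (dual_kernel \<eta> z x))\<^sup>2 \<partial>P) powr (r / 2)) \<partial>(count_space UNIV \<Otimes>\<^sub>M lborel)) < \<infinity>"
proof -
  let ?d = "real DIM('a)"
  obtain C where C: "C \<ge> 0"
    "\<And>k y. (\<integral>x. (norm (dual_kernel \<eta> (k, y) x))\<^sup>2 \<partial>P) \<le> C * (2 powr (- (real k * (2 * \<eta>)))) / (1 + norm y) ^ DIM('a)"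
    by (rule dual_kernel_L2[of \<eta>]) blast
  define I where "I = (\<integral>\<^sup>+(y::'a). ennreal ((1 + norm y) powr (- (?d * r / 2))) \<partial>lborel)"
  have I: "I < \<infinity>" unfolding I_def using r by (intro nn_integral_polynomial_decay) simp
  have [measurable]: "(\<lambda>z. \<integral>x. (norm (dual_kernel \<eta> z x))\<^sup>2 \<partial>P) \<in> borel_measurable (count_space UNIV \<Otimes>\<^sub>M lborel)"
    using measurable_dual_kernel_pair by measurable
  have "(\<integral>\<^sup>+z. ennreal ((\<integral>x. (norm (dual_kernel \<eta> z x))\<^sup>2 \<partial>P) powr (r / 2)) \<partial>(count_space UNIV \<Otimes>\<^sub>M lborel))
    = (\<Sum>k. \<integral>\<^sup>+y. ennreal ((\<integral>x. (norm (dual_kernel \<eta> (k, y) x))\<^sup>2 \<partial>P) powr (r / 2)) \<partial>lborel)"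
    by (subst lborel.nn_integral_fst[symmetric]) (auto simp: nn_integral_count_space_nat)
  also have "\<dots> \<le> (\<Sum>k. ennreal (C powr (r / 2) * 2 powr (- (real k * (\<eta> * r)))) * I)"
  proof (rule suminf_le)
    fix k
    have div_powr: "x / u powr c = x * u powr (- c)" for x u c :: real
      by (simp add: powr_minus divide_inverse)
    have le: "(\<integral>x. (norm (dual_kernel \<eta> (k, y) x))\<^sup>2 \<partial>P) powr (r / 2) \<le> (C powr (r / 2) * 2 powr (- (real k * (\<eta> * r)))) * (1 + norm y) powr (- (?d * r / 2))" for y
    proof -
      have "(\<integral>x. (norm (dual_kernel \<eta> (k, y) x))\<^sup>2 \<partial>P) powr (r / 2) \<le> (C * (2 powr (- (real k * (2 * \<eta>)))) / (1 + norm y) ^ DIM('a)) powr (r / 2)"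
        using C(2) r by (intro powr_mono2) auto
      also have "\<dots> = C powr (r / 2) * (2 powr (- (real k * (2 * \<eta>)))) powr (r / 2) / ((1 + norm y) ^ DIM('a)) powr (r / 2)"
        using C(1) by (simp add: powr_mult powr_divide)
      also have "(2 powr (- (real k * (2 * \<eta>)))) powr (r / 2) = 2 powr (- (real k * (\<eta> * r)))"
        by (simp add: powr_powr)
      also have "((1 + norm y) ^ DIM('a)) powr (r / 2) = (1 + norm y) powr (?d * r / 2)"
        by (simp add: powr_powr add_pos_nonneg flip: powr_realpow)
      finally show ?thesis by (simp only: div_powr)
    qed
    have "(\<integral>\<^sup>+y. ennreal ((\<integral>x. (norm (dual_kernel \<eta> (k, y) x))\<^sup>2 \<partial>P) powr (r / 2)) \<partial>lborel)
      \<le> (\<integral>\<^sup>+y. ennreal (C powr (r / 2) * 2 powr (- (real k * (\<eta> * r)))) * ennreal ((1 + norm (y::'a)) powr (- (?d * r / 2))) \<partial>lborel)"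
    proof (rule nn_integral_mono)
      fix y :: 'a
      show "ennreal ((\<integral>x. (norm (dual_kernel \<eta> (k, y) x))\<^sup>2 \<partial>P) powr (r / 2))
        \<le> ennreal (C powr (r / 2) * 2 powr (- (real k * (\<eta> * r)))) * ennreal ((1 + norm y) powr (- (?d * r / 2)))"
        by (subst ennreal_mult[symmetric]) (simp_all only: mult_nonneg_nonneg powr_ge_zero ennreal_leI le)
    qed
    also have "\<dots> = ennreal (C powr (r / 2) * 2 powr (- (real k * (\<eta> * r)))) * I"
      unfolding I_def by (rule nn_integral_cmult) measurable
    finally show "(\<integral>\<^sup>+y. ennreal ((\<integral>x. (norm (dual_kernel \<eta> (k, y) x))\<^sup>2 \<partial>P) powr (r / 2)) \<partial>lborel)
       \<le> ennreal (C powr (r / 2) * 2 powr (- (real k * (\<eta> * r)))) * I" .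
  qed auto
  also have "\<dots> = (\<Sum>k. ennreal (C powr (r / 2) * 2 powr (- (real k * (\<eta> * r))))) * I"
    by (rule ennreal_suminf_multc)
  also have "\<dots> < \<infinity>"
  proof -
    have "summable (\<lambda>k::nat. C powr (r / 2) * 2 powr (- (real k * (\<eta> * r))))"
      using \<eta> r by (intro summable_mult powr_neg_summable) auto
    then show ?thesis
      using I by (subst suminf_ennreal2) (auto simp: ennreal_mult_less_top)
  qed
  finally show ?thesis .
qed

text \<open>The chaining criterion with the dual kernels as \<open>\<kappa>\<close>; levels carry
  counting measure, centres Lebesgue measure. Borel versions may be used because P is absolutely
  continuous.\<close>

theorem pregaussian_of_representatives:
  assumes F: "\<And>f. f \<in> F \<Longrightarrow> f \<in> borel_measurable lebesgue"
    "\<And>f. f \<in> F \<Longrightarrow> \<exists>f'\<in>borel_measurable borel. (AE x in lborel. f x = f' x) \<and> in_ball (\<lambda>x. complex_of_real (f' x))"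
  shows "pregaussian P F"
proof -
  obtain t r \<eta> :: real where t: "p \<le> t" "1 < t" "t < 2" and r: "r > 2" and tr: "1 / t + 1 / r = 1"
    and \<eta>: "\<eta> > 0" and \<sigma>_t: "\<sigma> t = DIM('a) / 2 + 2 * \<eta>"
    by (rule exponent_choice)
  obtain C where C: "C \<ge> 0" and dual:
    "\<And>F g. \<lbrakk>in_ball F; g \<in> borel_measurable borel; integrable lborel (\<lambda>x. (g x)\<^sup>2)\<rbrakk> \<Longrightarrow>
      ennreal (norm (CLINT x|lborel. F x * complex_of_real (g x))) \<le> ennreal C *
        (1 + (\<Sum>k. \<integral>\<^sup>+y. ennreal (norm (CLINT x|lborel. dual_kernel \<eta> (k, y) x * complex_of_real (g x)) powr r) \<partial>lborel))"
    using duality_bound_ball[OF t(1,2) r tr \<eta> \<sigma>_t] by blast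
  have L2: "L2fun P f" if f: "f \<in> F" for f
  proof -
    obtain f' where f' [measurable]: "f' \<in> borel_measurable borel" and eq: "AE x in lborel. f x = f' x"
      and ball: "in_ball (\<lambda>x. complex_of_real (f' x))" using F(2)[OF f] by blast
    have [measurable]: "f' \<in> borel_measurable P" using measurable_lebesgueI[OF f'] by simp
    have "(\<integral>\<^sup>+x. ennreal ((f' x)\<^sup>2) \<partial>P) = (\<integral>\<^sup>+x. ennreal (\<phi> x) * ennreal ((f' x)\<^sup>2) \<partial>lebesgue)"
      using measurable_lebesgueI[OF f'] by (intro nn_integral_density) measurable
    also have "\<dots> \<le> (\<integral>\<^sup>+x. ennreal (C\<phi> * (f' x)\<^sup>2) \<partial>lebesgue)"
    proof (rule nn_integral_mono_AE)
      show "AE x in lebesgue. ennreal (\<phi> x) * ennreal ((f' x)\<^sup>2) \<le> ennreal (C\<phi> * (f' x)\<^sup>2)"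
        using \<phi>_le by eventually_elim (auto simp: \<phi>_nonneg mult_right_mono ennreal_leI simp flip: ennreal_mult)
    qed
    also have "\<dots> = ennreal (\<integral>x. C\<phi> * (f' x)\<^sup>2 \<partial>lborel)"
      using ball_L2[OF ball] C\<phi> by (simp add: nn_integral_completion nn_integral_eq_integral)
    finally have "integrable P (\<lambda>x. (f' x)\<^sup>2)"
      by (intro integrableI_nonneg) (auto intro: le_less_trans)
    then have "L2fun P f'" by (simp add: L2fun_def)
    then show ?thesis
      by (rule L2fun_cong_AE) (use AE_P[OF eq] F(1)[OF f] in \<open>auto elim: eventually_mono\<close>)
  qed
  obtain E :: "'a set set" where E: "countable E" "Int_stable E" "E \<subseteq> sets borel" "sets borel = sigma_sets UNIV E"
    by (rule borel_countable_Int_stable_generator)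
  have E_P: "E \<subseteq> sets P" using E(3) by auto
  \<comment> \<open>A Lebesgue set is Borel up to a Lebesgue null set, which is also null for
    \<open>P\<close>.\<close>
  have gen: "\<exists>B\<in>sigma_sets (space P) E. AE x in P. x \<in> A \<longleftrightarrow> x \<in> B" if "A \<in> sets P" for A
  proof -
    have "A \<in> sets (completion lborel)" using that by simp
    then obtain S N N' where A: "A = S \<union> N" "N \<subseteq> N'" "N' \<in> null_sets lborel" "S \<in> sets lborel"
      by (rule sets_completionE)
    have "AE x in lborel. x \<in> A \<longleftrightarrow> x \<in> S"
      using AE_not_in[OF A(3)] by eventually_elim (use A in auto)
    then show ?thesis using A(4) E(4) by (intro bexI[of _ S] AE_P) auto
  qed
  obtain e where e: "orthonormal_system P e" "e 0 = (\<lambda>_. 1)"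
    "\<And>f. L2fun P f \<Longrightarrow> (\<lambda>j. (\<integral>x. f x * e j x \<partial>P)\<^sup>2) sums (\<integral>x. (f x)\<^sup>2 \<partial>P)"
    using P.exists_orthonormal_basis[OF E(1,2) E_P gen] by blast
  interpret orthonormal_system P e by (rule e(1))
  let ?N = "count_space (UNIV :: nat set) \<Otimes>\<^sub>M (lborel :: 'a measure)"
  interpret pair_sigma_finite "count_space (UNIV :: nat set)" "lborel :: 'a measure"
    by (intro pair_sigma_finite.intro sigma_finite_measure_count_space sigma_finite_lborel)
  have bound: "ennreal \<bar>\<integral>x. f x * (\<Sum>j\<in>J. a j * e j x) \<partial>P\<bar> \<le>
      ennreal C * (1 + (\<integral>\<^sup>+ z. ennreal (norm (\<integral>x. dual_kernel \<eta> z x * complex_of_real (\<Sum>j\<in>J. a j * e j x) \<partial>P) powr r) \<partial>?N))"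
    if f: "f \<in> F" and J: "finite J" for f J and a :: "nat \<Rightarrow> real"
  proof -
    define h where "h x = (\<Sum>j\<in>J. a j * e j x)" for x
    have h: "L2fun P h" unfolding h_def by (intro L2fun_sum L2fun_cmult L2_e)
    then have h_meas: "h \<in> borel_measurable lebesgue" by (simp add: L2fun_def)
    obtain g where g [measurable]: "g \<in> borel_measurable borel" and gh: "AE x in lborel. \<phi> x * h x = g x"
      and g2: "integrable lborel (\<lambda>x. (g x)\<^sup>2)"
      by (rule density_times_L2[OF h])
    obtain f' where f' [measurable]: "f' \<in> borel_measurable borel" and ff': "AE x in lborel. f x = f' x"
      and ball: "in_ball (\<lambda>x. complex_of_real (f' x))" using F(2)[OF f] by blast
    \<comment> \<open>The duality bound is stated for Lebesgue measure; on both of its sides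
      \<open>h\<close> under \<open>P\<close> is exchanged for the Borel version \<open>g\<close> of
      \<open>\<phi> x * h x\<close>.\<close>
    have kernel: "(CLINT x|lborel. dual_kernel \<eta> z x * complex_of_real (g x)) = (\<integral>x. dual_kernel \<eta> z x * complex_of_real (h x) \<partial>P)" for z
      by (rule integral_P_times[OF h_meas g gh, symmetric]) (auto intro: measurable_lebesgueI)
    have "complex_of_real (\<integral>x. f x * h x \<partial>P) = (CLINT x|P. complex_of_real (f x) * complex_of_real (h x))"
      by (simp only: integral_complex_of_real[symmetric] of_real_mult)
    also have "\<dots> = (CLINT x|lborel. complex_of_real (f' x) * complex_of_real (g x))"
      by (rule integral_P_times[OF h_meas g gh]) (use F(1)[OF f] f' ff' in \<open>auto elim: eventually_mono\<close>)
    finally have "\<bar>\<integral>x. f x * h x \<partial>P\<bar> = norm (CLINT x|lborel. complex_of_real (f' x) * complex_of_real (g x))"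
      by (metis norm_of_real real_norm_def)
    then have "ennreal \<bar>\<integral>x. f x * h x \<partial>P\<bar> \<le> ennreal C *
        (1 + (\<Sum>k. \<integral>\<^sup>+y. ennreal (norm (CLINT x|lborel. dual_kernel \<eta> (k, y) x * complex_of_real (g x)) powr r) \<partial>lborel))"
      using dual[OF ball g g2] by simp
    note this[unfolded kernel]
    also have "(\<Sum>k. \<integral>\<^sup>+y. ennreal (norm (\<integral>x. dual_kernel \<eta> (k, y) x * complex_of_real (h x) \<partial>P) powr r) \<partial>lborel)
      = (\<integral>\<^sup>+ z. ennreal (norm (\<integral>x. dual_kernel \<eta> z x * complex_of_real (h x) \<partial>P) powr r) \<partial>?N)"
    proof -
      have [measurable]: "h \<in> borel_measurable P" using h by (simp add: L2fun_def)
      note [measurable] = measurable_dual_kernel_pair[of \<eta>]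
      have [measurable]: "(\<lambda>z. \<integral>x. dual_kernel \<eta> z x * complex_of_real (h x) \<partial>P) \<in> borel_measurable ?N"
        by measurable
      show ?thesis
        by (subst lborel.nn_integral_fst[symmetric]) (auto simp: nn_integral_count_space_nat)
    qed
    finally show ?thesis unfolding h_def .
  qed
  have "gaussian_chaining P e F ?N (dual_kernel \<eta>) r C"
  proof (intro gaussian_chaining.intro gaussian_chaining_axioms.intro)
    show "orthonormal_system P e" by (rule e(1))
    show "integrable P (\<lambda>x. (norm (dual_kernel \<eta> z x))\<^sup>2)" for z
    proof (cases z)
      case (Pair k y)
      then show ?thesis using dual_kernel_L2 by blast
    qed
    show "(\<integral>\<^sup>+z. ennreal ((\<integral>x. (norm (dual_kernel \<eta> z x))\<^sup>2 \<partial>P) powr (r / 2)) \<partial>?N) < \<infinity>"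
      by (rule dual_kernel_finite[OF \<eta> r])
    show "sigma_finite_measure ?N" ..
  qed (use e L2 r C bound measurable_dual_kernel_pair in auto)
  then show ?thesis by (rule gaussian_chaining.pregaussian)
qed

end

theorem theorem5:
  fixes \<phi>0 :: "'a::euclidean_space \<Rightarrow> real"
    and s p :: real and q :: ennreal
    and \<U> :: "('a \<Rightarrow> real) set"
    and \<phi> :: "'a \<Rightarrow> real"
  assumes phi0: "admissible_phi0 \<phi>0"
    and p: "1 \<le> p" "p < 2"
    and q: "1 \<le> q"
    and s: "s > real DIM('a) / 2"
    and U_reps: "\<forall>f\<in>\<U>. in_besov_unit_ball \<phi>0 s p q f"
    and U_all: "\<forall>g. in_besov_unit_ball \<phi>0 s p q g \<longrightarrow>
                  (\<exists>!f. f \<in> \<U> \<and> (AE x in lebesgue. f x = g x))"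
    and dens_meas: "\<phi> \<in> borel_measurable lebesgue"
    and dens_nonneg: "\<forall>x. \<phi> x \<ge> 0"
    and prob: "prob_space (density lebesgue (\<lambda>x. ennreal (\<phi> x)))"
    and dens_bound: "\<exists>C. AE x in lebesgue.
                       \<bar>\<phi> x * (1 + (norm x)\<^sup>2) powr (real DIM('a) / 2)\<bar> \<le> C"
  shows "pregaussian (density lebesgue (\<lambda>x. ennreal (\<phi> x))) \<U>"
proof -
  let ?d = "real DIM('a)"
  obtain C where C: "AE x in lebesgue. \<bar>\<phi> x * (1 + (norm x)\<^sup>2) powr (?d / 2)\<bar> \<le> C"
    using dens_bound by blast
  \<comment> \<open>The factor comes from (1 + u)^2 <= 2 (1 + u^2) raised to the power d/2;
    \<open>max\<close> makes the constant nonnegative.\<close>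
  define C' where "C' = max C 0 * 2 powr (?d / 2)"
  have bound: "AE x in lebesgue. \<phi> x \<le> C' / (1 + norm x) ^ DIM('a)"
    using C
  proof eventually_elim
    case (elim x)
    have pos: "1 + norm x > 0" by (simp add: add_pos_nonneg)
    have "(1 + norm x)\<^sup>2 \<le> 2 * (1 + (norm x)\<^sup>2)"
      using sum_squares_bound[of 1 "norm x"] by (simp add: power2_sum)
    then have "((1 + norm x)\<^sup>2) powr (?d / 2) \<le> (2 * (1 + (norm x)\<^sup>2)) powr (?d / 2)"
      by (intro powr_mono2) auto
    moreover have "((1 + norm x)\<^sup>2) powr (?d / 2) = (1 + norm x) ^ DIM('a)"
    proof -
      have "((1 + norm x)\<^sup>2) powr (?d / 2) = ((1 + norm x) powr 2) powr (?d / 2)"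
        using pos by (simp only: powr_numeral)
      also have "\<dots> = (1 + norm x) powr ?d" by (simp only: powr_powr) simp
      finally show ?thesis using pos by (simp add: powr_realpow)
    qed
    ultimately have "(1 + norm x) ^ DIM('a) \<le> 2 powr (?d / 2) * (1 + (norm x)\<^sup>2) powr (?d / 2)"
      by (simp only: powr_mult)
    then have "\<phi> x * (1 + norm x) ^ DIM('a) \<le> \<phi> x * (2 powr (?d / 2) * (1 + (norm x)\<^sup>2) powr (?d / 2))"
      using dens_nonneg by (intro mult_left_mono) auto
    also have "\<dots> = 2 powr (?d / 2) * (\<phi> x * (1 + (norm x)\<^sup>2) powr (?d / 2))" by simp
    also have "\<dots> \<le> 2 powr (?d / 2) * max C 0"
      using elim by (intro mult_left_mono) auto
    finally show ?case using pos by (simp add: C'_def field_simps)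
  qed
  interpret besov_weighted \<phi>0 p s \<phi> C'
  proof (intro besov_weighted.intro besov_ball.intro littlewood_paley.intro besov_ball_axioms.intro
      besov_weighted_axioms.intro phi0 p s dens_meas prob bound)
    show "\<phi> x \<ge> 0" for x using dens_nonneg by blast
    show "C' \<ge> 0" by (simp add: C'_def)
  qed
  show ?thesis
  proof (rule pregaussian_of_representatives)
    fix f assume "f \<in> \<U>"
    then have f: "in_besov_unit_ball \<phi>0 s p q f" using U_reps by blast
    then show "f \<in> borel_measurable lebesgue" by (simp add: in_besov_unit_ball_def)
    show "\<exists>f'\<in>borel_measurable borel. (AE x in lborel. f x = f' x) \<and> in_ball (\<lambda>x. complex_of_real (f' x))"
      using in_ball_representative[OF f q] by blast
  qed
qed

end
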